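(* Consider the extended Erlang--Sevastyanov service process $(X_t)_{t\ge 0}$ described in the context, with arrival intensity $\lambda(\cdot)$ and service intensity $h(\cdot)$. Suppose there exist constants $C_0>0$, $m>1$, $a>1$ and $\ell>0$ such that \[ h(t)\ge \frac{C_0}{1+t}\quad\text{for all } t\ge 0, \] \[ \inf_{y\ge 0}\lambda_0(y)>0,\qquad \Lambda<\infty, \] and \[ C_0>\left(a+\frac{\ell+1}{m}\right)\left(m+\Lambda\, 2^{\,a+\frac{\ell+1}{m}}\right). \] Then the process has a unique stationary (invariant) probability measure $\mu$, and for every $0<k<\ell$ there exists a constant $C>0$ such that for every initial state $X_0=x\in\mathcal S$ and every $t\ge 0$, \[ \|\mu^x_t-\mu\|_{TV}\le C\,\frac{L_{m,\,a+\ell/m}(x)}{(1+t)^{k+1}}, \] where $\mu^x_t$ denotes the distribution of $X_t$ given $X_0=x$ and $\|\cdot\|_{TV}$ is the total variation distance.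
   Context: State space: $\mathcal S=\bigcup_{n\ge 0}\mathcal S_n$ with $\mathcal S_n=\mathbb R_+^{n+1}$; a state is written $x=(n,x^0,x^1,\dots,x^n)$ with $n=n(x)\in\mathbb Z_+$ the number of customers in the system (there are countably many servers, so every customer is served immediately). The coordinates $x^1,\dots,x^n\ge 0$ are the elapsed service times of the $n$ customers present, and $x^0\ge 0$ is the time elapsed since the most recent arrival (for $n\ge 1$ it coincides with one of the $x^i$). Between jumps all coordinates grow at unit speed. New customers arrive with intensity $\lambda(X_t)$, i.e. $P(\text{one arrival in }(t,t+\Delta)\mid X_t)=\lambda(X_t)\Delta+o(\Delta)$; on arrival $n$ increases by one, $x^0$ is reset to $0$, and the new customer receives elapsed service time $0$, placed at each of the positions $1,\dots,n+1$ with equal probability. Write $\lambda_n$ for the restriction of $\lambda$ to $\mathcal S_n$; in particular $\lambda_0(y)$ is the arrival intensity in the empty state $(0,y)$. Service times have distribution function $G$ with density $g=G'$, and each customer present with elapsed service time $x^i$ independently completes service (and leaves) with intensity $h(x^i)$, where $h(t)=g(t)/(1-G(t))$. The process $X_t$ is Markov (and strong Markov) on $\mathcal S$. Notation: $L_{m,a}(x)=\left(\sum_{j=1}^{n(x)}(1+x^j)^m\right)^{a}$ (it does not depend on $x^0$), and $\Lambda=\sup_{x\in\mathcal S}\lambda(x)/(n(x)\vee 1)$.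
   Formalization: The bound uses max(1, L_{m,a+ℓ/m}(x)) instead of L_{m,a+ℓ/m}(x): for empty initial states (n(x)=0) L is 0 and the bound as written fails at t=0, since it would force μ=δ_x; for n(x)≥1, L≥1 and nothing changes. *)

theory Defs
  imports "HOL-Probability.Probability"
begin

text \<open>States of the extended Erlang--Sevastyanov system. A state (n, x) encodes
  (n, x^0, x^1, ..., x^n); coordinates x i with i > n are unused and fixed to 0.\<close>

type_synonym es_state = "nat \<times> (nat \<Rightarrow> real)"

definition ES_space :: "es_state set" where
  "ES_space = {(n, x). (\<forall>i\<le>n. 0 \<le> x i) \<and> (\<forall>i>n. x i = 0)}"

text \<open>Measurable structure: disjoint union over n of the Borel sets of R_+^(n+1)
  (realised as the trace of the product sigma algebra).\<close>

definition ES_M :: "es_state measure" where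
  "ES_M = restrict_space (count_space UNIV \<Otimes>\<^sub>M (\<Pi>\<^sub>M i\<in>(UNIV::nat set). (borel :: real measure))) ES_space"

definition ES_n :: "es_state \<Rightarrow> nat" where
  "ES_n s = fst s"

definition ES_empty :: "real \<Rightarrow> es_state" where
  "ES_empty y = (0, \<lambda>i. if i = 0 then y else 0)"

definition hazard :: "(real \<Rightarrow> real) \<Rightarrow> (real \<Rightarrow> real) \<Rightarrow> real \<Rightarrow> real" where
  "hazard G g t = g t / (1 - G t)"

definition ES_flow :: "real \<Rightarrow> es_state \<Rightarrow> es_state" where
  "ES_flow u s = (fst s, \<lambda>i. if i \<le> fst s then snd s i + u else 0)"

definition ES_rate :: "(es_state \<Rightarrow> real) \<Rightarrow> (real \<Rightarrow> real) \<Rightarrow> es_state \<Rightarrow> real" where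
  "ES_rate lam h s = lam s + (\<Sum>i\<in>{1..fst s}. h (snd s i))"

definition ES_surv :: "(es_state \<Rightarrow> real) \<Rightarrow> (real \<Rightarrow> real) \<Rightarrow> es_state \<Rightarrow> real \<Rightarrow> real" where
  "ES_surv lam h s u =
     (let I = (\<integral>\<^sup>+ r\<in>{0..u}. ennreal (ES_rate lam h (ES_flow r s)) \<partial>lborel)
      in if I = \<infinity> then 0 else exp (- enn2real I))"

text \<open>Arrival: a new customer with elapsed time 0 is inserted at position j
  (1 \<le> j \<le> n+1), and x^0 is reset to 0.\<close>
definition ES_ins :: "nat \<Rightarrow> es_state \<Rightarrow> es_state" where
  "ES_ins j s = (Suc (fst s), \<lambda>i. if i = 0 then 0
                                 else if i < j then snd s i
                                 else if i = j then 0
                                 else if i \<le> Suc (fst s) then snd s (i - 1)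
                                 else 0)"

text \<open>Departure of customer i (1 \<le> i \<le> n); x^0 is unchanged.\<close>
definition ES_del :: "nat \<Rightarrow> es_state \<Rightarrow> es_state" where
  "ES_del i s = (fst s - 1, \<lambda>k. if k = 0 then snd s 0
                               else if k < i then snd s k
                               else if k \<le> fst s - 1 then snd s (Suc k)
                               else 0)"

text \<open>ES_P lam h k s t A = P(exactly k jumps in [0,t] and X_t \<in> A | X_0 = s),
  defined by the first-jump decomposition of the piecewise deterministic process.\<close>
primrec ES_P :: "(es_state \<Rightarrow> real) \<Rightarrow> (real \<Rightarrow> real) \<Rightarrow> nat \<Rightarrow> es_state \<Rightarrow> real \<Rightarrow> es_state set \<Rightarrow> ennreal" where
  "ES_P lam h 0 s t A = ennreal (ES_surv lam h s t) * indicator A (ES_flow t s)"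
| "ES_P lam h (Suc k) s t A =
     (\<integral>\<^sup>+ u\<in>{0..t}. ennreal (ES_surv lam h s u) *
        ( ennreal (lam (ES_flow u s) / real (Suc (fst s))) *
            (\<Sum>j\<in>{1..Suc (fst s)}. ES_P lam h k (ES_ins j (ES_flow u s)) (t - u) A)
        + (\<Sum>i\<in>{1..fst s}. ennreal (h (snd (ES_flow u s) i)) *
            ES_P lam h k (ES_del i (ES_flow u s)) (t - u) A)) \<partial>lborel)"

definition ES_trans :: "(es_state \<Rightarrow> real) \<Rightarrow> (real \<Rightarrow> real) \<Rightarrow> es_state \<Rightarrow> real \<Rightarrow> es_state set \<Rightarrow> ennreal" where
  "ES_trans lam h s t A = (\<Sum>k. ES_P lam h k s t A)"

definition ES_law :: "(es_state \<Rightarrow> real) \<Rightarrow> (real \<Rightarrow> real) \<Rightarrow> es_state \<Rightarrow> real \<Rightarrow> es_state measure" where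
  "ES_law lam h s t = measure_of ES_space (sets ES_M) (ES_trans lam h s t)"

definition ES_stationary :: "(es_state \<Rightarrow> real) \<Rightarrow> (real \<Rightarrow> real) \<Rightarrow> es_state measure \<Rightarrow> bool" where
  "ES_stationary lam h \<mu> \<longleftrightarrow>
     sets \<mu> = sets ES_M \<and> prob_space \<mu> \<and>
     (\<forall>t\<ge>0. \<forall>A\<in>sets ES_M. (\<integral>\<^sup>+ s. ES_trans lam h s t A \<partial>\<mu>) = emeasure \<mu> A)"

definition tv_dist :: "'a measure \<Rightarrow> 'a measure \<Rightarrow> real" where
  "tv_dist M N = (SUP A\<in>sets M. \<bar>measure M A - measure N A\<bar>)"

definition ES_L :: "real \<Rightarrow> real \<Rightarrow> es_state \<Rightarrow> real" where
  "ES_L m a s = (\<Sum>j\<in>{1..fst s}. (1 + snd s j) powr m) powr a"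

definition ES_Lambda :: "(es_state \<Rightarrow> real) \<Rightarrow> real" where
  "ES_Lambda lam = (SUP s\<in>ES_space. lam s / real (max 1 (fst s)))"

end

theory Submission
  imports Defs
begin

text \<open>Let \<open>S\<close> be the sum of \<open>(1 + x\<^sup>j)\<^sup>m\<close> over the customers present. The lower bound on the service intensity
  gives, for \<open>V = S\<^sup>p\<close> with \<open>p \<le> a + (l + 1)/m\<close>, a subgeometric drift \<open>P V \<le> V - c V powr (1 - 1/(m p)) + b\<close>,
  and from \<open>{V \<le> R}\<close> the system empties and then passes through the state \<open>(1, 0)\<close> with probability bounded
  below, which is a minorization. For a function \<open>f\<close> whose two-point oscillation is at most
  \<open>\<psi>\<^sub>j (V x + V y + M)\<close> with \<open>\<psi>\<^sub>j v = (v powr (1/e) + \<gamma> j) powr e\<close>, \<open>e = m p\<close>, bounding the concave \<open>\<psi>\<^sub>j\<close> by a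
  tangent line splits the bound into a function of \<open>x\<close> plus a function of \<open>y\<close>, to which drift and minorization
  apply; thus \<open>P f\<close> has oscillation at most \<open>\<psi>\<^sub>j\<^sub>-\<^sub>1 (V x + V y + M)\<close>, without any coupling. Hence
  \<open>\<bar>P\<^sub>t(x, A) - P\<^sub>t(y, A)\<bar> \<le> C (V x + V y) (1 + t) powr (- e)\<close>. With \<open>p = a + l/m\<close> one has \<open>e = m a + l \<ge> l + 1\<close>,
  and the drift for the exponent \<open>p + 1/m\<close> shows that \<open>V\<close> is integrable under the invariant law, over which
  \<open>y\<close> is then averaged.\<close>

section \<open>Power inequalities and comparison of measures\<close>

text \<open>The density is only given as a derivative, so the service intensity is measurable and
  locally integrable but may be discontinuous and unbounded: neither a pointwise Kolmogorov equation
  nor uniformization is at hand. Estimates on the process are therefore stated for the equation of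
  the first jump. The transition operator is the limit of its iterates from 0, so a function that
  does not increase under that equation dominates it; this one principle gives the drift, and its
  analogue for the number of jumps excludes explosion. The shape of \<open>\<psi>\<close> j comes
  from v' = - v powr (1 - 1/e), along which v powr (1/e) falls at constant speed: one remaining step
  is worth one \<gamma> inside the power. The constant added to V x + V y is chosen so large that,
  below a fixed level, the minorization alone pays for the constant 2 b of the drift. The condition
  on \<open>C0\<close> is stated at p + 1/m because S powr (p + 1/m) loses a multiple of S powr p,
  which is what bounds the moments of V. In it the factor p weighs arrivals and ageing only: a
  departure lowers S powr p with coefficient 1.\<close>

lemma powr_le_affine:
  fixes x r :: real
  assumes "0 \<le> x" "0 \<le> r" "r \<le> 1"
  shows "x powr r \<le> r * x + (1 - r)"
proof (cases "x = 0 \<or> r = 0")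
  case True then show ?thesis using assms by auto
next
  case False
  then show ?thesis using Youngs_inequality_0[of r "1 - r" x 1] assms by simp
qed

text \<open>The concave case with exponent 1 / r at the point x powr r. Both inequalities compare a
  power with its tangent at 1.\<close>

lemma powr_ge_affine:
  fixes x r :: real
  assumes "0 \<le> x" "1 \<le> r"
  shows "r * x + (1 - r) \<le> x powr r"
proof -
  have "x = (x powr r) powr (1 / r)" using assms by (simp add: powr_powr)
  also have "\<dots> \<le> (1 / r) * x powr r + (1 - 1 / r)"
    by (rule powr_le_affine) (use assms in auto)
  finally have "r * x \<le> r * ((1 / r) * x powr r + (1 - 1 / r))"
    using assms by (intro mult_left_mono) auto
  also have "\<dots> = x powr r + r - 1" using assms by (simp add: distrib_left right_diff_distrib)
  finally show ?thesis by simp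
qed

text \<open>Tangent of the convex power at x, obtained from the tangent at 1 by homogeneity. The
  increment d may be negative; \<open>powr_add_le\<close> is the same inequality read from the point
  x + d.\<close>

lemma powr_add_ge:
  fixes x d p :: real
  assumes "0 < x" "0 \<le> x + d" "1 \<le> p"
  shows "x powr p + p * d * x powr (p - 1) \<le> (x + d) powr p"
proof -
  have "x powr p * (p * ((x + d) / x) + (1 - p)) \<le> x powr p * ((x + d) / x) powr p"
    by (intro mult_left_mono powr_ge_affine) (use assms in auto)
  also have "\<dots> = (x + d) powr p" using assms by (simp add: powr_divide)
  also have "x powr p * (p * ((x + d) / x) + (1 - p)) = x powr p + p * d * x powr (p - 1)"
    using assms by (simp add: powr_diff field_simps)
  finally show ?thesis .
qed

lemma powr_add_le:
  fixes x d p :: real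
  assumes "0 \<le> x" "0 \<le> d" "1 \<le> p"
  shows "(x + d) powr p \<le> x powr p + p * d * (x + d) powr (p - 1)"
proof (cases "x + d = 0")
  case False
  then show ?thesis using powr_add_ge[of "x + d" "- d" p] assms by simp
qed (use assms in auto)

text \<open>The ratio (x - d) / x lies in [0, 1], and a power p >= 1 only lowers it. The coefficient
  1 of d cannot be improved to p, as both sides vanish at d = x.\<close>

lemma powr_minus_le:
  fixes x d p :: real
  assumes "0 \<le> d" "d \<le> x" "0 < x" "1 \<le> p"
  shows "(x - d) powr p \<le> x powr p - d * x powr (p - 1)"
proof -
  have "x powr p * ((x - d) / x) powr p \<le> x powr p * ((x - d) / x) powr 1"
    by (intro mult_left_mono powr_mono') (use assms in auto)
  also have "\<dots> = x powr p - d * x powr (p - 1)"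
    using assms by (simp add: powr_diff field_simps)
  finally show ?thesis using assms by (simp add: powr_divide)
qed

text \<open>The map v -> (v powr (1/e) + d) powr e is concave, and A v + B is its tangent at v0.
  Convexity of the power e is applied to y + d = th (y / th) + (1 - th) (d / (1 - th)); with th = y0
  / (y0 + d) the two points coincide at y = y0, which gives equality there. The case d = 0 is apart
  because then 1 - th = 0.\<close>

lemma powr_sum_tangent:
  fixes e d v0 :: real
  assumes e: "1 \<le> e" and d: "0 \<le> d" and v0: "0 < v0"
  obtains A B where "0 \<le> A" "0 \<le> B" "A * v0 + B = (v0 powr (1/e) + d) powr e"
    "\<And>v. 0 \<le> v \<Longrightarrow> (v powr (1/e) + d) powr e \<le> A * v + B"
proof (cases "d = 0")
  case True
  show ?thesis by (rule that[of 1 0]) (use e v0 True in \<open>auto simp: powr_powr\<close>)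
next
  case False
  define y0 where "y0 = v0 powr (1/e)"
  define th where "th = y0 / (y0 + d)"
  have y0: "0 < y0" using v0 by (simp add: y0_def)
  have th: "0 < th" "th < 1" "1 - th = d / (y0 + d)"
    using y0 d False by (auto simp: th_def field_simps)
  define A where "A = th powr (1 - e)"
  define B where "B = (1 - th) powr (1 - e) * d powr e"
  have pe: "th * (z / th) powr e = th powr (1-e) * z powr e" if "0 < th" "0 \<le> z" for th z :: real
    using that by (simp add: powr_divide powr_diff)
  have v0e: "v0 = y0 powr e" using e v0 by (simp add: y0_def powr_powr)
  have a1: "A * v0 = th * (y0 + d) powr e"
    using pe[of th y0] th y0 d by (simp add: A_def v0e th_def)
  have b1: "B = (1 - th) * (y0 + d) powr e"
    using pe[of "1 - th" d] th y0 d False by (simp add: B_def)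
  show ?thesis
  proof (rule that[of A B])
    show "A * v0 + B = (v0 powr (1 / e) + d) powr e"
      using a1 b1 by (simp add: y0_def algebra_simps)
    fix v :: real assume v: "0 \<le> v"
    define y where "y = v powr (1/e)"
    have y: "0 \<le> y" "v = y powr e" using e v by (auto simp: y_def powr_powr)
    define a where "a = y + d"
    have a: "0 < a" using y d False by (simp add: a_def)
    \<comment> \<open>Jensen's inequality for two points: the tangent at the mean a is used at both
      points, and the linear terms cancel in the average.\<close>
    have jen: "a powr e + e * (z - a) * a powr (e - 1) \<le> z powr e" if "0 \<le> z" for z
      using powr_add_ge[of a "z - a" e] a that e by simp
    define u w where "u = y / th" and "w = d / (1 - th)"
    have "th * u + (1 - th) * w = y + d" using th d y0 by (simp add: u_def w_def)
    then have "th * (u - a) + (1 - th) * (w - a) = 0"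
      by (simp add: algebra_simps a_def)
    then have "e * a powr (e - 1) * (th * (u - a) + (1 - th) * (w - a)) = 0" by simp
    then have "a powr e = th * (a powr e + e * (u - a) * a powr (e - 1))
        + (1 - th) * (a powr e + e * (w - a) * a powr (e - 1))"
      by (simp add: algebra_simps)
    then have "a powr e = th * (a powr e + e * (y / th - a) * a powr (e - 1))
        + (1 - th) * (a powr e + e * (d / (1 - th) - a) * a powr (e - 1))"
      by (simp only: u_def w_def)
    also have "\<dots> \<le> th * (y / th) powr e + (1 - th) * (d / (1 - th)) powr e"
      by (intro add_mono mult_left_mono jen) (use th y y0 d in auto)
    also have "\<dots> = A * v + B"
      using pe[of th y] pe[of "1 - th" d] th y d by (simp add: A_def B_def)
    finally show "(v powr (1/e) + d) powr e \<le> A * v + B" by (simp add: y_def a_def)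
  qed (auto simp: A_def B_def)
qed

lemma nn_integral_le_scaled:
  assumes sets: "sets N = sets M" and f: "f \<in> borel_measurable N"
    and le: "\<And>A. A \<in> sets M \<Longrightarrow> r * emeasure N A \<le> emeasure M A"
  shows "r * (\<integral>\<^sup>+x. f x \<partial>N) \<le> (\<integral>\<^sup>+x. f x \<partial>M)"
proof -
  have "r * emeasure N A \<le> emeasure M A" for A
    using le[of A] sets by (cases "A \<in> sets M") (auto simp: emeasure_notin_sets)
  then have "scale_measure r N \<le> M"
    using sets_eq_imp_space_eq[OF sets] sets
    by (simp add: le_measure_iff le_fun_def space_scale_measure)
  then have "(\<integral>\<^sup>+x. f x \<partial>scale_measure r N) \<le> (\<integral>\<^sup>+x. f x \<partial>M)"
    by (intro nn_integral_mono_measure) (auto simp: sets)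
  then show ?thesis using f by (simp add: nn_integral_scale_measure)
qed

text \<open>Subtracting a constant from \<open>f\<close> turns the two-point bound into \<open>\<bar>f - c\<bar> \<le> U\<close>; the common part
  \<open>\<epsilon> N\<close> of the two laws then cancels.\<close>

lemma weighted_oscillation:
  fixes f V :: "'a \<Rightarrow> real"
  assumes Q: "prob_space Q1" "prob_space Q2" "prob_space N"
    and sets: "sets Q1 = sets M" "sets Q2 = sets M" "sets N = sets M"
    and f: "f \<in> borel_measurable M" "\<And>x. x \<in> space M \<Longrightarrow> 0 \<le> f x \<and> f x \<le> 1"
    and U: "U \<in> borel_measurable M" "\<And>x. x \<in> space M \<Longrightarrow> K \<le> U x" and K: "0 \<le> K"
    and osc: "\<And>x y. x \<in> space M \<Longrightarrow> y \<in> space M \<Longrightarrow> f x - f y \<le> U x + U y"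
    and int: "integrable Q1 U" "integrable Q2 U"
    and eps: "0 \<le> \<epsilon>" 
      "\<And>A. A \<in> sets M \<Longrightarrow> ennreal \<epsilon> * emeasure N A \<le> emeasure Q1 A"
      "\<And>A. A \<in> sets M \<Longrightarrow> ennreal \<epsilon> * emeasure N A \<le> emeasure Q2 A"
  shows "(\<integral>x. f x \<partial>Q1) - (\<integral>x. f x \<partial>Q2) \<le> (\<integral>x. U x \<partial>Q1) + (\<integral>x. U x \<partial>Q2) - 2 * \<epsilon> * K"
proof -
  interpret Q1: prob_space Q1 by fact
  interpret Q2: prob_space Q2 by fact
  interpret N: prob_space N by fact
  have sp: "space Q1 = space M" "space Q2 = space M" "space N = space M"
    using sets by (auto dest: sets_eq_imp_space_eq)
  have ne: "space M \<noteq> {}" using Q1.not_empty sp by simp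
  note [measurable_cong] = sets
  note [measurable] = f(1) U(1)
  \<comment> \<open>\<open>osc\<close> says that f - U at one point never exceeds f + U at another,
    so a constant fits between them; the infimum of f + U is such a constant.\<close>
  define c where "c = (INF x\<in>space M. f x + U x)"
  have bdd: "bdd_below ((\<lambda>x. f x + U x) ` space M)"
    by (rule bdd_belowI2[of _ 0]) (use f U K in force)
  have c1: "c \<le> f y + U y" if "y \<in> space M" for y
    unfolding c_def using bdd that by (rule cINF_lower)
  have c2: "f y - U y \<le> c" if "y \<in> space M" for y
    unfolding c_def using ne that osc[of y] by (intro cINF_greatest) (auto simp: algebra_simps)
  have intf: "integrable Q1 f" "integrable Q2 f"
    using f by (auto intro!: Q1.integrable_const_bound[where B=1] Q2.integrable_const_bound[where B=1] simp: sp abs_le_iff)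
  \<comment> \<open>U - (f - c) and U + (f - c) are nonnegative with sum 2 U >= 2 K. The first is
    integrated against \<open>Q1\<close> and the second against \<open>Q2\<close>, and each of these
    measures dominates \<open>\<epsilon> N\<close>.\<close>
  have "ennreal (2 * \<epsilon> * K) = ennreal \<epsilon> * (\<integral>\<^sup>+x. ennreal (2 * K) \<partial>N)"
    using eps(1) K N.emeasure_space_1 by (simp add: ennreal_mult' [symmetric] ac_simps)
  also have "\<dots> \<le> ennreal \<epsilon> * (\<integral>\<^sup>+x. ennreal (U x - (f x - c)) + ennreal (U x + (f x - c)) \<partial>N)"
  proof (intro mult_left_mono nn_integral_mono)
    fix x assume "x \<in> space N"
    then have "K \<le> U x" "c \<le> f x + U x" "f x - U x \<le> c" using c1 c2 U(2) sp by auto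
    then show "ennreal (2 * K) \<le> ennreal (U x - (f x - c)) + ennreal (U x + (f x - c))"
      by (subst ennreal_plus[symmetric]) (auto intro!: ennreal_leI)
  qed auto
  also have "\<dots> = ennreal \<epsilon> * (\<integral>\<^sup>+x. ennreal (U x - (f x - c)) \<partial>N) 
       + ennreal \<epsilon> * (\<integral>\<^sup>+x. ennreal (U x + (f x - c)) \<partial>N)"
    by (subst nn_integral_add) (auto simp: distrib_left)
  also have "\<dots> \<le> (\<integral>\<^sup>+x. ennreal (U x - (f x - c)) \<partial>Q1) + (\<integral>\<^sup>+x. ennreal (U x + (f x - c)) \<partial>Q2)"
    by (intro add_mono nn_integral_le_scaled) (use sets eps in auto)
  also have "(\<integral>\<^sup>+x. ennreal (U x - (f x - c)) \<partial>Q1) = ennreal (\<integral>x. U x - (f x - c) \<partial>Q1)"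
    using c2 int intf by (intro nn_integral_eq_integral) (auto intro!: AE_I2 simp: sp algebra_simps)
  also have "(\<integral>\<^sup>+x. ennreal (U x + (f x - c)) \<partial>Q2) = ennreal (\<integral>x. U x + (f x - c) \<partial>Q2)"
    using c1 int intf by (intro nn_integral_eq_integral) (auto intro!: AE_I2 simp: sp algebra_simps)
  also have "ennreal (\<integral>x. U x - (f x - c) \<partial>Q1) + ennreal (\<integral>x. U x + (f x - c) \<partial>Q2)
     = ennreal ((\<integral>x. U x - (f x - c) \<partial>Q1) + (\<integral>x. U x + (f x - c) \<partial>Q2))"
    using c1 c2 by (intro ennreal_plus[symmetric] integral_nonneg_AE AE_I2) (auto simp: sp algebra_simps)
  finally have "2 * \<epsilon> * K \<le> (\<integral>x. U x - (f x - c) \<partial>Q1) + (\<integral>x. U x + (f x - c) \<partial>Q2)"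
    using c1 c2 by (subst (asm) ennreal_le_iff) (auto intro!: add_nonneg_nonneg integral_nonneg_AE AE_I2 simp: sp algebra_simps)
  also have "\<dots> = (\<integral>x. U x \<partial>Q1) - (\<integral>x. f x \<partial>Q1) + (\<integral>x. U x \<partial>Q2) + (\<integral>x. f x \<partial>Q2)"
    using int intf Q1.prob_space Q2.prob_space by simp
  finally show ?thesis by simp
qed

lemma nn_integral_layer_cake:
  fixes f :: "'a \<Rightarrow> real"
  assumes M: "sigma_finite_measure M" and f [measurable]: "f \<in> borel_measurable M"
  shows "(\<integral>\<^sup>+x. ennreal (f x) \<partial>M) = (\<integral>\<^sup>+v. indicator {0..} v * emeasure M {x\<in>space M. v < f x} \<partial>lborel)"
proof -
  interpret M: sigma_finite_measure M by fact
  interpret pair_sigma_finite M lborel ..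
  have "ennreal (f x) = (\<integral>\<^sup>+v. indicator {0..} v * (if v < f x then 1 else 0) \<partial>lborel)" for x
  proof -
    have "(\<integral>\<^sup>+v. indicator {0..} v * (if v < f x then 1 else 0) \<partial>lborel) = (\<integral>\<^sup>+v. indicator {0..<f x} v \<partial>lborel)"
      by (intro nn_integral_cong) (auto split: split_indicator)
    also have "\<dots> = emeasure lborel {0..<f x}" by simp
    also have "\<dots> = ennreal (f x)" by (cases "0 \<le> f x") (auto simp: ennreal_neg)
    finally show ?thesis by simp
  qed
  then have "(\<integral>\<^sup>+x. ennreal (f x) \<partial>M) = (\<integral>\<^sup>+x. (\<integral>\<^sup>+v. indicator {0..} v * (if v < f x then 1 else 0) \<partial>lborel) \<partial>M)"
    by simp
  also have "\<dots> = (\<integral>\<^sup>+v. (\<integral>\<^sup>+x. indicator {0..} v * (if v < f x then 1 else 0) \<partial>M) \<partial>lborel)"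
    by (rule Fubini'[symmetric]) measurable
  also have "\<dots> = (\<integral>\<^sup>+v. indicator {0..} v * emeasure M {x\<in>space M. v < f x} \<partial>lborel)"
  proof (intro nn_integral_cong)
    fix v :: real
    have "(\<integral>\<^sup>+x. indicator {0..} v * (if v < f x then 1 else 0) \<partial>M)
        = (\<integral>\<^sup>+x. indicator {0..} v * indicator {x\<in>space M. v < f x} x \<partial>M)"
      by (intro nn_integral_cong) (auto simp: indicator_def)
    then show "(\<integral>\<^sup>+x. indicator {0..} v * (if v < f x then 1 else 0) \<partial>M)
        = indicator {0..} v * emeasure M {x\<in>space M. v < f x}"
      by (simp add: nn_integral_cmult)
  qed
  finally show ?thesis .
qed

text \<open>In the layer cake formula only levels between 0 and K contribute, and on each of them
  the first measure exceeds the second by at most r.\<close>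

lemma nn_integral_le_of_emeasure_le:
  fixes f :: "'a \<Rightarrow> real"
  assumes fin: "finite_measure Q1" "finite_measure Q2"
    and sets: "sets Q1 = sets M" "sets Q2 = sets M"
    and le: "\<And>A. A \<in> sets M \<Longrightarrow> emeasure Q1 A \<le> emeasure Q2 A + ennreal r"
    and f: "f \<in> borel_measurable M" "\<And>x. x \<in> space M \<Longrightarrow> f x \<le> K" and K: "0 \<le> K" and r: "0 \<le> r"
  shows "(\<integral>\<^sup>+x. ennreal (f x) \<partial>Q1) \<le> (\<integral>\<^sup>+x. ennreal (f x) \<partial>Q2) + ennreal (K * r)"
proof -
  interpret Q1: finite_measure Q1 by fact
  interpret Q2: finite_measure Q2 by fact
  have sp: "space Q1 = space M" "space Q2 = space M" using sets by (auto dest: sets_eq_imp_space_eq)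
  note [measurable_cong] = sets
  note [measurable] = f(1)
  have "(\<integral>\<^sup>+x. ennreal (f x) \<partial>Q1) = (\<integral>\<^sup>+v. indicator {0..} v * emeasure Q1 {x\<in>space M. v < f x} \<partial>lborel)"
    by (subst nn_integral_layer_cake) (auto simp: sp Q1.sigma_finite_measure_axioms)
  also have "\<dots> \<le> (\<integral>\<^sup>+v. indicator {0..} v * emeasure Q2 {x\<in>space M. v < f x} + ennreal r * indicator {0..K} v \<partial>lborel)"
  proof (intro nn_integral_mono)
    fix v :: real
    have "{x\<in>space M. v < f x} = {}" if "v > K" using f(2) that by force
    then have "emeasure Q1 {x\<in>space M. v < f x} = 0" if "v > K" using that by (metis emeasure_empty)
    then show "indicator {0..} v * emeasure Q1 {x\<in>space M. v < f x}
       \<le> indicator {0..} v * emeasure Q2 {x\<in>space M. v < f x} + ennreal r * indicator {0..K} v"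
      using le[of "{x\<in>space M. v < f x}"] by (cases "v > K"; cases "v \<ge> 0") auto
  qed
  also have "\<dots> = (\<integral>\<^sup>+v. indicator {0..} v * emeasure Q2 {x\<in>space M. v < f x} \<partial>lborel) 
      + (\<integral>\<^sup>+v. ennreal r * indicator {0..K} v \<partial>lborel)"
  proof (rule nn_integral_add)
    have "(\<lambda>v. emeasure Q2 {x\<in>space M. v < f x}) = (\<lambda>v. emeasure Q2 (Pair v -` {p\<in>space (borel \<Otimes>\<^sub>M Q2). fst p < f (snd p)}))"
      by (auto simp: fun_eq_iff space_pair_measure sp intro!: arg_cong[where f="emeasure Q2"])
    moreover have "\<dots> \<in> borel_measurable borel"
      by (rule Q2.measurable_emeasure_Pair) measurable
    ultimately have [measurable]: "(\<lambda>v. emeasure Q2 {x\<in>space M. v < f x}) \<in> borel_measurable borel"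
      by simp
    show "(\<lambda>v. indicator {0..} v * emeasure Q2 {x\<in>space M. v < f x}) \<in> borel_measurable lborel"
      by measurable
  qed simp
  also have "(\<integral>\<^sup>+v. indicator {0..} v * emeasure Q2 {x\<in>space M. v < f x} \<partial>lborel) = (\<integral>\<^sup>+x. ennreal (f x) \<partial>Q2)"
    by (subst nn_integral_layer_cake) (auto simp: sp Q2.sigma_finite_measure_axioms)
  also have "(\<integral>\<^sup>+v. ennreal r * indicator {0..K} v \<partial>lborel) = ennreal (K * r)"
    using K r by (simp add: nn_integral_cmult_indicator ennreal_mult mult.commute)
  finally show ?thesis .
qed

section \<open>Polynomial ergodicity of Markov semigroups\<close>

locale markov_semigroup =
  fixes M :: "'a measure" and P :: "real \<Rightarrow> 'a \<Rightarrow> 'a measure"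
  assumes prob_P: "x \<in> space M \<Longrightarrow> 0 \<le> t \<Longrightarrow> prob_space (P t x)"
    and sets_P: "x \<in> space M \<Longrightarrow> 0 \<le> t \<Longrightarrow> sets (P t x) = sets M"
    and kernel_measurable: "0 \<le> t \<Longrightarrow> A \<in> sets M \<Longrightarrow> (\<lambda>x. emeasure (P t x) A) \<in> borel_measurable M"
    and chapman_kolmogorov: "x \<in> space M \<Longrightarrow> 0 \<le> s \<Longrightarrow> 0 \<le> t \<Longrightarrow> A \<in> sets M \<Longrightarrow>
      emeasure (P (s + t) x) A = (\<integral>\<^sup>+y. emeasure (P t y) A \<partial>P s x)"
begin

lemma space_P: "x \<in> space M \<Longrightarrow> 0 \<le> t \<Longrightarrow> space (P t x) = space M"
  using sets_P sets_eq_imp_space_eq by blast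

lemma measurable_P:
  assumes "f \<in> borel_measurable M" "x \<in> space M" "0 \<le> t"
  shows "f \<in> borel_measurable (P t x)"
  using assms(1) by (simp only: measurable_cong_sets[OF sets_P[OF assms(2,3)] refl])

lemma measure_P_measurable:
  "0 \<le> t \<Longrightarrow> A \<in> sets M \<Longrightarrow> (\<lambda>x. measure (P t x) A) \<in> borel_measurable M"
  unfolding measure_def using kernel_measurable by simp

lemma emeasure_P: "x \<in> space M \<Longrightarrow> 0 \<le> t \<Longrightarrow> emeasure (P t x) A = ennreal (measure (P t x) A)"
  using prob_P[of x t] by (intro finite_measure.emeasure_eq_measure) (simp add: prob_space.finite_measure)

lemma measure_P_le_1: "x \<in> space M \<Longrightarrow> 0 \<le> t \<Longrightarrow> measure (P t x) A \<le> 1"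
  using prob_P[of x t] by (intro prob_space.prob_le_1)

lemma integrable_measure_P:
  assumes "x \<in> space M" "0 \<le> s" "0 \<le> t" "A \<in> sets M"
  shows "integrable (P s x) (\<lambda>y. measure (P t y) A)"
proof -
  interpret prob_space "P s x" using assms prob_P by simp
  show ?thesis
  proof (rule integrable_const_bound[where B=1])
    show "AE y in P s x. norm (measure (P t y) A) \<le> 1"
      using assms by (intro AE_I2) (auto simp: space_P measure_P_le_1)
    show "(\<lambda>y. measure (P t y) A) \<in> borel_measurable (P s x)"
      using assms by (intro measurable_P measure_P_measurable)
  qed
qed

lemma measure_chapman_kolmogorov:
  assumes "x \<in> space M" "0 \<le> s" "0 \<le> t" "A \<in> sets M"
  shows "measure (P (s + t) x) A = (\<integral>y. measure (P t y) A \<partial>P s x)"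
proof -
  have "ennreal (measure (P (s + t) x) A) = (\<integral>\<^sup>+y. ennreal (measure (P t y) A) \<partial>P s x)"
    using assms chapman_kolmogorov[OF assms] emeasure_P[of x "s + t" A]
    by (auto simp: emeasure_P space_P intro!: nn_integral_cong)
  also have "\<dots> = ennreal (\<integral>y. measure (P t y) A \<partial>P s x)"
    by (intro nn_integral_eq_integral integrable_measure_P assms) simp
  finally show ?thesis by (simp add: integral_nonneg_AE)
qed

end

text \<open>Drift and minorization refer to the same time \<open>T\<close>, so that one step of the
  skeleton can use both. Every sublevel set is to be minorized because the level to be used depends
  on \<open>c\<close> and \<open>b\<close>. A loss of V powr (1 - 1/e) corresponds to decay of order
  t powr (- e).\<close>

locale subgeometric_drift = markov_semigroup +
  fixes V :: "'a \<Rightarrow> real" and e c b T :: real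
  assumes V_measurable: "V \<in> borel_measurable M"
    and V_ge_1: "x \<in> space M \<Longrightarrow> 1 \<le> V x"
    and T_pos: "0 < T" and e_gt_1: "1 < e" and c_pos: "0 < c" and b_nonneg: "0 \<le> b"
    and V_finite: "x \<in> space M \<Longrightarrow> 0 \<le> t \<Longrightarrow> (\<integral>\<^sup>+y. ennreal (V y) \<partial>P t x) < \<infinity>"
    and drift: "x \<in> space M \<Longrightarrow>
      (\<integral>\<^sup>+y. ennreal (V y) \<partial>P T x) \<le> ennreal (V x - c * V x powr (1 - 1/e) + b)"
    and minorization: "\<exists>\<epsilon>>0. \<exists>N. prob_space N \<and> sets N = sets M \<and>
      (\<forall>x\<in>space M. V x \<le> R \<longrightarrow> (\<forall>A\<in>sets M. ennreal \<epsilon> * emeasure N A \<le> emeasure (P T x) A))"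
begin

section \<open>Integrability of the Lyapunov function and one-step contraction of
  oscillations\<close>

lemma integrable_V:
  assumes "x \<in> space M" "0 \<le> t"
  shows "integrable (P t x) V"
proof (rule integrableI_bounded)
  show "V \<in> borel_measurable (P t x)"
    using assms V_measurable by (intro measurable_P)
  have "(\<integral>\<^sup>+y. ennreal (norm (V y)) \<partial>P t x) = (\<integral>\<^sup>+y. ennreal (V y) \<partial>P t x)"
    using V_ge_1 space_P[OF assms] by (intro nn_integral_cong) force
  then show "(\<integral>\<^sup>+y. ennreal (norm (V y)) \<partial>P t x) < \<infinity>" using V_finite[OF assms] by simp
qed

lemma integral_V_ge_1:
  assumes "x \<in> space M" "0 \<le> t"
  shows "1 \<le> (\<integral>y. V y \<partial>P t x)"
proof -
  interpret prob_space "P t x" using assms prob_P by simp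
  show ?thesis
    using integral_mono[of "P t x" "\<lambda>_. 1" V] integrable_V[OF assms] V_ge_1 prob_space
    by (simp add: space_P[OF assms])
qed

lemma drift_integral:
  assumes "x \<in> space M"
  shows "(\<integral>y. V y \<partial>P T x) \<le> V x - c * V x powr (1 - 1/e) + b"
proof -
  have "ennreal (\<integral>y. V y \<partial>P T x) = (\<integral>\<^sup>+y. ennreal (V y) \<partial>P T x)"
    using assms T_pos V_ge_1
    by (intro nn_integral_eq_integral[symmetric] integrable_V AE_I2) (force simp: space_P)+
  then have le: "ennreal (\<integral>y. V y \<partial>P T x) \<le> ennreal (V x - c * V x powr (1 - 1/e) + b)"
    using drift[OF assms] by simp
  \<comment> \<open>\<open>ennreal\<close> sends negative numbers to 0. As the left side is at least
    1, the right side must be positive, and the inequality passes to the reals.\<close>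
  have "0 < (\<integral>y. V y \<partial>P T x)" using integral_V_ge_1[OF assms, of T] T_pos by simp
  then have "0 < V x - c * V x powr (1 - 1/e) + b"
    using le by (cases "0 < V x - c * V x powr (1 - 1/e) + b") (auto simp: ennreal_neg)
  then show ?thesis using le by (simp add: ennreal_le_iff)
qed

text \<open>Discrete form of the linear decrease of v powr (1/e) along v' = - v powr (1 - 1/e).
  After W is factored out, the power 1/e is bounded by its tangent at 1; \<delta> <= 1/2 keeps the
  base positive.\<close>

lemma powr_inverse_drop:
  fixes W \<delta> :: real
  assumes "1 \<le> W" "0 < \<delta>" "\<delta> \<le> 1/2"
  shows "0 < W - \<delta> * W powr (1 - 1/e)"
    "(W - \<delta> * W powr (1 - 1/e)) powr (1/e) \<le> W powr (1/e) - \<delta> / e"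
proof -
  have le1: "W powr (- (1/e)) \<le> 1"
    using assms e_gt_1 powr_mono[of "- (1/e)" 0 W] by simp
  have d1: "\<delta> * W powr (- (1/e)) \<le> 1/2" using assms le1 mult_mono[of \<delta> "1/2" "W powr (- (1/e))" 1] by simp
  have eq: "W - \<delta> * W powr (1 - 1/e) = W * (1 - \<delta> * W powr (- (1/e)))"
    using assms powr_add[of W 1 "- (1/e)"] by (simp add: algebra_simps)
  show "0 < W - \<delta> * W powr (1 - 1/e)" unfolding eq using assms d1 by simp
  have "(W - \<delta> * W powr (1 - 1/e)) powr (1/e) = W powr (1/e) * (1 - \<delta> * W powr (- (1/e))) powr (1/e)"
    unfolding eq using assms d1 by (simp add: powr_mult)
  also have "\<dots> \<le> W powr (1/e) * ((1/e) * (1 - \<delta> * W powr (- (1/e))) + (1 - 1/e))"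
    using assms d1 e_gt_1 by (intro mult_left_mono powr_le_affine) auto
  also have "\<dots> = W powr (1/e) - (\<delta> / e) * (W powr (1/e) * W powr (- (1/e)))"
    by (simp add: algebra_simps)
  also have "W powr (1/e) * W powr (- (1/e)) = 1"
    using assms by (simp add: powr_add[symmetric])
  finally show "(W - \<delta> * W powr (1 - 1/e)) powr (1/e) \<le> W powr (1/e) - \<delta> / e" by simp
qed

text \<open>One step of the skeleton removes one \<gamma> from the shift. The concave bound is
  replaced by its tangent at v0, the value to which drift and minorization bring W down in one step;
  being affine, this bound splits into a function of x and the same function of y.\<close>

lemma pair_contraction:
  obtains m \<gamma> where "0 \<le> m" "0 < \<gamma>"
    "\<And>f j \<kappa> x y. f \<in> borel_measurable M \<Longrightarrow> (\<And>x. x \<in> space M \<Longrightarrow> 0 \<le> f x \<and> f x \<le> 1) \<Longrightarrow> 0 \<le> \<kappa> \<Longrightarrow>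
      (\<And>x y. x \<in> space M \<Longrightarrow> y \<in> space M \<Longrightarrow>
         f x - f y \<le> \<kappa> * ((V x + V y + m) powr (1/e) + \<gamma> * real (Suc j)) powr e) \<Longrightarrow>
      x \<in> space M \<Longrightarrow> y \<in> space M \<Longrightarrow>
      (\<integral>z. f z \<partial>P T x) - (\<integral>z. f z \<partial>P T y) \<le> \<kappa> * ((V x + V y + m) powr (1/e) + \<gamma> * real j) powr e"
proof -
  define \<alpha> where "\<alpha> = 1 - 1/e"
  have \<alpha>: "0 < \<alpha>" using e_gt_1 by (simp add: \<alpha>_def)
  \<comment> \<open>Above level R the loss c V powr \<alpha> is at least 4 b, so half of it absorbs
    the 2 b that the two points bring in.\<close>
  define R where "R = max 1 ((4 * b / c) powr (1/\<alpha>))"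
  have "4 * b / c = ((4 * b / c) powr (1/\<alpha>)) powr \<alpha>" using \<alpha> b_nonneg c_pos by (simp add: powr_powr)
  also have "\<dots> \<le> R powr \<alpha>" using \<alpha> by (intro powr_mono2) (auto simp: R_def)
  finally have R: "1 \<le> R" "4 * b \<le> c * R powr \<alpha>" using c_pos by (auto simp: R_def field_simps)
  obtain \<epsilon> N where N: "0 < \<epsilon>" "prob_space N" "sets N = sets M"
    "\<And>x A. x \<in> space M \<Longrightarrow> V x \<le> R \<Longrightarrow> A \<in> sets M \<Longrightarrow> ennreal \<epsilon> * emeasure N A \<le> emeasure (P T x) A"
    using minorization[of R] by blast
  \<comment> \<open>Below level R the minorization gains \<epsilon> m, up to the factor \<kappa> A.
    This pays for 2 b and leaves 1.\<close>
  define m where "m = (2 * b + 1) / \<epsilon>"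
  have m: "0 < m" "\<epsilon> * m = 2 * b + 1" using N(1) b_nonneg by (auto simp: m_def)
  \<comment> \<open>The decrease \<delta> W powr \<alpha> has to be covered by the remaining 1 if
    both values are at most R, where W <= 2 R + m, and by half of the drift otherwise, where W <= (2
    + m) max (V x) (V y). The bound 1/2 serves \<open>powr_inverse_drop\<close>.\<close>
  define \<delta> where "\<delta> = min (1/2) (min (1 / (2 * R + m) powr \<alpha>) (c / 2 / (2 + m) powr \<alpha>))"
  have \<delta>: "0 < \<delta>" "\<delta> \<le> 1/2" using R m c_pos by (auto simp: \<delta>_def)
  have "\<delta> * (2 * R + m) powr \<alpha> \<le> 1 / (2 * R + m) powr \<alpha> * (2 * R + m) powr \<alpha>"
    by (intro mult_right_mono) (auto simp: \<delta>_def)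
  then have \<delta>1: "\<delta> * (2 * R + m) powr \<alpha> \<le> 1" using R m by simp
  have "\<delta> * (2 + m) powr \<alpha> \<le> c / 2 / (2 + m) powr \<alpha> * (2 + m) powr \<alpha>"
    by (intro mult_right_mono) (auto simp: \<delta>_def)
  then have \<delta>2: "\<delta> * (2 + m) powr \<alpha> \<le> c / 2" using m by simp
  show thesis
  proof (rule that[of m "\<delta> / e"])
    show "0 \<le> m" using m by simp
    show "0 < \<delta> / e" using \<delta> e_gt_1 by simp
    fix f :: "'a \<Rightarrow> real" and j \<kappa> x y
    assume f: "f \<in> borel_measurable M" "\<And>x. x \<in> space M \<Longrightarrow> 0 \<le> f x \<and> f x \<le> 1" and \<kappa>: "0 \<le> \<kappa>"
      and osc: "\<And>x y. x \<in> space M \<Longrightarrow> y \<in> space M \<Longrightarrow>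
         f x - f y \<le> \<kappa> * ((V x + V y + m) powr (1/e) + \<delta> / e * real (Suc j)) powr e"
      and x: "x \<in> space M" and y: "y \<in> space M"
    have V1: "1 \<le> V x" "1 \<le> V y" using V_ge_1 x y by auto
    define W where "W = V x + V y + m"
    have W: "1 \<le> W" using V1 m by (simp add: W_def)
    define v0 where "v0 = W - \<delta> * W powr \<alpha>"
    note drop = powr_inverse_drop[OF W \<delta>, folded \<alpha>_def, folded v0_def]
    obtain A B where AB: "0 \<le> A" "0 \<le> B" 
      "A * v0 + B = (v0 powr (1/e) + \<delta> / e * real (Suc j)) powr e"
      "\<And>v. 0 \<le> v \<Longrightarrow> (v powr (1/e) + \<delta> / e * real (Suc j)) powr e \<le> A * v + B"
      using powr_sum_tangent[of e "\<delta> / e * real (Suc j)" v0] drop(1) e_gt_1 \<delta> by auto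
    \<comment> \<open>U z + U w is to be \<kappa> (A (V z + V w + m) + B). Its constant part is
      shared equally, and the share K is a lower bound of U, which is what the minorization
      multiplies.\<close>
    define K where "K = \<kappa> * ((A * m + B) / 2)"
    define U where "U = (\<lambda>z. \<kappa> * (A * V z) + K)"
    have K: "0 \<le> K" using \<kappa> AB m by (simp add: K_def)
    have U: "U \<in> borel_measurable M" using V_measurable by (simp add: U_def)
    have UK: "K \<le> U z" if "z \<in> space M" for z
      using V_ge_1[OF that] \<kappa> AB by (simp add: U_def)
    have oscU: "f z - f w \<le> U z + U w" if "z \<in> space M" "w \<in> space M" for z w
    proof -
      have "f z - f w \<le> \<kappa> * (A * (V z + V w + m) + B)"
        using osc[OF that] AB(4)[of "V z + V w + m"] V_ge_1[OF that(1)] V_ge_1[OF that(2)] m \<kappa>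
        by (smt (verit) mult_left_mono)
      also have "\<dots> = U z + U w" by (simp add: U_def K_def field_simps)
      finally show ?thesis .
    qed
    have intU: "integrable (P T z) U" "(\<integral>w. U w \<partial>P T z) \<le> \<kappa> * (A * (V z - c * V z powr \<alpha> + b)) + K"
      if "z \<in> space M" for z
    proof -
      interpret prob_space "P T z" using that prob_P T_pos by simp
      have i: "integrable (P T z) V" using that T_pos by (intro integrable_V) auto
      show "integrable (P T z) U" unfolding U_def using i by auto
      have "(\<integral>w. U w \<partial>P T z) = \<kappa> * (A * (\<integral>w. V w \<partial>P T z)) + K"
        unfolding U_def using i by (simp add: prob_space)
      also have "\<dots> \<le> \<kappa> * (A * (V z - c * V z powr \<alpha> + b)) + K"
        using drift_integral[OF that] \<kappa> AB by (intro add_mono mult_left_mono) (auto simp: \<alpha>_def)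
      finally show "(\<integral>w. U w \<partial>P T z) \<le> \<kappa> * (A * (V z - c * V z powr \<alpha> + b)) + K" .
    qed
    have T0: "0 \<le> T" using T_pos by simp
    have "(\<integral>z. f z \<partial>P T x) - (\<integral>z. f z \<partial>P T y) \<le> \<kappa> * (A * v0 + B)"
    proof (cases "V x \<le> R \<and> V y \<le> R")
      case True
      have "(\<integral>z. f z \<partial>P T x) - (\<integral>z. f z \<partial>P T y)
          \<le> (\<integral>z. U z \<partial>P T x) + (\<integral>z. U z \<partial>P T y) - 2 * \<epsilon> * K"
        by (rule weighted_oscillation[where M=M and N=N])
          (use x y T0 N True f U UK K oscU intU in \<open>auto simp: prob_P sets_P\<close>)
      also have "\<dots> \<le> \<kappa> * (A * (V x - c * V x powr \<alpha> + b)) + K + (\<kappa> * (A * (V y - c * V y powr \<alpha> + b)) + K) - 2 * \<epsilon> * K"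
        using intU(2)[OF x] intU(2)[OF y] by simp
      also have "\<dots> = \<kappa> * (A * (W - c * V x powr \<alpha> - c * V y powr \<alpha> + 2 * b - \<epsilon> * m) + B - \<epsilon> * B)"
        by (simp add: K_def W_def field_simps)
      also have "\<dots> \<le> \<kappa> * (A * v0 + B)"
      proof (intro mult_left_mono \<kappa>)
        have "W powr \<alpha> \<le> (2 * R + m) powr \<alpha>" using True W \<alpha> by (intro powr_mono2) (auto simp: W_def)
        then have "\<delta> * W powr \<alpha> \<le> 1" using \<delta>1 \<delta> by (smt (verit) mult_left_mono)
        then have "W - c * V x powr \<alpha> - c * V y powr \<alpha> + 2 * b - \<epsilon> * m \<le> v0"
          using m c_pos by (simp add: v0_def) (smt (verit) mult_nonneg_nonneg powr_ge_zero)
        then have "A * (W - c * V x powr \<alpha> - c * V y powr \<alpha> + 2 * b - \<epsilon> * m) \<le> A * v0"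
          using AB by (intro mult_left_mono) auto
        moreover have "0 \<le> \<epsilon> * B" using N AB by simp
        ultimately show "A * (W - c * V x powr \<alpha> - c * V y powr \<alpha> + 2 * b - \<epsilon> * m) + B - \<epsilon> * B \<le> A * v0 + B"
          by simp
      qed
      finally show ?thesis .
    next
      case False
      \<comment> \<open>No minorization is available here, so the oscillation bound is used with
        \<epsilon> = 0; the drift at the larger of the two values suffices.\<close>
      define v where "v = max (V x) (V y)"
      have v: "R \<le> v" "1 \<le> v" using False V1 by (auto simp: v_def)
      have "(\<integral>z. f z \<partial>P T x) - (\<integral>z. f z \<partial>P T y)
          \<le> (\<integral>z. U z \<partial>P T x) + (\<integral>z. U z \<partial>P T y) - 2 * 0 * K"
        by (rule weighted_oscillation[where M=M and N=N])
          (use x y T0 N f U UK K oscU intU in \<open>auto simp: prob_P sets_P\<close>)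
      also have "\<dots> \<le> \<kappa> * (A * (V x - c * V x powr \<alpha> + b)) + K + (\<kappa> * (A * (V y - c * V y powr \<alpha> + b)) + K)"
        using intU(2)[OF x] intU(2)[OF y] by simp
      also have "\<dots> = \<kappa> * (A * (W - c * V x powr \<alpha> - c * V y powr \<alpha> + 2 * b) + B)"
        by (simp add: K_def W_def field_simps)
      also have "\<dots> \<le> \<kappa> * (A * v0 + B)"
      proof (intro mult_left_mono \<kappa> add_right_mono AB(1))
        have "c * R powr \<alpha> \<le> c * v powr \<alpha>"
          using v R \<alpha> c_pos by (intro mult_left_mono powr_mono2) auto
        then have 1: "2 * b - c * v powr \<alpha> \<le> - (c / 2 * v powr \<alpha>)" using R by simp
        have "m \<le> m * v" using v m by simp
        then have "W \<le> (2 + m) * v" by (simp add: W_def v_def distrib_right)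
        then have "W powr \<alpha> \<le> (2 + m) powr \<alpha> * v powr \<alpha>"
          using \<alpha> W m v powr_mono2[of \<alpha> W "(2 + m) * v"] by (simp add: powr_mult)
        then have "\<delta> * W powr \<alpha> \<le> (\<delta> * (2 + m) powr \<alpha>) * v powr \<alpha>"
          using \<delta> by (simp add: mult.assoc)
        also have "\<dots> \<le> c / 2 * v powr \<alpha>" using \<delta>2 by (intro mult_right_mono) auto
        finally have 2: "\<delta> * W powr \<alpha> \<le> c / 2 * v powr \<alpha>" .
        have "v powr \<alpha> \<le> V x powr \<alpha> + V y powr \<alpha>" by (simp add: v_def max_def)
        then have "c * v powr \<alpha> \<le> c * V x powr \<alpha> + c * V y powr \<alpha>"
          using c_pos by (simp add: distrib_left[symmetric])
        then show "W - c * V x powr \<alpha> - c * V y powr \<alpha> + 2 * b \<le> v0"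
          using 1 2 by (simp add: v0_def)
      qed
      finally show ?thesis .
    qed
    \<comment> \<open>The tangent is exact at v0, and v0 powr (1/e) is smaller than W powr (1/e) by
      at least \<delta> / e: this trades \<open>Suc j\<close> for \<open>j\<close>.\<close>
    also have "\<dots> \<le> \<kappa> * (W powr (1/e) + \<delta> / e * real j) powr e"
    proof (intro mult_left_mono \<kappa>)
      have "v0 powr (1/e) + \<delta> / e * real (Suc j) \<le> W powr (1/e) + \<delta> / e * real j"
        using drop(2) by (simp add: distrib_left)
      then show "A * v0 + B \<le> (W powr (1/e) + \<delta> / e * real j) powr e"
        unfolding AB(3) using e_gt_1 \<delta> by (intro powr_mono2) auto
    qed
    finally show "(\<integral>z. f z \<partial>P T x) - (\<integral>z. f z \<partial>P T y)
      \<le> \<kappa> * ((V x + V y + m) powr (1/e) + \<delta> / e * real j) powr e" by (simp add: W_def)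
  qed
qed

text \<open>The trivial bound 1 equals \<kappa> (1 + \<gamma> N) powr e. Each of the N steps removes
  one \<gamma>, and at the end only \<kappa> (V x + V y + m) is left, with \<kappa> of order t powr
  (- e).\<close>

theorem oscillation_decay:
  obtains C where "0 < C"
    "\<And>A x y t. A \<in> sets M \<Longrightarrow> x \<in> space M \<Longrightarrow> y \<in> space M \<Longrightarrow> 0 \<le> t \<Longrightarrow>
      \<bar>measure (P t x) A - measure (P t y) A\<bar> \<le> C * (V x + V y) * (1 + t) powr (- e)"
proof -
  obtain m \<gamma> where m: "0 \<le> m" and \<gamma>: "0 < \<gamma>" and step:
    "\<And>f j \<kappa> x y. f \<in> borel_measurable M \<Longrightarrow> (\<And>x. x \<in> space M \<Longrightarrow> 0 \<le> f x \<and> f x \<le> 1) \<Longrightarrow> 0 \<le> \<kappa> \<Longrightarrow>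
      (\<And>x y. x \<in> space M \<Longrightarrow> y \<in> space M \<Longrightarrow>
         f x - f y \<le> \<kappa> * ((V x + V y + m) powr (1/e) + \<gamma> * real (Suc j)) powr e) \<Longrightarrow>
      x \<in> space M \<Longrightarrow> y \<in> space M \<Longrightarrow>
      (\<integral>z. f z \<partial>P T x) - (\<integral>z. f z \<partial>P T y) \<le> \<kappa> * ((V x + V y + m) powr (1/e) + \<gamma> * real j) powr e"
    using pair_contraction by blast
  \<comment> \<open>Converts steps into time: with this \<eta> one has \<eta> (1 + t) <= 1 +
    \<gamma> N.\<close>
  define \<eta> where "\<eta> = min 1 \<gamma> / (1 + T)"
  have \<eta>: "0 < \<eta>" using \<gamma> T_pos by (simp add: \<eta>_def)
  define C where "C = (1 + m) * \<eta> powr (- e)"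
  have main: "measure (P t x) A - measure (P t y) A \<le> C * (V x + V y) * (1 + t) powr (- e)"
    if A: "A \<in> sets M" and x: "x \<in> space M" and y: "y \<in> space M" and t: "0 \<le> t" for A x y t
  proof -
    define N where "N = nat \<lfloor>t / T\<rfloor>"
    \<comment> \<open>The leftover time is run last, so that it only changes the function from which
      the induction starts, which is still a probability.\<close>
    define r where "r = t - real N * T"
    have N: "real N \<le> t / T" "t / T < real N + 1"
      using t T_pos by (auto simp: N_def)
    then have r: "0 \<le> r" "t < (real N + 1) * T" using T_pos by (auto simp: r_def field_simps)
    define \<kappa> where "\<kappa> = (1 + \<gamma> * real N) powr (- e)"
    define q where "q = (\<lambda>n x. measure (P (real n * T + r) x) A)"
    have nT: "0 \<le> real n * T + r" for n using r T_pos by simp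
    have "n \<le> N \<Longrightarrow> x \<in> space M \<Longrightarrow> y \<in> space M \<Longrightarrow>
      q n x - q n y \<le> \<kappa> * ((V x + V y + m) powr (1/e) + \<gamma> * real (N - n)) powr e" for n x y
    proof (induction n arbitrary: x y)
      case 0
      have V1: "1 \<le> V x" "1 \<le> V y" using V_ge_1 0 by auto
      have "q 0 x - q 0 y \<le> 1"
        using measure_P_le_1[of x r A] 0 r measure_nonneg[of "P r y" A] unfolding q_def
        by (simp del: measure_nonneg)
      also have "1 = \<kappa> * (1 + \<gamma> * real N) powr e"
        using \<gamma> by (simp add: \<kappa>_def powr_add[symmetric] add_nonneg_eq_0_iff)
      also have "\<dots> \<le> \<kappa> * ((V x + V y + m) powr (1/e) + \<gamma> * real N) powr e"
      proof (intro mult_left_mono powr_mono2 add_right_mono)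
        show "1 \<le> (V x + V y + m) powr (1/e)" using V1 m e_gt_1 by (intro ge_one_powr_ge_zero) auto
      qed (use \<gamma> e_gt_1 in \<open>auto simp: \<kappa>_def\<close>)
      finally show ?case by simp
    next
      case (Suc n)
      have CK: "q (Suc n) z = (\<integral>w. q n w \<partial>P T z)" if "z \<in> space M" for z
        using measure_chapman_kolmogorov[OF that _ nT A, of T n] T_pos
        by (simp add: q_def distrib_right add.assoc)
      have j: "N - n = Suc (N - Suc n)" using Suc.prems by simp
      show ?case unfolding CK[OF Suc.prems(2)] CK[OF Suc.prems(3)]
      proof (rule step[OF _ _ _ _ Suc.prems(2,3)])
        show "q n \<in> borel_measurable M" unfolding q_def using nT A by (rule measure_P_measurable)
        show "0 \<le> q n x \<and> q n x \<le> 1" if "x \<in> space M" for x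
          unfolding q_def using measure_P_le_1[OF that nT] by simp
        show "q n x - q n y \<le> \<kappa> * ((V x + V y + m) powr (1/e) + \<gamma> * real (Suc (N - Suc n))) powr e"
          if "x \<in> space M" "y \<in> space M" for x y
          unfolding j[symmetric] by (rule Suc.IH) (use Suc.prems that in auto)
      qed (simp add: \<kappa>_def)
    qed
    from this[of N x y] x y have "q N x - q N y \<le> \<kappa> * ((V x + V y + m) powr (1/e)) powr e" by simp
    also have "((V x + V y + m) powr (1/e)) powr e = V x + V y + m"
      using e_gt_1 m V_ge_1[OF x] V_ge_1[OF y] by (simp add: powr_powr)
    also have "\<kappa> * (V x + V y + m) \<le> (\<eta> * (1 + t)) powr (- e) * ((1 + m) * (V x + V y))"
    proof (intro mult_mono)
      have "m * 1 \<le> m * (V x + V y)" using m V_ge_1[OF x] V_ge_1[OF y]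
        by (intro mult_left_mono) auto
      then show "V x + V y + m \<le> (1 + m) * (V x + V y)" by (simp add: distrib_right)
      have "1 + t \<le> (1 + T) * (1 + real N)" using r(2) T_pos by (simp add: algebra_simps)
      then have "\<eta> * (1 + t) \<le> \<eta> * ((1 + T) * (1 + real N))" using \<eta> by (intro mult_left_mono) auto
      also have "\<dots> = min 1 \<gamma> * (1 + real N)" using T_pos by (simp add: \<eta>_def)
      also have "\<dots> \<le> 1 + \<gamma> * real N"
        using mult_right_mono[of "min 1 \<gamma>" \<gamma> "real N"] by (simp add: distrib_left)
      finally show "\<kappa> \<le> (\<eta> * (1 + t)) powr (- e)"
        unfolding \<kappa>_def using \<eta> t e_gt_1 by (intro powr_mono2') auto
    qed (use m V_ge_1[OF x] V_ge_1[OF y] in auto)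
    also have "\<dots> = C * (V x + V y) * (1 + t) powr (- e)"
      using \<eta> t by (simp add: C_def powr_mult)
    finally show ?thesis by (simp add: q_def r_def)
  qed
  show thesis
  proof (rule that[of C])
    show "0 < C" using m \<eta> by (simp add: C_def)
    fix A x y t assume h: "A \<in> sets M" "x \<in> space M" "y \<in> space M" "0 \<le> (t::real)"
    show "\<bar>measure (P t x) A - measure (P t y) A\<bar> \<le> C * (V x + V y) * (1 + t) powr (- e)"
      using main[OF h] main[OF h(1,3,2,4)] by (simp add: abs_le_iff add.commute)
  qed
qed

end

text \<open>A second Lyapunov function \<open>U\<close>, whose drift dominates \<open>V\<close>, makes the time averages of \<open>V\<close> bounded; this
  is what gives the invariant law a finite \<open>V\<close>-moment.\<close>

locale subgeometric_drift_moment = subgeometric_drift +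
  fixes U :: "'a \<Rightarrow> real" and c' b' :: real and x0 :: 'a
  assumes U_measurable: "U \<in> borel_measurable M" and U_nonneg: "x \<in> space M \<Longrightarrow> 0 \<le> U x"
    and c'_pos: "0 < c'" and b'_nonneg: "0 \<le> b'" and x0: "x0 \<in> space M"
    and drift_U: "x \<in> space M \<Longrightarrow> (\<integral>\<^sup>+y. ennreal (U y + c' * V y) \<partial>P T x) \<le> ennreal (U x + b')"
    and U_finite: "(\<integral>\<^sup>+y. ennreal (U y) \<partial>P 0 x0) < \<infinity>"
begin

section \<open>Moments along the skeleton and the invariant law\<close>

lemma nn_integral_chapman_kolmogorov:
  assumes x: "x \<in> space M" and s: "0 \<le> s" and t: "0 \<le> t" and f: "f \<in> borel_measurable M"
  shows "(\<integral>\<^sup>+z. f z \<partial>P (s + t) x) = (\<integral>\<^sup>+y. (\<integral>\<^sup>+z. f z \<partial>P t y) \<partial>P s x)"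
    "(\<lambda>y. \<integral>\<^sup>+z. f z \<partial>P t y) \<in> borel_measurable M"
proof -
  have ms: "P t \<in> measurable M (subprob_algebra M)"
  proof (rule measurable_subprob_algebra)
    show "subprob_space (P t y)" "sets (P t y) = sets M" if "y \<in> space M" for y
      using prob_P[OF that t] sets_P[OF that t] by (auto intro: prob_space_imp_subprob_space)
  qed (use kernel_measurable t in auto)
  then have ms': "P t \<in> measurable (P s x) (subprob_algebra M)"
    by (simp only: measurable_cong_sets[OF sets_P[OF x s] refl])
  show "(\<lambda>y. \<integral>\<^sup>+z. f z \<partial>P t y) \<in> borel_measurable M"
    by (rule measurable_compose[OF ms nn_integral_measurable_subprob_algebra[OF f]])
  have eq: "P (s + t) x = P s x \<bind> P t"
  proof (rule measure_eqI)
    have ne: "space (P s x) \<noteq> {}" using x s by (auto simp: space_P)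
    show s': "sets (P (s + t) x) = sets (P s x \<bind> P t)"
      using x s t by (subst sets_bind[where N=M, OF _ ne]) (auto simp: sets_P space_P)
    fix A assume "A \<in> sets (P (s + t) x)"
    then have A: "A \<in> sets M" using x s t by (simp add: sets_P)
    show "emeasure (P (s + t) x) A = emeasure (P s x \<bind> P t) A"
      by (subst emeasure_bind[OF ne ms' A]) (rule chapman_kolmogorov[OF x s t A])
  qed
  show "(\<integral>\<^sup>+z. f z \<partial>P (s + t) x) = (\<integral>\<^sup>+y. (\<integral>\<^sup>+z. f z \<partial>P t y) \<partial>P s x)"
    unfolding eq by (rule nn_integral_bind[OF f ms'])
qed

text \<open>Telescoping of the drift of \<open>U\<close> over n steps. It bounds the sum of the
  first n moments of \<open>V\<close> linearly in n.\<close>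

lemma U_iterate:
  "(\<integral>\<^sup>+y. ennreal (U y) \<partial>P (real n * T) x0) + ennreal c' * (\<Sum>j<n. \<integral>\<^sup>+y. ennreal (V y) \<partial>P (real (Suc j) * T) x0)
     \<le> (\<integral>\<^sup>+y. ennreal (U y) \<partial>P 0 x0) + ennreal (real n * b')"
proof (induction n)
  case (Suc n)
  have nT: "0 \<le> real n * T" "0 \<le> T" using T_pos by auto
  have nT': "real n * T + T = real (Suc n) * T" by (simp add: distrib_right)
  have meas: "(\<lambda>y. ennreal (U y)) \<in> borel_measurable M" "(\<lambda>y. ennreal (c' * V y)) \<in> borel_measurable M"
    "(\<lambda>y. ennreal (U y + c' * V y)) \<in> borel_measurable M"
    using U_measurable V_measurable by auto
  have "(\<integral>\<^sup>+y. ennreal (U y) \<partial>P (real (Suc n) * T) x0) + ennreal c' * (\<integral>\<^sup>+y. ennreal (V y) \<partial>P (real (Suc n) * T) x0)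
      = (\<integral>\<^sup>+y. ennreal (U y + c' * V y) \<partial>P (real (Suc n) * T) x0)"
  proof -
    have xx: "0 \<le> real (Suc n) * T" using T_pos by simp
    have "(\<integral>\<^sup>+y. ennreal (U y + c' * V y) \<partial>P (real (Suc n) * T) x0)
       = (\<integral>\<^sup>+y. ennreal (U y) + ennreal c' * ennreal (V y) \<partial>P (real (Suc n) * T) x0)"
      using U_nonneg V_ge_1 c'_pos space_P[OF x0 xx]
      by (intro nn_integral_cong) (force simp: ennreal_mult'[symmetric] intro!: ennreal_plus mult_nonneg_nonneg)
    also have "\<dots> = (\<integral>\<^sup>+y. ennreal (U y) \<partial>P (real (Suc n) * T) x0) + (\<integral>\<^sup>+y. ennreal c' * ennreal (V y) \<partial>P (real (Suc n) * T) x0)"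
      using U_measurable V_measurable by (intro nn_integral_add measurable_P[OF _ x0 xx]) auto
    also have "(\<integral>\<^sup>+y. ennreal c' * ennreal (V y) \<partial>P (real (Suc n) * T) x0) = ennreal c' * (\<integral>\<^sup>+y. ennreal (V y) \<partial>P (real (Suc n) * T) x0)"
      using V_measurable by (intro nn_integral_cmult measurable_P[OF _ x0 xx]) auto
    finally show ?thesis by simp
  qed
  also have "\<dots> = (\<integral>\<^sup>+z. (\<integral>\<^sup>+y. ennreal (U y + c' * V y) \<partial>P T z) \<partial>P (real n * T) x0)"
    unfolding nT'[symmetric] by (rule nn_integral_chapman_kolmogorov[OF x0 nT meas(3)])
  also have "\<dots> \<le> (\<integral>\<^sup>+z. ennreal (U z) + ennreal b' \<partial>P (real n * T) x0)"
    using drift_U U_nonneg b'_nonneg by (intro nn_integral_mono) (simp add: space_P[OF x0 nT(1)])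
  also have "\<dots> = (\<integral>\<^sup>+z. ennreal (U z) \<partial>P (real n * T) x0) + ennreal b'"
    using prob_space.emeasure_space_1[OF prob_P[OF x0 nT(1)]]
    by (subst nn_integral_add) (auto intro!: measurable_P[OF _ x0 nT(1)] simp: meas)
  finally have 1: "(\<integral>\<^sup>+y. ennreal (U y) \<partial>P (real (Suc n) * T) x0) + ennreal c' * (\<integral>\<^sup>+y. ennreal (V y) \<partial>P (real (Suc n) * T) x0)
    \<le> (\<integral>\<^sup>+z. ennreal (U z) \<partial>P (real n * T) x0) + ennreal b'" .
  have "(\<integral>\<^sup>+y. ennreal (U y) \<partial>P (real (Suc n) * T) x0) + ennreal c' * (\<Sum>j<Suc n. \<integral>\<^sup>+y. ennreal (V y) \<partial>P (real (Suc j) * T) x0)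
    = ((\<integral>\<^sup>+y. ennreal (U y) \<partial>P (real (Suc n) * T) x0) + ennreal c' * (\<integral>\<^sup>+y. ennreal (V y) \<partial>P (real (Suc n) * T) x0))
      + ennreal c' * (\<Sum>j<n. \<integral>\<^sup>+y. ennreal (V y) \<partial>P (real (Suc j) * T) x0)"
    by (simp only: sum.lessThan_Suc distrib_left add.assoc add.commute add.left_commute)
  also have "\<dots> \<le> ((\<integral>\<^sup>+z. ennreal (U z) \<partial>P (real n * T) x0) + ennreal b') 
      + ennreal c' * (\<Sum>j<n. \<integral>\<^sup>+y. ennreal (V y) \<partial>P (real (Suc j) * T) x0)"
    by (intro add_right_mono 1)
  also have "\<dots> \<le> ((\<integral>\<^sup>+y. ennreal (U y) \<partial>P 0 x0) + ennreal (real n * b')) + ennreal b'"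
    using add_right_mono[OF Suc.IH, of "ennreal b'"] by (simp only: add.assoc add.commute add.left_commute)
  also have "\<dots> = (\<integral>\<^sup>+y. ennreal (U y) \<partial>P 0 x0) + ennreal (real (Suc n) * b')"
    using b'_nonneg by (simp add: add.assoc ennreal_plus[symmetric] distrib_right add.commute del: ennreal_plus)
  finally show ?case .
qed simp

text \<open>Moments that all exceeded B from some index on would violate the linear bound on their
  sums. Individual moments are not controlled, but infinitely many of them are.\<close>

lemma V_moment_subsequence:
  obtains B where "0 \<le> B" "\<And>J. \<exists>j\<ge>J. (\<integral>\<^sup>+y. ennreal (V y) \<partial>P (real j * T) x0) \<le> ennreal B"
proof -
  define v where "v = (\<lambda>j. \<integral>\<^sup>+y. ennreal (V y) \<partial>P (real j * T) x0)"
  define u where "u = enn2real (\<integral>\<^sup>+y. ennreal (U y) \<partial>P 0 x0)"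
  \<comment> \<open>The block of indices from J to 2 J has J + 1 terms. If each exceeded this B,
    their sum times c' would be at least (J + 1) (u + 2 b' + 1), more than the permitted u + (2 J +
    1) b'.\<close>
  define B where "B = (u + 2 * b' + 1) / c'"
  have u: "0 \<le> u" "(\<integral>\<^sup>+y. ennreal (U y) \<partial>P 0 x0) = ennreal u" using U_finite by (auto simp: u_def)
  have B: "0 \<le> B" using u b'_nonneg c'_pos by (simp add: B_def)
  have sums: "ennreal c' * (\<Sum>j<n. v (Suc j)) \<le> ennreal (u + real n * b')" for n
  proof -
    have "ennreal c' * (\<Sum>j<n. v (Suc j)) \<le>
        (\<integral>\<^sup>+y. ennreal (U y) \<partial>P (real n * T) x0) + ennreal c' * (\<Sum>j<n. v (Suc j))"
      by (rule add_increasing) auto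
    also have "\<dots> \<le> ennreal u + ennreal (real n * b')"
      using U_iterate[of n] unfolding v_def u(2) .
    finally show ?thesis using u b'_nonneg by simp
  qed
  have "\<exists>j\<ge>J. v j \<le> ennreal B" for J
  proof (rule ccontr)
    assume "\<not> ?thesis"
    then have "\<not> v (Suc j) \<le> ennreal B" if "J \<le> j" for j using that le_SucI by blast
    then have gt: "ennreal B \<le> v (Suc j)" if "J \<le> j" for j using that linear by blast
    have "real (J + 1) * (u + 2 * b' + 1) = c' * (real (J + 1) * B)" using c'_pos by (simp add: B_def)
    then have "ennreal (real (J + 1) * (u + 2 * b' + 1)) = ennreal c' * (\<Sum>j\<in>{J..<2 * J + 1}. ennreal B)"
      using B c'_pos by (simp add: ennreal_mult ennreal_of_nat_eq_real_of_nat mult.left_commute)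
    also have "\<dots> \<le> ennreal c' * (\<Sum>j\<in>{J..<2 * J + 1}. v (Suc j))"
      by (intro mult_left_mono sum_mono gt) auto
    also have "\<dots> \<le> ennreal c' * (\<Sum>j<2 * J + 1. v (Suc j))"
      by (intro mult_left_mono sum_mono2) auto
    also have "\<dots> \<le> ennreal (u + real (2 * J + 1) * b')" by (rule sums)
    finally have "real (J + 1) * (u + 2 * b' + 1) \<le> u + real (2 * J + 1) * b'"
      using u b'_nonneg by (subst (asm) ennreal_le_iff) auto
    moreover have "real (J + 1) * (u + 2 * b' + 1) = real J * u + 2 * (real J * b') + real J + u + 2 * b' + 1"
      "real (2 * J + 1) * b' = 2 * (real J * b') + b'" by (simp_all add: algebra_simps)
    moreover have "0 \<le> real J * u" using u by simp
    ultimately show False using b'_nonneg u by linarith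
  qed
  then show thesis using that[OF B] by (simp add: v_def)
qed

text \<open>The law at time s + t is the average, over the position at time s, of laws at time t.
  Averaging the two-point decay thus compares two different times from one starting point.\<close>

lemma law_increment:
  assumes C: "0 \<le> C" "\<And>A x y t. A \<in> sets M \<Longrightarrow> x \<in> space M \<Longrightarrow> y \<in> space M \<Longrightarrow> 0 \<le> t \<Longrightarrow>
      \<bar>measure (P t x) A - measure (P t y) A\<bar> \<le> C * (V x + V y) * (1 + t) powr (- e)"
    and x: "x \<in> space M" and s: "0 \<le> s" and t: "0 \<le> t" and A: "A \<in> sets M"
  shows "\<bar>measure (P (s + t) x) A - measure (P t x) A\<bar>
      \<le> C * ((\<integral>y. V y \<partial>P s x) + V x) * (1 + t) powr (- e)"
proof -
  interpret prob_space "P s x" using x s by (rule prob_P)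
  have i: "integrable (P s x) (\<lambda>y. measure (P t y) A)" by (rule integrable_measure_P[OF x s t A])
  have iV: "integrable (P s x) V" using x s by (rule integrable_V)
  have "measure (P (s + t) x) A - measure (P t x) A = (\<integral>y. measure (P t y) A - measure (P t x) A \<partial>P s x)"
    using i by (simp add: measure_chapman_kolmogorov[OF x s t A] prob_space)
  also have "\<bar>\<dots>\<bar> \<le> (\<integral>y. \<bar>measure (P t y) A - measure (P t x) A\<bar> \<partial>P s x)"
    by (rule integral_abs_bound)
  also have "\<dots> \<le> (\<integral>y. C * (V y + V x) * (1 + t) powr (- e) \<partial>P s x)"
    using i iV C(2)[OF A _ x t] by (intro integral_mono) (auto simp: space_P[OF x s])
  also have "\<dots> = C * ((\<integral>y. V y \<partial>P s x) + V x) * (1 + t) powr (- e)"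
    using iV by (simp add: prob_space)
  finally show ?thesis .
qed

text \<open>As e > 1, the increments along the skeleton are summable, with a bound that does not
  depend on the set. Hence the probabilities converge uniformly over all sets, and this uniformity
  carries countable additivity to the limit.\<close>

lemma uniform_limit_law:
  obtains \<mu> r where "sets \<mu> = sets M" "prob_space \<mu>" "r \<longlonglongrightarrow> 0" "\<And>n. 0 \<le> r n"
    "\<And>A n. A \<in> sets M \<Longrightarrow> \<bar>measure (P (real n * T) x0) A - measure \<mu> A\<bar> \<le> r n"
proof -
  obtain C where C: "0 < C" "\<And>A x y t. A \<in> sets M \<Longrightarrow> x \<in> space M \<Longrightarrow> y \<in> space M \<Longrightarrow> 0 \<le> t \<Longrightarrow>
      \<bar>measure (P t x) A - measure (P t y) A\<bar> \<le> C * (V x + V y) * (1 + t) powr (- e)"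
    using oscillation_decay by blast
  define a where "a = (\<lambda>n. C * ((\<integral>y. V y \<partial>P T x0) + V x0) * (1 + real n * T) powr (- e))"
  define X where "X = (\<lambda>n A. measure (P (real n * T) x0) A)"
  have nT: "0 \<le> real n * T" for n using T_pos by simp
  have a0: "0 \<le> a n" for n
    using C(1) V_ge_1[OF x0] integral_V_ge_1[OF x0, of T] T_pos by (simp add: a_def)
  have inc: "\<bar>X (Suc n) A - X n A\<bar> \<le> a n" if "A \<in> sets M" for n A
    using law_increment[OF less_imp_le[OF C(1)] C(2) x0 less_imp_le[OF T_pos] nT that, of n]
    by (simp add: X_def a_def distrib_right)
  have suma: "summable a"
  proof -
    define k where "k = C * ((\<integral>y. V y \<partial>P T x0) + V x0) * min 1 T powr (- e)"
    have k: "0 \<le> k" using a0[of 0] by (simp add: a_def k_def)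
    have "summable (\<lambda>n. k * real (Suc n) powr (- e))"
      using e_gt_1 summable_Suc_iff[of "\<lambda>n. real n powr (- e)"] 
      by (intro summable_mult) (simp add: summable_real_powr_iff)
    moreover have "norm (a n) \<le> k * real (Suc n) powr (- e)" for n
    proof -
      have "min 1 T * real (Suc n) \<le> 1 + real n * T"
        using mult_left_mono[of "min 1 T" T "real n"] by (simp add: algebra_simps)
      then have "(1 + real n * T) powr (- e) \<le> (min 1 T * real (Suc n)) powr (- e)"
        using T_pos e_gt_1 by (intro powr_mono2') auto
      also have "\<dots> = min 1 T powr (- e) * real (Suc n) powr (- e)"
        using T_pos by (simp add: powr_mult)
      finally have "(C * ((\<integral>y. V y \<partial>P T x0) + V x0)) * (1 + real n * T) powr (- e) 
         \<le> (C * ((\<integral>y. V y \<partial>P T x0) + V x0)) * (min 1 T powr (- e) * real (Suc n) powr (- e))"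
        using C(1) V_ge_1[OF x0] integral_V_ge_1[OF x0, of T] T_pos by (intro mult_left_mono) auto
      then show ?thesis using a0[of n] by (simp add: a_def k_def mult_ac)
    qed
    ultimately show ?thesis by (rule summable_comparison_test'[where N=0])
  qed
  define r where "r = (\<lambda>n. \<Sum>i. a (i + n))"
  have suma': "summable (\<lambda>i. a (i + n))" for n using suma by (simp add: summable_iff_shift)
  have r0: "0 \<le> r n" for n unfolding r_def by (intro suminf_nonneg suma' a0)
  have rlim: "r \<longlonglongrightarrow> 0"
    using suminf_exist_split[OF _ suma] by (intro LIMSEQ_I) (simp add: r_def)
  define L where "L = (\<lambda>A. lim (\<lambda>n. X n A))"
  have tail: "\<bar>X (m + n) A - X n A\<bar> \<le> r n" if A: "A \<in> sets M" for m n A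
  proof -
    have "\<bar>X (m + n) A - X n A\<bar> = \<bar>\<Sum>i<m. X (Suc (i + n)) A - X (i + n) A\<bar>"
      using sum_lessThan_telescope[of "\<lambda>i. X (i + n) A" m] by simp
    also have "\<dots> \<le> (\<Sum>i<m. a (i + n))" by (intro order_trans[OF sum_abs] sum_mono inc A)
    also have "\<dots> \<le> r n" unfolding r_def by (intro sum_le_suminf suma') (auto intro: a0)
    finally show ?thesis .
  qed
  have L: "(\<lambda>n. X n A) \<longlonglongrightarrow> L A" if A: "A \<in> sets M" for A
  proof -
    have "Cauchy (\<lambda>n. X n A)"
    proof (rule metric_CauchyI)
      fix \<epsilon> :: real assume "0 < \<epsilon>"
      then obtain N where N: "r N < \<epsilon> / 2" 
        using LIMSEQ_D[OF rlim, of "\<epsilon>/2"] by (auto simp: abs_of_nonneg[OF r0])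
      have "dist (X m A) (X n A) < \<epsilon>" if "N \<le> m" "N \<le> n" for m n
        using tail[OF A, of "m - N" N] tail[OF A, of "n - N" N] N that by (simp add: dist_real_def)
      then show "\<exists>N. \<forall>m\<ge>N. \<forall>n\<ge>N. dist (X m A) (X n A) < \<epsilon>" by blast
    qed
    then show ?thesis unfolding L_def by (simp add: Cauchy_convergent convergent_LIMSEQ_iff[symmetric])
  qed
  have Lr: "\<bar>X n A - L A\<bar> \<le> r n" if A: "A \<in> sets M" for A n
  proof -
    have "(\<lambda>m. \<bar>X (m + n) A - X n A\<bar>) \<longlonglongrightarrow> \<bar>L A - X n A\<bar>"
      by (intro tendsto_intros LIMSEQ_ignore_initial_segment L A)
    then have "\<bar>L A - X n A\<bar> \<le> r n" by (rule LIMSEQ_le_const2) (use tail[OF A] in blast)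
    then show ?thesis by (simp add: abs_minus_commute)
  qed
  have L0: "0 \<le> L A" if "A \<in> sets M" for A
    using L[OF that] by (rule LIMSEQ_le_const) (simp add: X_def)
  define \<mu> where "\<mu> = measure_of (space M) (sets M) (\<lambda>A. ennreal (L A))"
  have pos: "positive (sets M) (\<lambda>A. ennreal (L A))"
  proof -
    have "L {} = 0" using L[of "{}"] by (simp add: X_def LIMSEQ_const_iff)
    then show ?thesis by (simp add: positive_def)
  qed
  \<comment> \<open>Continuity at the empty set: one skeleton law that is \<epsilon>/2-close to the
    limit on all sets, and is itself continuous, makes the limit small along decreasing
    sets.\<close>
  have ca: "countably_additive (sets M) (\<lambda>A. ennreal (L A))"
  proof (rule sets.empty_continuous_imp_countably_additive[OF pos])
    show "additive (sets M) (\<lambda>A. ennreal (L A))"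
      unfolding additive_def
    proof (intro ballI impI)
      fix A B assume AB: "A \<in> sets M" "B \<in> sets M" "A \<inter> B = {}"
      have "X n (A \<union> B) = X n A + X n B" for n
      proof -
        interpret prob_space "P (real n * T) x0" using x0 nT by (rule prob_P)
        show ?thesis using AB x0 nT unfolding X_def by (intro finite_measure_Union) (auto simp: sets_P)
      qed
      then have "(\<lambda>n. X n (A \<union> B)) \<longlonglongrightarrow> L A + L B" using tendsto_add[OF L[OF AB(1)] L[OF AB(2)]] by simp
      then have "L (A \<union> B) = L A + L B" using L[of "A \<union> B"] AB LIMSEQ_unique by blast
      then show "ennreal (L (A \<union> B)) = ennreal (L A) + ennreal (L B)" using L0 AB by simp
    qed
    fix A :: "nat \<Rightarrow> _" assume A: "range A \<subseteq> sets M" "decseq A" "\<Inter> (range A) = {}"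
    then have Am: "A i \<in> sets M" for i by auto
    have "(\<lambda>i. L (A i)) \<longlonglongrightarrow> 0"
    proof (rule LIMSEQ_I)
      fix \<epsilon> :: real assume "0 < \<epsilon>"
      then obtain N where N: "r N < \<epsilon> / 2" 
        using LIMSEQ_D[OF rlim, of "\<epsilon>/2"] by (auto simp: abs_of_nonneg[OF r0])
      interpret prob_space "P (real N * T) x0" using x0 nT by (rule prob_P)
      have "(\<lambda>i. X N (A i)) \<longlonglongrightarrow> measure (P (real N * T) x0) (\<Inter>i. A i)"
        unfolding X_def using A x0 nT by (intro finite_Lim_measure_decseq) (auto simp: sets_P)
      then have "(\<lambda>i. X N (A i)) \<longlonglongrightarrow> 0" using A by simp
      then obtain I where I: "\<And>i. I \<le> i \<Longrightarrow> \<bar>X N (A i)\<bar> < \<epsilon> / 2"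
        using LIMSEQ_D[of "\<lambda>i. X N (A i)" 0 "\<epsilon>/2"] \<open>0 < \<epsilon>\<close> by auto
      have "norm (L (A i) - 0) < \<epsilon>" if "I \<le> i" for i
        using Lr[OF Am, of N i] I[OF that] N by (simp)
      then show "\<exists>no. \<forall>n\<ge>no. norm (L (A n) - 0) < \<epsilon>" by blast
    qed
    then show "(\<lambda>i. ennreal (L (A i))) \<longlonglongrightarrow> 0"
      using tendsto_ennrealI by force
  qed auto
  have sets: "sets \<mu> = sets M" by (simp add: \<mu>_def sets.sigma_sets_eq)
  have em: "emeasure \<mu> A = ennreal (L A)" if "A \<in> sets M" for A
    using emeasure_measure_of_sigma[OF sets.sigma_algebra_axioms pos ca that] by (simp add: \<mu>_def)
  show thesis
  proof (rule that[OF sets _ rlim r0])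
    have "L (space M) = 1"
    proof -
      have "X n (space M) = 1" for n
        using prob_space.prob_space[OF prob_P[OF x0 nT]] by (simp add: X_def space_P[OF x0 nT])
      then show ?thesis using L[of "space M"] by (simp add: LIMSEQ_const_iff)
    qed
    then show "prob_space \<mu>" using em[of "space M"] sets_eq_imp_space_eq[OF sets] by (intro prob_spaceI) simp
    show "\<bar>measure (P (real n * T) x0) A - measure \<mu> A\<bar> \<le> r n" if "A \<in> sets M" for A n
      using Lr[OF that, of n] em[OF that] L0[OF that] by (simp add: X_def measure_def)
  qed
qed

text \<open>The limit of the skeleton laws is invariant because a time shift by t changes these laws
  by an amount tending to 0. Its finite moment of V then allows averaging the two-point bound over
  the second point, so that the rate involves V x alone.\<close>

theorem invariant_law:
  obtains \<mu> where "sets \<mu> = sets M" "prob_space \<mu>"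
    "\<And>t A. 0 \<le> t \<Longrightarrow> A \<in> sets M \<Longrightarrow> (\<integral>\<^sup>+x. emeasure (P t x) A \<partial>\<mu>) = emeasure \<mu> A"
    "\<exists>C>0. \<forall>x\<in>space M. \<forall>A\<in>sets M. \<forall>t\<ge>0. \<bar>measure (P t x) A - measure \<mu> A\<bar> \<le> C * V x * (1 + t) powr (- e)"
    "\<And>\<nu>. sets \<nu> = sets M \<Longrightarrow> prob_space \<nu> \<Longrightarrow>
      (\<And>t A. 0 \<le> t \<Longrightarrow> A \<in> sets M \<Longrightarrow> (\<integral>\<^sup>+x. emeasure (P t x) A \<partial>\<nu>) = emeasure \<nu> A) \<Longrightarrow> \<nu> = \<mu>"
proof -
  obtain C where C: "0 < C" "\<And>A x y t. A \<in> sets M \<Longrightarrow> x \<in> space M \<Longrightarrow> y \<in> space M \<Longrightarrow> 0 \<le> t \<Longrightarrow>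
      \<bar>measure (P t x) A - measure (P t y) A\<bar> \<le> C * (V x + V y) * (1 + t) powr (- e)"
    using oscillation_decay by blast
  obtain \<mu> r where \<mu>: "sets \<mu> = sets M" "prob_space \<mu>" and r: "r \<longlonglongrightarrow> 0" "\<And>n. 0 \<le> r n"
    and \<mu>r: "\<And>A n. A \<in> sets M \<Longrightarrow> \<bar>measure (P (real n * T) x0) A - measure \<mu> A\<bar> \<le> r n"
    using uniform_limit_law by blast
  interpret mu: prob_space \<mu> by fact
  have sp: "space \<mu> = space M" using \<mu>(1) by (rule sets_eq_imp_space_eq)
  have nT: "0 \<le> real n * T" for n using T_pos by simp
  have fm: "finite_measure (P (real n * T) x0)" for n
    using prob_P[OF x0 nT] by (rule prob_space.finite_measure)
  have meas_mu: "f \<in> borel_measurable \<mu>" if "f \<in> borel_measurable M" for f :: "'a \<Rightarrow> real"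
    using that by (simp only: measurable_cong_sets[OF \<mu>(1) refl])
  have le1: "emeasure \<mu> A \<le> emeasure (P (real n * T) x0) A + ennreal (r n)"
    and le2: "emeasure (P (real n * T) x0) A \<le> emeasure \<mu> A + ennreal (r n)" if "A \<in> sets M" for A n
    using \<mu>r[OF that, of n] r(2)[of n] 
    by (auto simp: emeasure_P[OF x0 nT] mu.emeasure_eq_measure ennreal_plus[symmetric] simp del: ennreal_plus intro!: ennreal_leI)
  \<comment> \<open>V is unbounded, so the uniform convergence is applied to min V k, where it costs
    k r j. Along the subsequence of bounded moments this gives the bound B for every k, and monotone
    convergence removes the truncation.\<close>
  have V_mu: "(\<integral>\<^sup>+x. ennreal (V x) \<partial>\<mu>) < \<infinity>"
  proof -
    obtain B where B: "0 \<le> B" "\<And>J. \<exists>j\<ge>J. (\<integral>\<^sup>+y. ennreal (V y) \<partial>P (real j * T) x0) \<le> ennreal B"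
      using V_moment_subsequence by blast
    have "(\<integral>\<^sup>+x. ennreal (min (V x) (real k)) \<partial>\<mu>) \<le> ennreal B" for k
    proof (rule ennreal_le_epsilon)
      fix \<epsilon> :: real assume \<epsilon>: "0 < \<epsilon>"
      obtain N where N: "\<And>n. N \<le> n \<Longrightarrow> r n < \<epsilon> / (real k + 1)"
        using LIMSEQ_D[OF r(1), of "\<epsilon> / (real k + 1)"] \<epsilon> by (auto simp: abs_of_nonneg[OF r(2)])
      obtain j where j: "N \<le> j" "(\<integral>\<^sup>+y. ennreal (V y) \<partial>P (real j * T) x0) \<le> ennreal B" using B(2) by blast
      have "(\<integral>\<^sup>+x. ennreal (min (V x) (real k)) \<partial>\<mu>) \<le> (\<integral>\<^sup>+x. ennreal (min (V x) (real k)) \<partial>P (real j * T) x0) + ennreal (real k * r j)"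
        by (rule nn_integral_le_of_emeasure_le[OF mu.finite_measure_axioms fm \<mu>(1) sets_P[OF x0 nT] le1])
          (use V_measurable r(2) in auto)
      also have "\<dots> \<le> ennreal B + ennreal \<epsilon>"
      proof (intro add_mono ennreal_leI)
        show "(\<integral>\<^sup>+x. ennreal (min (V x) (real k)) \<partial>P (real j * T) x0) \<le> ennreal B"
          by (rule order_trans[OF nn_integral_mono j(2)]) (auto intro!: ennreal_leI)
        have "real k * r j \<le> (real k + 1) * (\<epsilon> / (real k + 1))"
          using N[OF j(1)] r(2)[of j] by (intro mult_mono) auto
        then show "real k * r j \<le> \<epsilon>" by simp
      qed
      finally show "(\<integral>\<^sup>+x. ennreal (min (V x) (real k)) \<partial>\<mu>) \<le> ennreal B + ennreal \<epsilon>" .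
    qed
    moreover have "(\<integral>\<^sup>+x. ennreal (V x) \<partial>\<mu>) = (SUP k. \<integral>\<^sup>+x. ennreal (min (V x) (real k)) \<partial>\<mu>)"
    proof -
      have "ennreal v = (SUP k. ennreal (min v (real k)))" for v
      proof (rule antisym)
        obtain k where "v \<le> real k" using real_arch_simple by blast
        then show "ennreal v \<le> (SUP k. ennreal (min v (real k)))" by (intro SUP_upper2[of k]) auto
      qed (auto intro!: SUP_least ennreal_leI)
      then have "(\<integral>\<^sup>+x. ennreal (V x) \<partial>\<mu>) = (\<integral>\<^sup>+x. (SUP k. ennreal (min (V x) (real k))) \<partial>\<mu>)"
        by (rule nn_integral_cong)
      also have "\<dots> = (SUP k. \<integral>\<^sup>+x. ennreal (min (V x) (real k)) \<partial>\<mu>)"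
      proof (rule nn_integral_monotone_convergence_SUP)
        show "incseq (\<lambda>k x. ennreal (min (V x) (real k)))"
          by (auto simp: incseq_def le_fun_def intro!: ennreal_leI)
        show "(\<lambda>x. ennreal (min (V x) (real k))) \<in> borel_measurable \<mu>" for k
          using meas_mu[OF V_measurable] by auto
      qed
      finally show ?thesis .
    qed
    ultimately have "(\<integral>\<^sup>+x. ennreal (V x) \<partial>\<mu>) \<le> ennreal B" by (simp add: SUP_least)
    then show ?thesis using order_le_less_trans[OF _ ennreal_less_top] by (simp add: infinity_ennreal_def)
  qed
  have intV: "integrable \<mu> V"
  proof (rule integrableI_bounded)
    show "V \<in> borel_measurable \<mu>" using V_measurable by (rule meas_mu)
    have "(\<integral>\<^sup>+y. ennreal (norm (V y)) \<partial>\<mu>) = (\<integral>\<^sup>+y. ennreal (V y) \<partial>\<mu>)"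
      using V_ge_1 sp by (intro nn_integral_cong) force
    then show "(\<integral>\<^sup>+y. ennreal (norm (V y)) \<partial>\<mu>) < \<infinity>" using V_mu by simp
  qed
  have stat: "(\<integral>\<^sup>+x. emeasure (P t x) A \<partial>\<mu>) = emeasure \<mu> A" if t: "0 \<le> t" and A: "A \<in> sets M" for t A
  proof -
    define I where "I = enn2real (\<integral>\<^sup>+x. emeasure (P t x) A \<partial>\<mu>)"
    have "(\<integral>\<^sup>+x. emeasure (P t x) A \<partial>\<mu>) \<le> (\<integral>\<^sup>+x. 1 \<partial>\<mu>)"
      using t by (intro nn_integral_mono) (auto simp: sp emeasure_P measure_P_le_1)
    then have I: "(\<integral>\<^sup>+x. emeasure (P t x) A \<partial>\<mu>) = ennreal I"
      using mu.emeasure_space_1 by (auto simp: I_def le_less_trans)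
    have I0: "0 \<le> I" by (simp add: I_def)
    have eq1: "(\<integral>\<^sup>+x. emeasure (P t x) A \<partial>\<mu>) = (\<integral>\<^sup>+x. ennreal (measure (P t x) A) \<partial>\<mu>)"
      using t by (intro nn_integral_cong) (auto simp: sp emeasure_P)
    have eq2: "ennreal (measure (P (real n * T + t) x0) A) = (\<integral>\<^sup>+x. ennreal (measure (P t x) A) \<partial>P (real n * T) x0)" for n
    proof -
      have "ennreal (measure (P (real n * T + t) x0) A) = emeasure (P (real n * T + t) x0) A"
        using nT[of n] t x0 by (simp add: emeasure_P)
      also have "\<dots> = (\<integral>\<^sup>+x. emeasure (P t x) A \<partial>P (real n * T) x0)"
        by (rule chapman_kolmogorov[OF x0 nT t A])
      also have "\<dots> = (\<integral>\<^sup>+x. ennreal (measure (P t x) A) \<partial>P (real n * T) x0)"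
        using t by (intro nn_integral_cong) (auto simp: space_P[OF x0 nT] emeasure_P)
      finally show ?thesis .
    qed
    define k where "k = C * ((\<integral>y. V y \<partial>P t x0) + V x0)"
    \<comment> \<open>Three comparisons: I with the law at time n T + t, that law with the one at n
      T, and the latter with \<mu>. The first and the last cost r n each, the middle one is
      \<open>law_increment\<close>.\<close>
    have "\<bar>I - measure \<mu> A\<bar> \<le> 2 * r n + k * (1 + real n * T) powr (- e)" for n
    proof -
      have "ennreal I \<le> ennreal (measure (P (real n * T + t) x0) A) + ennreal (1 * r n)"
        unfolding I[symmetric] eq1 eq2
        by (rule nn_integral_le_of_emeasure_le[OF mu.finite_measure_axioms fm \<mu>(1) sets_P[OF x0 nT] le1])
          (use measure_P_measurable[OF t A] measure_P_le_1[OF _ t] r(2) in auto)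
      then have 1: "I \<le> measure (P (real n * T + t) x0) A + r n"
        using r(2)[of n] by (simp add: ennreal_plus[symmetric] del: ennreal_plus)
      have "ennreal (measure (P (real n * T + t) x0) A) \<le> ennreal I + ennreal (1 * r n)"
        unfolding I[symmetric] eq1 eq2
        by (rule nn_integral_le_of_emeasure_le[OF fm mu.finite_measure_axioms sets_P[OF x0 nT] \<mu>(1) le2])
          (use measure_P_measurable[OF t A] measure_P_le_1[OF _ t] r(2) in auto)
      then have 2: "measure (P (real n * T + t) x0) A \<le> I + r n"
        using r(2)[of n] I0 by (simp add: ennreal_plus[symmetric] del: ennreal_plus)
      have 3: "\<bar>measure (P (real n * T + t) x0) A - measure (P (real n * T) x0) A\<bar> \<le> k * (1 + real n * T) powr (- e)"
        using law_increment[OF less_imp_le[OF C(1)] C(2) x0 t nT A, of n] by (simp add: k_def add.commute)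
      show ?thesis using 1 2 3 \<mu>r[OF A, of n] by linarith
    qed
    moreover have "(\<lambda>n. 2 * r n + k * (1 + real n * T) powr (- e)) \<longlonglongrightarrow> 2 * 0 + k * 0"
    proof (intro tendsto_intros r tendsto_neg_powr)
      show "filterlim (\<lambda>n. 1 + real n * T) at_top sequentially"
        using T_pos by (intro filterlim_tendsto_add_at_top[OF tendsto_const]
          filterlim_at_top_mult_tendsto_pos[OF tendsto_const] filterlim_real_sequentially)
    qed (use e_gt_1 in auto)
    ultimately have "\<bar>I - measure \<mu> A\<bar> \<le> 2 * 0 + k * 0" by (intro LIMSEQ_le_const) auto
    then show ?thesis unfolding I by (simp add: mu.emeasure_eq_measure)
  qed
  have int_m: "integrable \<nu> (\<lambda>y. measure (P t y) A)" 
    and stat_m: "measure \<nu> A = (\<integral>y. measure (P t y) A \<partial>\<nu>)"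
    if \<nu>: "sets \<nu> = sets M" "prob_space \<nu>"
      and st: "(\<integral>\<^sup>+x. emeasure (P t x) A \<partial>\<nu>) = emeasure \<nu> A"
      and t: "0 \<le> t" and A: "A \<in> sets M" for \<nu> t A
  proof -
    interpret prob_space \<nu> by fact
    have sp': "space \<nu> = space M" using \<nu>(1) by (rule sets_eq_imp_space_eq)
    show i: "integrable \<nu> (\<lambda>y. measure (P t y) A)"
    proof (rule integrable_const_bound[where B=1])
      show "AE y in \<nu>. norm (measure (P t y) A) \<le> 1" using t by (intro AE_I2) (auto simp: sp' measure_P_le_1)
      show "(\<lambda>y. measure (P t y) A) \<in> borel_measurable \<nu>"
        using measure_P_measurable[OF t A] by (simp only: measurable_cong_sets[OF \<nu>(1) refl])
    qed
    have "ennreal (measure \<nu> A) = (\<integral>\<^sup>+x. ennreal (measure (P t x) A) \<partial>\<nu>)"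
      unfolding emeasure_eq_measure[symmetric] st[symmetric]
      using t by (intro nn_integral_cong) (auto simp: sp' emeasure_P)
    also have "\<dots> = ennreal (\<integral>y. measure (P t y) A \<partial>\<nu>)" by (intro nn_integral_eq_integral i) simp
    finally show "measure \<nu> A = (\<integral>y. measure (P t y) A \<partial>\<nu>)" by (simp add: integral_nonneg_AE)
  qed
  \<comment> \<open>Uses V x + q <= (1 + q) V x for q >= 0, which holds since V x >= 1; here q is
    the moment of V under \<mu>.\<close>
  define D where "D = C * (1 + (\<integral>y. V y \<partial>\<mu>))"
  have V_mu1: "0 \<le> (\<integral>y. V y \<partial>\<mu>)"
    using V_ge_1 by (intro integral_nonneg_AE AE_I2) (force simp: sp)
  have D: "0 < D" using C(1) V_mu1 by (simp add: D_def)
  have rate: "\<bar>measure (P t x) A - measure \<mu> A\<bar> \<le> D * V x * (1 + t) powr (- e)"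
    if x: "x \<in> space M" and A: "A \<in> sets M" and t: "0 \<le> t" for x A t
  proof -
    note i = int_m[OF \<mu> stat[OF t A] t A]
    have "measure (P t x) A - measure \<mu> A = (\<integral>y. measure (P t x) A - measure (P t y) A \<partial>\<mu>)"
      using i by (simp add: stat_m[OF \<mu> stat[OF t A] t A] mu.prob_space)
    also have "\<bar>\<dots>\<bar> \<le> (\<integral>y. \<bar>measure (P t x) A - measure (P t y) A\<bar> \<partial>\<mu>)"
      by (rule integral_abs_bound)
    also have "\<dots> \<le> (\<integral>y. C * (V x + V y) * (1 + t) powr (- e) \<partial>\<mu>)"
      using i intV C(2)[OF A x _ t] by (intro integral_mono) (auto simp: sp)
    also have "\<dots> = C * (V x + (\<integral>y. V y \<partial>\<mu>)) * (1 + t) powr (- e)"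
      using intV by (simp add: mu.prob_space)
    also have "\<dots> \<le> C * ((1 + (\<integral>y. V y \<partial>\<mu>)) * V x) * (1 + t) powr (- e)"
    proof (intro mult_right_mono mult_left_mono)
      have "(\<integral>y. V y \<partial>\<mu>) * 1 \<le> (\<integral>y. V y \<partial>\<mu>) * V x" using V_mu1 V_ge_1[OF x] by (rule mult_left_mono[rotated])
      then show "V x + (\<integral>y. V y \<partial>\<mu>) \<le> (1 + (\<integral>y. V y \<partial>\<mu>)) * V x" by (simp add: distrib_right)
    qed (use C(1) in auto)
    finally show ?thesis by (simp add: D_def mult.assoc)
  qed
  show thesis
  proof (rule that[OF \<mu> stat])
    show "\<exists>C>0. \<forall>x\<in>space M. \<forall>A\<in>sets M. \<forall>t\<ge>0. \<bar>measure (P t x) A - measure \<mu> A\<bar> \<le> C * V x * (1 + t) powr (- e)"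
      using D rate by blast
    fix \<nu> assume \<nu>: "sets \<nu> = sets M" "prob_space \<nu>"
      and st: "\<And>t A. 0 \<le> t \<Longrightarrow> A \<in> sets M \<Longrightarrow> (\<integral>\<^sup>+x. emeasure (P t x) A \<partial>\<nu>) = emeasure \<nu> A"
    interpret nu: prob_space \<nu> by fact
    have sp': "space \<nu> = space M" using \<nu>(1) by (rule sets_eq_imp_space_eq)
    show "\<nu> = \<mu>"
    proof (rule measure_eqI)
      show "sets \<nu> = sets \<mu>" using \<nu> \<mu> by simp
      fix A assume "A \<in> sets \<nu>"
      then have A: "A \<in> sets M" using \<nu> by simp
      \<comment> \<open>Nothing is known about the moment of V under \<nu>, so the rate is used only
        pointwise; the probabilities are dominated by 1.\<close>
      have "(\<lambda>n. \<integral>y. measure (P (real n) y) A \<partial>\<nu>) \<longlonglongrightarrow> (\<integral>y. measure \<mu> A \<partial>\<nu>)"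
      proof (rule integral_dominated_convergence[where w="\<lambda>_. 1"])
        show "(\<lambda>y. measure (P (real n) y) A) \<in> borel_measurable \<nu>" for n
          using int_m[OF \<nu> st[OF _ A] _ A, of "real n"] by auto
        show "AE y in \<nu>. (\<lambda>n. measure (P (real n) y) A) \<longlonglongrightarrow> measure \<mu> A"
        proof (intro AE_I2)
          fix y assume "y \<in> space \<nu>"
          then have y: "y \<in> space M" by (simp add: sp')
          have "(\<lambda>n. D * V y * (1 + real n) powr (- e)) \<longlonglongrightarrow> D * V y * 0"
            using e_gt_1 by (intro tendsto_intros tendsto_neg_powr filterlim_tendsto_add_at_top[OF tendsto_const] filterlim_real_sequentially) auto
          then have lim0: "(\<lambda>n. D * V y * (1 + real n) powr (- e)) \<longlonglongrightarrow> 0" by simp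
          have "(\<lambda>n. measure (P (real n) y) A - measure \<mu> A) \<longlonglongrightarrow> 0"
            by (rule tendsto_rabs_zero_cancel, rule tendsto_sandwich[OF _ _ tendsto_const lim0])
              (use rate[OF y A] in auto)
          then show "(\<lambda>n. measure (P (real n) y) A) \<longlonglongrightarrow> measure \<mu> A" by (simp add: LIM_zero_iff)
        qed
      qed (auto simp: sp' measure_P_le_1)
      moreover have "(\<integral>y. measure (P (real n) y) A \<partial>\<nu>) = measure \<nu> A" for n
        by (rule stat_m[OF \<nu> st[OF _ A] _ A, symmetric]) auto
      ultimately have "measure \<nu> A = measure \<mu> A" by (simp add: nu.prob_space LIMSEQ_const_iff)
      then show "emeasure \<nu> A = emeasure \<mu> A" by (simp add: nu.emeasure_eq_measure mu.emeasure_eq_measure)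
    qed
  qed
qed

end

section \<open>Integration by parts against a survival function\<close>

text \<open>On a fine partition the squared increments of the continuous monotone A add up to at
  most the largest increment times the total increase, which is arbitrarily small.\<close>

lemma eq_of_quadratic_increments:
  fixes E A :: "real \<Rightarrow> real"
  assumes t: "0 \<le> t" and A: "continuous_on {0..t} A" "\<And>v w. 0 \<le> v \<Longrightarrow> v \<le> w \<Longrightarrow> w \<le> t \<Longrightarrow> A v \<le> A w"
    and K: "0 \<le> K" "\<And>v w. 0 \<le> v \<Longrightarrow> v \<le> w \<Longrightarrow> w \<le> t \<Longrightarrow> \<bar>E w - E v\<bar> \<le> K * (A w - A v)\<^sup>2"
  shows "E t = E 0"
proof -
  have A0: "0 \<le> A t - A 0" using A(2)[of 0 t] t by simp
  have "\<bar>E t - E 0\<bar> \<le> 0 + \<epsilon>" if \<epsilon>: "0 < \<epsilon>" for \<epsilon>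
  proof -
    define \<epsilon>' where "\<epsilon>' = \<epsilon> / (K * (A t - A 0) + 1)"
    have den: "0 < K * (A t - A 0) + 1" using K A0 by (simp add: add_nonneg_pos)
    have \<epsilon>': "0 < \<epsilon>'" using \<epsilon> den by (simp add: \<epsilon>'_def)
    have "uniformly_continuous_on {0..t} A"
      using A(1) by (rule compact_uniformly_continuous) simp
    then obtain \<delta> where \<delta>: "0 < \<delta>" "\<And>x y. x \<in> {0..t} \<Longrightarrow> y \<in> {0..t} \<Longrightarrow> dist y x < \<delta> \<Longrightarrow> dist (A y) (A x) < \<epsilon>'"
      unfolding uniformly_continuous_on_def using \<epsilon>' by metis
    obtain n :: nat where n: "t / \<delta> < real n" using reals_Archimedean2 by blast
    have n0: "0 < n" using n t \<delta>(1) by (cases n) (auto simp: divide_less_eq)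
    define u where "u = (\<lambda>i::nat. real i * t / real n)"
    have step: "u (Suc i) - u i = t / real n" for i by (simp add: u_def diff_divide_distrib[symmetric] distrib_right)
    have sm: "t / real n < \<delta>" using n \<delta>(1) n0 by (simp add: field_simps)
    have u0: "0 \<le> u i" "u i \<le> u (Suc i)" for i
    proof -
      show "0 \<le> u i" using t by (simp add: u_def)
      have "0 \<le> t / real n" using t by simp
      then show "u i \<le> u (Suc i)" using step[of i] by linarith
    qed
    have ut: "u i \<le> t" if "i \<le> n" for i
      using that t n0 mult_right_mono[of "real i" "real n" t] by (simp add: u_def field_simps)
    have un: "u n = t" "u 0 = 0" using n0 by (auto simp: u_def)
    have "\<bar>E t - E 0\<bar> = \<bar>\<Sum>i<n. E (u (Suc i)) - E (u i)\<bar>"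
      using sum_lessThan_telescope[of "\<lambda>i. E (u i)" n] by (simp add: un)
    also have "\<dots> \<le> (\<Sum>i<n. K * (\<epsilon>' * (A (u (Suc i)) - A (u i))))"
    proof (intro order_trans[OF sum_abs] sum_mono)
      fix i assume "i \<in> {..<n}"
      then have i: "i \<le> n" "Suc i \<le> n" by auto
      have m: "0 \<le> A (u (Suc i)) - A (u i)" using A(2) u0 ut i by simp
      have "dist (u (Suc i)) (u i) < \<delta>" using step[of i] sm t by (simp add: dist_real_def)
      then have "dist (A (u (Suc i))) (A (u i)) < \<epsilon>'" using ut[OF i(1)] ut[OF i(2)] u0(1)[of i] u0(1)[of "Suc i"]
        by (intro \<delta>(2)) auto
      then have "A (u (Suc i)) - A (u i) \<le> \<epsilon>'" using m by (simp add: dist_real_def)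
      then have "(A (u (Suc i)) - A (u i))\<^sup>2 \<le> \<epsilon>' * (A (u (Suc i)) - A (u i))"
        unfolding power2_eq_square using m by (rule mult_right_mono)
      then show "\<bar>E (u (Suc i)) - E (u i)\<bar> \<le> K * (\<epsilon>' * (A (u (Suc i)) - A (u i)))"
        using K(2)[OF u0(1) u0(2) ut[OF i(2)]] K(1) by (meson mult_left_mono order_trans)
    qed
    also have "\<dots> = \<epsilon>' * (K * (A t - A 0))"
      using sum_lessThan_telescope[of "\<lambda>i. A (u i)" n] 
      by (simp add: un sum_distrib_left[symmetric] mult.left_commute)
    also have "\<dots> \<le> \<epsilon>' * (K * (A t - A 0) + 1)" using \<epsilon>' by simp
    also have "\<dots> = \<epsilon>" using den by (simp add: \<epsilon>'_def)
    finally show ?thesis by simp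
  qed
  then have "\<bar>E t - E 0\<bar> \<le> 0" by (rule field_le_epsilon)
  then show ?thesis by simp
qed

lemma continuous_on_Icc_abs_bound:
  fixes f :: "real \<Rightarrow> real"
  assumes "continuous_on {a..b} f"
  obtains B where "\<And>u. u \<in> {a..b} \<Longrightarrow> \<bar>f u\<bar> \<le> B"
proof -
  have "bounded (f ` {a..b})"
    by (rule compact_imp_bounded[OF compact_continuous_image[OF assms compact_Icc]])
  then show thesis unfolding bounded_iff using that by (metis imageI real_norm_def)
qed

text \<open>As \<open>\<rho>\<close> is merely integrable, \<open>D\<close> need not be differentiable everywhere; instead, the increments of the
  two sides agree up to a quadratic error.\<close>

lemma survival_by_parts:
  fixes \<rho> \<phi> \<phi>' :: "real \<Rightarrow> real"
  assumes t: "0 \<le> t" and \<rho>: "set_integrable lborel {0..t} \<rho>" "\<And>u. u \<in> {0..t} \<Longrightarrow> 0 \<le> \<rho> u"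
    and \<phi>: "\<And>u. u \<in> {0..t} \<Longrightarrow> (\<phi> has_real_derivative \<phi>' u) (at u within {0..t})"
    and \<phi>': "continuous_on {0..t} \<phi>'"
  defines "D \<equiv> \<lambda>u. exp (- integral {0..u} \<rho>)"
  shows "set_integrable lborel {0..t} (\<lambda>u. D u * (\<rho> u * \<phi> u - \<phi>' u))" (is ?int)
    "integral {0..t} (\<lambda>u. D u * (\<rho> u * \<phi> u - \<phi>' u)) = \<phi> 0 - D t * \<phi> t" (is ?eq)
proof -
  define I where "I = (\<lambda>u. integral {0..u} \<rho>)"
  have \<rho>i: "\<rho> integrable_on {0..t}" using \<rho>(1) by (rule set_borel_integral_eq_integral)
  have sub: "\<rho> integrable_on {v..w}" if "0 \<le> v" "w \<le> t" for v w
    by (rule integrable_on_subinterval[OF \<rho>i]) (use that in auto)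
  have Icont: "continuous_on {0..t} I" unfolding I_def by (rule indefinite_integral_continuous_1[OF \<rho>i])
  have Iadd: "I w - I v = integral {v..w} \<rho>" if "0 \<le> v" "v \<le> w" "w \<le> t" for v w
    unfolding I_def using Henstock_Kurzweil_Integration.integral_combine[of 0 v w \<rho>] sub[of 0 w] that by simp
  have Imono: "I v \<le> I w" if "0 \<le> v" "v \<le> w" "w \<le> t" for v w
  proof -
    have "0 \<le> integral {v..w} \<rho>" using sub[of v w] \<rho>(2) that by (intro integral_nonneg) auto
    then show ?thesis using Iadd[OF that] by simp
  qed
  have I0: "I 0 = 0" by (simp add: I_def)
  have D: "D u = exp (- I u)" for u by (simp add: D_def I_def)
  have Dcont: "continuous_on {0..t} D" unfolding D by (intro continuous_intros Icont)
  have Dmono: "D w \<le> D v" if "0 \<le> v" "v \<le> w" "w \<le> t" for v w using Imono[OF that] by (simp add: D)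
  have D01: "0 \<le> D u" "u \<in> {0..t} \<Longrightarrow> D u \<le> 1" for u using Imono[of 0 u] I0 by (auto simp: D)
  \<comment> \<open>All three come from 1 + x <= exp x, taken at plus and at minus the increment of
    I, together with D <= 1.\<close>
  have DI: "D v - D w \<le> I w - I v" "D w * (I w - I v) \<le> D v - D w" "D v - D w \<le> D v * (I w - I v)"
    if "0 \<le> v" "v \<le> w" "w \<le> t" for v w
  proof -
    have e: "D w = D v * exp (- (I w - I v))" by (simp add: D mult_exp_exp)
    have e': "D v = D w * exp (I w - I v)" by (simp add: D mult_exp_exp)
    have "1 - (I w - I v) \<le> exp (- (I w - I v))" using exp_ge_add_one_self[of "- (I w - I v)"] by linarith
    then have "D v * (1 - (I w - I v)) \<le> D w" unfolding e using D01(1) by (intro mult_left_mono) auto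
    then show 1: "D v - D w \<le> D v * (I w - I v)" by (simp add: algebra_simps)
    have "D w * (1 + (I w - I v)) \<le> D v" unfolding e' using D01(1) exp_ge_add_one_self by (intro mult_left_mono) auto
    then show "D w * (I w - I v) \<le> D v - D w" by (simp add: algebra_simps)
    have "D v * (I w - I v) \<le> 1 * (I w - I v)" using D01(2)[of v] Imono[OF that] that by (intro mult_right_mono) auto
    then show "D v - D w \<le> I w - I v" using 1 by simp
  qed
  have \<phi>c: "continuous_on {0..t} \<phi>"
    using \<phi> by (intro DERIV_continuous_on) auto
  obtain K1 where K1: "\<And>u. u \<in> {0..t} \<Longrightarrow> \<bar>\<phi> u\<bar> \<le> K1"
    using continuous_on_Icc_abs_bound[OF \<phi>c] by blast
  obtain K2 where K2: "\<And>u. u \<in> {0..t} \<Longrightarrow> \<bar>\<phi>' u\<bar> \<le> K2"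
    using continuous_on_Icc_abs_bound[OF \<phi>'] by blast
  define K where "K = max K1 K2"
  have K: "\<bar>\<phi> u\<bar> \<le> K" "\<bar>\<phi>' u\<bar> \<le> K" if "u \<in> {0..t}" for u using K1[OF that] K2[OF that] by (auto simp: K_def)
  have K0: "0 \<le> K" using K(1)[of 0] t by simp
  have bi: "set_integrable lborel {0..t} (\<lambda>u. f u * \<rho> u)" if f: "continuous_on {0..t} f" for f :: "real \<Rightarrow> real"
  proof -
    obtain B where B: "\<And>u. u \<in> {0..t} \<Longrightarrow> \<bar>f u\<bar> \<le> B"
      using continuous_on_Icc_abs_bound[OF f] by blast
    have fm: "set_borel_measurable lborel {0..t} f"
      using borel_measurable_continuous_on_indicator[OF _ f] by (simp add: set_borel_measurable_def)
    have "integrable lborel (\<lambda>u. (indicator {0..t} u *\<^sub>R f u) * (indicator {0..t} u *\<^sub>R \<rho> u))"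
    proof (rule Bochner_Integration.integrable_bound[of _ "\<lambda>u. B * (indicator {0..t} u *\<^sub>R \<rho> u)"])
      show "integrable lborel (\<lambda>u. B * (indicator {0..t} u *\<^sub>R \<rho> u))"
        using \<rho>(1) by (simp add: set_integrable_def)
      show "(\<lambda>u. (indicator {0..t} u *\<^sub>R f u) * (indicator {0..t} u *\<^sub>R \<rho> u)) \<in> borel_measurable lborel"
        using fm \<rho>(1) by (auto simp: set_borel_measurable_def set_integrable_def)
      show "AE u in lborel. norm ((indicator {0..t} u *\<^sub>R f u) * (indicator {0..t} u *\<^sub>R \<rho> u)) \<le> norm (B * (indicator {0..t} u *\<^sub>R \<rho> u))"
        using B \<rho>(2) by (intro AE_I2) (auto simp: abs_mult indicator_def intro!: mult_right_mono order_trans[OF B abs_ge_self])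
    qed
    then show ?thesis unfolding set_integrable_def
      by (rule Bochner_Integration.integrable_cong[THEN iffD1, rotated 2]) (auto simp: indicator_def)
  qed
  define N where "N = (\<lambda>u. D u * (\<rho> u * \<phi> u - \<phi>' u))"
  have Dphi: "continuous_on {0..t} (\<lambda>u. D u * \<phi> u)" "continuous_on {0..t} (\<lambda>u. D u * \<phi>' u)"
    by (intro continuous_intros Dcont \<phi>c \<phi>')+
  have si1: "set_integrable lborel {0..t} (\<lambda>u. D u * \<phi> u * \<rho> u)" by (rule bi[OF Dphi(1)])
  have si2: "set_integrable lborel {0..t} (\<lambda>u. D u * \<phi>' u)"
    by (rule borel_integrable_atLeastAtMost'[OF Dphi(2)])
  show ?int using set_integral_diff(1)[OF si1 si2] by (simp add: algebra_simps)
  have i1: "(\<lambda>u. D u * \<phi> u * \<rho> u) integrable_on {v..w}" "(\<lambda>u. D u * \<phi>' u) integrable_on {v..w}"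
    "(\<lambda>u. D u * \<rho> u) integrable_on {v..w}" "\<phi>' integrable_on {v..w}" "N integrable_on {v..w}" 
    if "0 \<le> v" "w \<le> t" for v w
  proof -
    have s: "{v..w} \<subseteq> {0..t}" using that by auto
    note r = integrable_on_subinterval[OF set_borel_integral_eq_integral(1) s]
    show "(\<lambda>u. D u * \<phi> u * \<rho> u) integrable_on {v..w}" "(\<lambda>u. D u * \<phi>' u) integrable_on {v..w}"
      "(\<lambda>u. D u * \<rho> u) integrable_on {v..w}" "\<phi>' integrable_on {v..w}" "N integrable_on {v..w}"
      by (rule r[OF si1] r[OF si2] r[OF bi[OF Dcont]] r[OF borel_integrable_atLeastAtMost'[OF \<phi>']] r[OF \<open>?int\<close>[folded N_def]])+
  qed
  \<comment> \<open>The claim is E t = E 0. The control function u + I u measures both kinds of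
    change: u that of \<phi>, which is Lipschitz, and I that of D.\<close>
  define E where "E = (\<lambda>v. integral {0..v} N + D v * \<phi> v)"
  have "E t = E 0"
  proof (rule eq_of_quadratic_increments[OF t, of "\<lambda>u. u + I u" K])
    show "continuous_on {0..t} (\<lambda>u. u + I u)" by (intro continuous_intros Icont)
    show "v + I v \<le> w + I w" if "0 \<le> v" "v \<le> w" "w \<le> t" for v w using Imono[OF that] that by simp
    show "0 \<le> K" by (rule K0)
    fix v w assume vw: "0 \<le> v" "v \<le> w" "w \<le> t"
    have vt: "v \<in> {0..t}" "w \<in> {0..t}" using vw by auto
    define dI where "dI = I w - I v"
    have dI: "0 \<le> dI" using Imono[OF vw] by (simp add: dI_def)
    have Nint: "integral {0..w} N - integral {0..v} N = integral {v..w} N"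
      using Henstock_Kurzweil_Integration.integral_combine[of 0 v w N] i1(5)[of 0 w] vw by simp
    have N: "integral {v..w} N = integral {v..w} (\<lambda>u. D u * \<phi> u * \<rho> u) - integral {v..w} (\<lambda>u. D u * \<phi>' u)"
      unfolding N_def using Henstock_Kurzweil_Integration.integral_diff[OF i1(1)[OF vw(1,3)] i1(2)[OF vw(1,3)]] by (simp add: algebra_simps)
    have FTC: "integral {v..w} \<phi>' = \<phi> w - \<phi> v"
    proof (rule integral_unique[OF fundamental_theorem_of_calculus[OF vw(2)]])
      fix u assume "u \<in> {v..w}"
      then have "(\<phi> has_real_derivative \<phi>' u) (at u within {v..w})"
        using vw by (intro DERIV_subset[OF \<phi>]) auto
      then show "(\<phi> has_vector_derivative \<phi>' u) (at u within {v..w})" by (rule has_real_derivative_iff_has_vector_derivative[THEN iffD1])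
    qed
    have lip: "\<bar>\<phi> u - \<phi> v\<bar> \<le> K * (w - v)" if "u \<in> {v..w}" for u
    proof -
      have "\<phi> u - \<phi> v = integral {v..u} \<phi>'"
      proof (rule integral_unique[OF fundamental_theorem_of_calculus, symmetric])
        fix z assume "z \<in> {v..u}"
        then have "(\<phi> has_real_derivative \<phi>' z) (at z within {v..u})"
          using vw that by (intro DERIV_subset[OF \<phi>]) auto
        then show "(\<phi> has_vector_derivative \<phi>' z) (at z within {v..u})" by (rule has_real_derivative_iff_has_vector_derivative[THEN iffD1])
      qed (use that in auto)
      also have "\<bar>\<dots>\<bar> \<le> K * (u - v)"
        using integral_bound[of v u \<phi>' K] K(2) continuous_on_subset[OF \<phi>', of "{v..u}"] that vw by auto
      also have "\<dots> \<le> K * (w - v)" using that K0 by (intro mult_left_mono) auto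
      finally show ?thesis .
    qed
    have a1: "\<bar>integral {v..w} (\<lambda>u. D u * \<phi> u * \<rho> u) - \<phi> v * integral {v..w} (\<lambda>u. D u * \<rho> u)\<bar> \<le> K * (w - v) * dI"
    proof -
      have "integral {v..w} (\<lambda>u. D u * \<phi> u * \<rho> u) - \<phi> v * integral {v..w} (\<lambda>u. D u * \<rho> u)
         = integral {v..w} (\<lambda>u. D u * \<phi> u * \<rho> u - \<phi> v * (D u * \<rho> u))"
        using Henstock_Kurzweil_Integration.integral_diff[OF i1(1)[OF vw(1,3)]
          integrable_on_mult_right[OF i1(3)[OF vw(1,3)], of "\<phi> v"]] by simp
      also have "norm \<dots> \<le> integral {v..w} (\<lambda>u. K * (w - v) * \<rho> u)"
      proof (rule integral_norm_bound_integral)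
        show "(\<lambda>u. D u * \<phi> u * \<rho> u - \<phi> v * (D u * \<rho> u)) integrable_on {v..w}"
          using i1[OF vw(1,3)] by (intro integrable_diff integrable_on_mult_right) auto
        show "(\<lambda>u. K * (w - v) * \<rho> u) integrable_on {v..w}"
          using sub[OF vw(1,3)] by (intro integrable_on_mult_right)
        fix u assume u: "u \<in> {v..w}"
        then have u': "u \<in> {0..t}" using vw by auto
        have "norm (D u * \<phi> u * \<rho> u - \<phi> v * (D u * \<rho> u)) = D u * \<bar>\<phi> u - \<phi> v\<bar> * \<rho> u"
        proof -
          have "D u * \<phi> u * \<rho> u - \<phi> v * (D u * \<rho> u) = D u * (\<phi> u - \<phi> v) * \<rho> u"
            by (simp add: algebra_simps)
          then show ?thesis using D01(1)[of u] \<rho>(2)[OF u'] by (simp add: abs_mult)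
        qed
        also have "\<dots> \<le> 1 * (K * (w - v)) * \<rho> u"
          using D01(1)[of u] D01(2)[OF u'] lip[OF u] \<rho>(2)[OF u'] by (intro mult_mono) auto
        finally show "norm (D u * \<phi> u * \<rho> u - \<phi> v * (D u * \<rho> u)) \<le> K * (w - v) * \<rho> u" by simp
      qed
      also have "\<dots> = K * (w - v) * dI" using Iadd[OF vw] by (simp add: dI_def)
      finally show ?thesis by simp
    qed
    have a2: "\<bar>integral {v..w} (\<lambda>u. D u * \<rho> u) - (D v - D w)\<bar> \<le> dI * dI"
    proof -
      have "integral {v..w} (\<lambda>u. D w * \<rho> u) \<le> integral {v..w} (\<lambda>u. D u * \<rho> u)"
        using i1[OF vw(1,3)] sub[OF vw(1,3)] Dmono \<rho>(2) vw
        by (intro integral_le integrable_on_mult_right mult_right_mono) auto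
      moreover have "integral {v..w} (\<lambda>u. D u * \<rho> u) \<le> integral {v..w} (\<lambda>u. D v * \<rho> u)"
        using i1[OF vw(1,3)] sub[OF vw(1,3)] Dmono \<rho>(2) vw
        by (intro integral_le integrable_on_mult_right mult_right_mono) auto
      ultimately have "D w * dI \<le> integral {v..w} (\<lambda>u. D u * \<rho> u)" "integral {v..w} (\<lambda>u. D u * \<rho> u) \<le> D v * dI"
        using Iadd[OF vw] by (auto simp: dI_def)
      moreover have "(D v - D w) * dI \<le> dI * dI" using DI(1)[OF vw] dI by (intro mult_right_mono) (auto simp: dI_def)
      ultimately show ?thesis using DI(2,3)[OF vw] by (simp add: dI_def[symmetric] abs_le_iff algebra_simps)
    qed
    have a3: "\<bar>integral {v..w} (\<lambda>u. D u * \<phi>' u) - D w * (\<phi> w - \<phi> v)\<bar> \<le> K * dI * (w - v)"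
    proof -
      have "integral {v..w} (\<lambda>u. D u * \<phi>' u) - D w * (\<phi> w - \<phi> v) = integral {v..w} (\<lambda>u. D u * \<phi>' u - D w * \<phi>' u)"
        using Henstock_Kurzweil_Integration.integral_diff[OF i1(2)[OF vw(1,3)]
          integrable_on_mult_right[OF i1(4)[OF vw(1,3)], of "D w"]] by (simp add: FTC)
      also have "norm \<dots> \<le> integral {v..w} (\<lambda>u. K * dI)"
      proof (rule integral_norm_bound_integral)
        show "(\<lambda>u. D u * \<phi>' u - D w * \<phi>' u) integrable_on {v..w}"
          using i1[OF vw(1,3)] by (intro integrable_diff integrable_on_mult_right) auto
        fix u assume u: "u \<in> {v..w}"
        then have u': "u \<in> {0..t}" using vw by auto
        have "D u - D w \<le> dI" using DI(1)[of u w] u vw Imono[of v u] by (simp add: dI_def)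
        moreover have "0 \<le> D u - D w" using Dmono[of u w] u vw by simp
        moreover have "norm (D u * \<phi>' u - D w * \<phi>' u) = \<bar>D u - D w\<bar> * \<bar>\<phi>' u\<bar>"
          by (simp add: abs_mult[symmetric] left_diff_distrib)
        ultimately show "norm (D u * \<phi>' u - D w * \<phi>' u) \<le> K * dI"
          using mult_mono[of "D u - D w" dI "\<bar>\<phi>' u\<bar>" K] K(2)[OF u'] dI by (simp add: mult.commute)
      qed auto
      also have "\<dots> = K * dI * (w - v)" using vw by simp
      finally show ?thesis by simp
    qed
    \<comment> \<open>The first-order terms cancel once \<phi> is frozen at v, the integral of D
      \<rho> is replaced by D v - D w, and D is frozen at w. The three errors are those of
      \<open>a1\<close>, \<open>a2\<close> and \<open>a3\<close>, each bounded by a product of two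
      increments.\<close>
    have "E w - E v = (integral {v..w} (\<lambda>u. D u * \<phi> u * \<rho> u) - \<phi> v * integral {v..w} (\<lambda>u. D u * \<rho> u))
        + \<phi> v * (integral {v..w} (\<lambda>u. D u * \<rho> u) - (D v - D w))
        - (integral {v..w} (\<lambda>u. D u * \<phi>' u) - D w * (\<phi> w - \<phi> v))"
      using Nint N by (simp add: E_def algebra_simps)
    also have "\<bar>\<dots>\<bar> \<le> K * (w - v) * dI + K * (dI * dI) + K * dI * (w - v)"
    proof -
      have "\<bar>\<phi> v * (integral {v..w} (\<lambda>u. D u * \<rho> u) - (D v - D w))\<bar> \<le> K * (dI * dI)"
        unfolding abs_mult using K(1)[OF vt(1)] a2 K0 by (intro mult_mono) auto
      then show ?thesis using a1 a3 by linarith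
    qed
    also have "\<dots> \<le> K * ((w - v) + dI)\<^sup>2"
    proof -
      have "K * ((w - v) + dI)\<^sup>2 = K * (w - v) * dI + K * (dI * dI) + K * dI * (w - v) + K * (w - v)\<^sup>2"
        by (simp add: power2_eq_square algebra_simps)
      then show ?thesis using K0 by simp
    qed
    also have "(w - v) + dI = w + I w - (v + I v)" by (simp add: dI_def)
    finally show "\<bar>E w - E v\<bar> \<le> K * (w + I w - (v + I v))\<^sup>2" .
  qed
  then show ?eq by (simp add: E_def N_def D I0)
qed

section \<open>The piecewise deterministic process\<close>

lemma space_ES_M [simp]: "space ES_M = ES_space"
  by (auto simp: ES_M_def space_restrict_space space_pair_measure space_PiM)

lemma measurable_ES_fst [measurable]: "fst \<in> measurable ES_M (count_space UNIV)"
  unfolding ES_M_def by (intro measurable_restrict_space1 measurable_fst)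

lemma measurable_ES_coord [measurable]: "(\<lambda>s. snd s i) \<in> borel_measurable ES_M"
  unfolding ES_M_def
  by (intro measurable_restrict_space1 measurable_compose[OF measurable_snd measurable_component_singleton]) simp

lemma measurable_into_ES_M:
  assumes "\<And>x. x \<in> space N \<Longrightarrow> f x \<in> ES_space"
    and "(\<lambda>x. fst (f x)) \<in> measurable N (count_space UNIV)"
    and "\<And>i. (\<lambda>x. snd (f x) i) \<in> borel_measurable N"
  shows "f \<in> measurable N ES_M"
  unfolding ES_M_def
proof (rule measurable_restrict_space2)
  show "f \<in> space N \<rightarrow> ES_space" using assms(1) by auto
  have "(\<lambda>x. (fst (f x), \<lambda>i. snd (f x) i)) \<in> measurable N (count_space UNIV \<Otimes>\<^sub>M (\<Pi>\<^sub>M i\<in>(UNIV::nat set). (borel :: real measure)))"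
    by (intro measurable_Pair assms(2) measurable_PiM_single' assms(3)) auto
  then show "f \<in> measurable N (count_space UNIV \<Otimes>\<^sub>M (\<Pi>\<^sub>M i\<in>(UNIV::nat set). (borel :: real measure)))"
    by simp
qed

lemma ES_space_nonneg: "s \<in> ES_space \<Longrightarrow> 0 \<le> snd s i"
  by (cases "i \<le> fst s") (auto simp: ES_space_def)

lemma ES_space_zero: "s \<in> ES_space \<Longrightarrow> fst s < i \<Longrightarrow> snd s i = 0"
  by (auto simp: ES_space_def)

lemma ES_space_I: "(\<And>i. 0 \<le> snd s i) \<Longrightarrow> (\<And>i. fst s < i \<Longrightarrow> snd s i = 0) \<Longrightarrow> s \<in> ES_space"
  by (cases s) (auto simp: ES_space_def)

lemma fst_ES_flow [simp]: "fst (ES_flow u s) = fst s"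
  and snd_ES_flow: "snd (ES_flow u s) i = (if i \<le> fst s then snd s i + u else 0)"
  by (auto simp: ES_flow_def)

lemma ES_flow_space: "s \<in> ES_space \<Longrightarrow> 0 \<le> u \<Longrightarrow> ES_flow u s \<in> ES_space"
  by (rule ES_space_I) (auto simp: snd_ES_flow ES_space_nonneg)

lemma ES_flow_add: "ES_flow u (ES_flow t s) = ES_flow (t + u) s"
  by (auto simp: ES_flow_def)

lemma ES_flow_0: "s \<in> ES_space \<Longrightarrow> ES_flow 0 s = s"
  by (cases s) (auto simp: ES_flow_def ES_space_def fun_eq_iff)

lemma ES_ins_space: "s \<in> ES_space \<Longrightarrow> ES_ins j s \<in> ES_space"
  by (rule ES_space_I) (auto simp: ES_ins_def ES_space_nonneg ES_space_zero)

lemma ES_del_space: "s \<in> ES_space \<Longrightarrow> i \<le> fst s \<Longrightarrow> ES_del i s \<in> ES_space"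
  by (rule ES_space_I) (auto simp: ES_del_def ES_space_nonneg ES_space_zero)

lemma measurable_ES_flow [measurable (raw)]:
  assumes [measurable]: "f \<in> measurable N ES_M" "g \<in> borel_measurable N"
  shows "(\<lambda>x. ES_flow (max 0 (g x)) (f x)) \<in> measurable N ES_M"
proof (rule measurable_into_ES_M)
  show "ES_flow (max 0 (g x)) (f x) \<in> ES_space" if "x \<in> space N" for x
    using measurable_space[OF assms(1) that] by (intro ES_flow_space) auto
  show "(\<lambda>x. fst (ES_flow (max 0 (g x)) (f x))) \<in> measurable N (count_space UNIV)" by simp
  show "(\<lambda>x. snd (ES_flow (max 0 (g x)) (f x)) i) \<in> borel_measurable N" for i
    unfolding snd_ES_flow by measurable
qed

lemma measurable_ES_ins [measurable (raw)]:
  assumes [measurable]: "f \<in> measurable N ES_M"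
  shows "(\<lambda>x. ES_ins j (f x)) \<in> measurable N ES_M"
proof (rule measurable_into_ES_M)
  show "ES_ins j (f x) \<in> ES_space" if "x \<in> space N" for x
    using measurable_space[OF assms that] by (intro ES_ins_space) auto
  show "(\<lambda>x. fst (ES_ins j (f x))) \<in> measurable N (count_space UNIV)" by (simp add: ES_ins_def)
  show "(\<lambda>x. snd (ES_ins j (f x)) i) \<in> borel_measurable N" for i
    unfolding ES_ins_def snd_conv by measurable
qed

lemma measurable_ES_del [measurable (raw)]:
  assumes [measurable]: "f \<in> measurable N ES_M"
  shows "(\<lambda>x. ES_del (min i (fst (f x))) (f x)) \<in> measurable N ES_M"
proof (rule measurable_into_ES_M)
  show "ES_del (min i (fst (f x))) (f x) \<in> ES_space" if "x \<in> space N" for x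
    using measurable_space[OF assms that] by (intro ES_del_space) auto
  show "(\<lambda>x. fst (ES_del (min i (fst (f x))) (f x))) \<in> measurable N (count_space UNIV)" 
    unfolding ES_del_def fst_conv by measurable
  show "(\<lambda>x. snd (ES_del (min i (fst (f x))) (f x)) k) \<in> borel_measurable N" for k
    unfolding ES_del_def snd_conv by measurable
qed

lemma suminf_ennreal_swap:
  fixes f :: "nat \<Rightarrow> nat \<Rightarrow> ennreal"
  shows "(\<Sum>i. \<Sum>j. f i j) = (\<Sum>j. \<Sum>i. f i j)"
proof -
  have "(\<Sum>i. \<Sum>j. f i j) = (\<integral>\<^sup>+i. (\<Sum>j. f i j) \<partial>count_space UNIV)"
    by (rule nn_integral_count_space_nat[symmetric])
  also have "\<dots> = (\<Sum>j. \<integral>\<^sup>+i. f i j \<partial>count_space UNIV)" by (rule nn_integral_suminf) simp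
  finally show ?thesis by (simp add: nn_integral_count_space_nat)
qed

text \<open>Summation along antidiagonals. With k the total number of jumps and i the number before
  an intermediate time, it passes from fixed jump numbers to the Chapman-Kolmogorov
  equation.\<close>

lemma suminf_ennreal_triangle:
  fixes f :: "nat \<Rightarrow> nat \<Rightarrow> ennreal"
  shows "(\<Sum>k. \<Sum>i\<le>k. f i (k - i)) = (\<Sum>i. \<Sum>j. f i j)"
proof -
  have "(\<Sum>k. \<Sum>i\<le>k. f i (k - i)) = (\<Sum>k. \<Sum>i. if i \<le> k then f i (k - i) else 0)"
    by (intro suminf_cong, subst suminf_finite[where N="{..k}" for k]) auto
  also have "\<dots> = (\<Sum>i. \<Sum>k. if i \<le> k then f i (k - i) else 0)" by (rule suminf_ennreal_swap)
  also have "\<dots> = (\<Sum>i. \<Sum>j. f i j)"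
  proof (rule suminf_cong)
    fix i
    have "(\<Sum>k. if i \<le> k then f i (k - i) else 0) = (\<Sum>k. if i \<le> k + i then f i (k + i - i) else 0) + (\<Sum>k<i. if i \<le> k then f i (k - i) else 0)"
      by (rule suminf_offset) simp
    then show "(\<Sum>k. if i \<le> k then f i (k - i) else 0) = (\<Sum>j. f i j)" by simp
  qed
  finally show ?thesis .
qed

text \<open>Ages are nonnegative and a hazard is unconstrained at negative arguments, hence
  \<open>max 0\<close> in the measurability of \<open>h\<close>. Local integrability of
  \<open>h\<close> makes the survival function strictly positive.\<close>

locale ES_process =
  fixes lam :: "es_state \<Rightarrow> real" and h :: "real \<Rightarrow> real" and Lam :: real
  assumes lam_measurable [measurable]: "lam \<in> borel_measurable ES_M"
    and lam_nonneg: "s \<in> ES_space \<Longrightarrow> 0 \<le> lam s"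
    and lam_le: "s \<in> ES_space \<Longrightarrow> lam s \<le> Lam * real (max 1 (fst s))"
    and h_measurable [measurable]: "(\<lambda>t. h (max 0 t)) \<in> borel_measurable borel"
    and h_nonneg: "0 \<le> x \<Longrightarrow> 0 \<le> h x"
    and h_integrable: "0 \<le> x \<Longrightarrow> 0 \<le> t \<Longrightarrow> (\<integral>\<^sup>+r\<in>{0..t}. ennreal (h (x + r)) \<partial>lborel) < \<infinity>"
begin

section \<open>Total jump rate and survival function\<close>

lemma Lam_nonneg: "0 \<le> Lam"
proof -
  have "(0, \<lambda>_. 0) \<in> ES_space" by (auto simp: ES_space_def)
  from lam_nonneg[OF this] lam_le[OF this] show ?thesis by simp
qed

abbreviation "rate \<equiv> ES_rate lam h"
abbreviation "surv \<equiv> ES_surv lam h"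

lemma rate_nonneg: "s \<in> ES_space \<Longrightarrow> 0 \<le> rate s"
  unfolding ES_rate_def by (intro add_nonneg_nonneg sum_nonneg lam_nonneg h_nonneg ES_space_nonneg) auto

lemma h_coord_measurable [measurable (raw)]:
  assumes [measurable]: "f \<in> measurable N ES_M"
  shows "(\<lambda>x. h (snd (f x) i)) \<in> borel_measurable N"
proof -
  have "(\<lambda>x. h (max 0 (snd (f x) i))) \<in> borel_measurable N"
    by (rule measurable_compose[OF _ h_measurable]) measurable
  then show ?thesis
    using measurable_space[OF assms] 
    by (subst measurable_cong[where g="\<lambda>x. h (max 0 (snd (f x) i))"]) (auto simp: max_absorb2 ES_space_nonneg)
qed

lemma rate_measurable [measurable]: "rate \<in> borel_measurable ES_M"
proof -
  have "(\<lambda>s. \<Sum>i\<in>{1..fst s}. h (snd s i)) \<in> borel_measurable ES_M"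
    by (rule measurable_compose_countable[OF _ measurable_ES_fst]) measurable
  then show ?thesis unfolding ES_rate_def by measurable
qed

text \<open>Clamping the time at \<open>0\<close> keeps \<open>ES_flow\<close> inside the state space, hence measurable, for all times.\<close>

definition hazard_integral :: "es_state \<Rightarrow> real \<Rightarrow> ennreal" where
  "hazard_integral s u = (\<integral>\<^sup>+r\<in>{0..u}. ennreal (rate (ES_flow (max 0 r) s)) \<partial>lborel)"

lemma hazard_integral_eq:
  "hazard_integral s u = (\<integral>\<^sup>+r\<in>{0..u}. ennreal (rate (ES_flow r s)) \<partial>lborel)"
  unfolding hazard_integral_def by (intro nn_integral_cong) (auto split: split_indicator)

lemma hazard_integral_measurable [measurable (raw)]:
  assumes [measurable]: "f \<in> measurable N ES_M" "g \<in> borel_measurable N"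
  shows "(\<lambda>x. hazard_integral (f x) (g x)) \<in> borel_measurable N"
proof -
  have "hazard_integral s u = (\<integral>\<^sup>+r. ennreal (rate (ES_flow (max 0 r) s)) * (if 0 \<le> r \<and> r \<le> u then 1 else 0) \<partial>lborel)" for s u
    unfolding hazard_integral_def by (intro nn_integral_cong) (auto split: split_indicator)
  then show ?thesis by simp
qed

lemma hazard_integral_le:
  assumes s: "s \<in> ES_space" and u: "0 \<le> u"
  shows "hazard_integral s u \<le> ennreal (Lam * real (max 1 (fst s))) * ennreal u
     + (\<Sum>i\<in>{1..fst s}. \<integral>\<^sup>+r\<in>{0..u}. ennreal (h (snd s i + r)) \<partial>lborel)"
proof -
  define n where "n = fst s"
  have fs: "ES_flow (max 0 r) s \<in> ES_space" for r using s by (intro ES_flow_space) auto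
  have "hazard_integral s u \<le> (\<integral>\<^sup>+r. (ennreal (Lam * real (max 1 n)) + (\<Sum>i\<in>{1..n}. ennreal (h (snd s i + max 0 r)))) * indicator {0..u} r \<partial>lborel)"
    unfolding hazard_integral_def
  proof (intro nn_integral_mono mult_right_mono)
    fix r :: real
    have "rate (ES_flow (max 0 r) s) = lam (ES_flow (max 0 r) s) + (\<Sum>i\<in>{1..n}. h (snd s i + max 0 r))"
      by (simp add: ES_rate_def n_def snd_ES_flow)
    also have "\<dots> \<le> Lam * real (max 1 n) + (\<Sum>i\<in>{1..n}. h (snd s i + max 0 r))"
      using lam_le[OF fs] by (simp add: n_def)
    finally have "ennreal (rate (ES_flow (max 0 r) s)) \<le> ennreal (Lam * real (max 1 n) + (\<Sum>i\<in>{1..n}. h (snd s i + max 0 r)))"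
      by (rule ennreal_leI)
    also have "\<dots> = ennreal (Lam * real (max 1 n)) + (\<Sum>i\<in>{1..n}. ennreal (h (snd s i + max 0 r)))"
      using Lam_nonneg s by (subst ennreal_plus) (auto intro!: sum_nonneg h_nonneg add_nonneg_nonneg ES_space_nonneg sum_ennreal[symmetric])
    finally show "ennreal (rate (ES_flow (max 0 r) s)) \<le> ennreal (Lam * real (max 1 n)) + (\<Sum>i\<in>{1..n}. ennreal (h (snd s i + max 0 r)))" .
  qed auto
  also have "\<dots> = ennreal (Lam * real (max 1 n)) * ennreal u + (\<Sum>i\<in>{1..n}. \<integral>\<^sup>+r\<in>{0..u}. ennreal (h (snd s i + r)) \<partial>lborel)"
  proof -
    have hm: "(\<lambda>r. h (snd s i + max 0 r)) \<in> borel_measurable borel" for i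
    proof -
      have "(\<lambda>r. h (max 0 (snd s i + max 0 r))) \<in> borel_measurable borel"
        by (rule measurable_compose[OF _ h_measurable]) measurable
      then show ?thesis using ES_space_nonneg[OF s, of i] by (simp add: max_absorb2)
    qed
    note [measurable] = hm
    have "(\<integral>\<^sup>+r. (ennreal (Lam * real (max 1 n)) + (\<Sum>i\<in>{1..n}. ennreal (h (snd s i + max 0 r)))) * indicator {0..u} r \<partial>lborel)
       = (\<integral>\<^sup>+r. ennreal (Lam * real (max 1 n)) * indicator {0..u} r + (\<Sum>i\<in>{1..n}. ennreal (h (snd s i + max 0 r)) * indicator {0..u} r) \<partial>lborel)"
      by (simp add: distrib_right sum_distrib_right)
    also have "\<dots> = (\<integral>\<^sup>+r. ennreal (Lam * real (max 1 n)) * indicator {0..u} r \<partial>lborel) + (\<Sum>i\<in>{1..n}. \<integral>\<^sup>+r. ennreal (h (snd s i + max 0 r)) * indicator {0..u} r \<partial>lborel)"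
    proof -
      have eq: "(\<integral>\<^sup>+r. (\<Sum>i\<in>{1..n}. ennreal (h (snd s i + max 0 r)) * indicator {0..u} r) \<partial>lborel)
          = (\<Sum>i\<in>{1..n}. \<integral>\<^sup>+r. ennreal (h (snd s i + max 0 r)) * indicator {0..u} r \<partial>lborel)"
        by (rule nn_integral_sum) measurable
      show ?thesis unfolding eq[symmetric] by (intro nn_integral_add) measurable
    qed
    also have "(\<integral>\<^sup>+r. ennreal (Lam * real (max 1 n)) * indicator {0..u} r \<partial>lborel) = ennreal (Lam * real (max 1 n)) * ennreal u"
      using u by (simp add: nn_integral_cmult_indicator)
    also have "(\<Sum>i\<in>{1..n}. \<integral>\<^sup>+r. ennreal (h (snd s i + max 0 r)) * indicator {0..u} r \<partial>lborel)
        = (\<Sum>i\<in>{1..n}. \<integral>\<^sup>+r\<in>{0..u}. ennreal (h (snd s i + r)) \<partial>lborel)"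
      by (intro sum.cong refl nn_integral_cong) (auto split: split_indicator)
    finally show ?thesis .
  qed
  finally show ?thesis by (simp only: n_def)
qed

text \<open>Consequently the branch of \<open>ES_surv\<close> with value 0 is never taken on the
  state space.\<close>

lemma hazard_integral_finite:
  assumes s: "s \<in> ES_space" and u: "0 \<le> u"
  shows "hazard_integral s u < \<infinity>"
proof -
  note hazard_integral_le[OF s u]
  also have "ennreal (Lam * real (max 1 (fst s))) * ennreal u
     + (\<Sum>i\<in>{1..fst s}. \<integral>\<^sup>+r\<in>{0..u}. ennreal (h (snd s i + r)) \<partial>lborel) < \<infinity>"
    using h_integrable[OF ES_space_nonneg[OF s] u]
    by (auto simp: ennreal_mult_less_top ennreal_add_less_top)
  finally show ?thesis .
qed

lemma surv_eq: "s \<in> ES_space \<Longrightarrow> 0 \<le> u \<Longrightarrow> surv s u = exp (- enn2real (hazard_integral s u))"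
  using hazard_integral_finite[of s u] by (simp add: ES_surv_def hazard_integral_eq[symmetric] Let_def)

lemma surv_nonneg: "0 \<le> surv s u"
  by (simp add: ES_surv_def Let_def)

lemma surv_le_1: "surv s u \<le> 1"
  by (simp add: ES_surv_def Let_def)

lemma surv_0: "surv s 0 = 1"
  by (simp add: ES_surv_def Let_def)

lemma surv_measurable [measurable (raw)]:
  assumes [measurable]: "f \<in> measurable N ES_M" "g \<in> borel_measurable N"
  shows "(\<lambda>x. surv (f x) (g x)) \<in> borel_measurable N"
  unfolding ES_surv_def Let_def hazard_integral_eq[symmetric] by measurable

text \<open>Translation from the extended nonnegative integral to the gauge integral, the form in
  which additivity over intervals and integration by parts are available.\<close>

lemma hazard_integral_integral:
  assumes s: "s \<in> ES_space" and u: "0 \<le> u"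
  shows "set_integrable lborel {0..u} (\<lambda>r. rate (ES_flow (max 0 r) s))"
    "surv s u = exp (- integral {0..u} (\<lambda>r. rate (ES_flow (max 0 r) s)))"
proof -
  have fs: "ES_flow (max 0 r) s \<in> ES_space" for r using s by (intro ES_flow_space) auto
  have s': "(\<lambda>_::real. s) \<in> measurable borel ES_M" using s by simp
  note [measurable] = measurable_ES_flow[OF s']
  have eq: "(\<integral>\<^sup>+r. ennreal (norm (indicator {0..u} r *\<^sub>R rate (ES_flow (max 0 r) s))) \<partial>lborel) = hazard_integral s u"
    unfolding hazard_integral_def using rate_nonneg[OF fs] by (intro nn_integral_cong) (auto split: split_indicator)
  have int: "integrable lborel (\<lambda>r. indicator {0..u} r *\<^sub>R rate (ES_flow (max 0 r) s))"
    by (rule integrableI_bounded) (use eq hazard_integral_finite[OF s u] in auto)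
  then show si: "set_integrable lborel {0..u} (\<lambda>r. rate (ES_flow (max 0 r) s))" by (simp add: set_integrable_def)
  have "hazard_integral s u = (\<integral>\<^sup>+r. ennreal (indicator {0..u} r *\<^sub>R rate (ES_flow (max 0 r) s)) \<partial>lborel)"
    unfolding hazard_integral_def by (intro nn_integral_cong) (auto split: split_indicator)
  also have "\<dots> = ennreal (LINT r:{0..u}|lborel. rate (ES_flow (max 0 r) s))"
    unfolding set_lebesgue_integral_def using rate_nonneg[OF fs]
    by (intro nn_integral_eq_integral int) auto
  also have "(LINT r:{0..u}|lborel. rate (ES_flow (max 0 r) s)) = integral {0..u} (\<lambda>r. rate (ES_flow (max 0 r) s))"
    by (rule set_borel_integral_eq_integral(2)[OF si])
  finally have "hazard_integral s u = ennreal (integral {0..u} (\<lambda>r. rate (ES_flow (max 0 r) s)))" .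
  moreover have "0 \<le> integral {0..u} (\<lambda>r. rate (ES_flow (max 0 r) s))"
    by (rule integral_nonneg[OF set_borel_integral_eq_integral(1)[OF si] rate_nonneg[OF fs]])
  ultimately show "surv s u = exp (- integral {0..u} (\<lambda>r. rate (ES_flow (max 0 r) s)))"
    using surv_eq[OF s u] by simp
qed

lemma surv_add:
  assumes s: "s \<in> ES_space" and t: "0 \<le> t" and u: "0 \<le> u"
  shows "surv s (t + u) = surv s t * surv (ES_flow t s) u"
proof -
  let ?\<rho> = "\<lambda>r. rate (ES_flow (max 0 r) s)"
  have tu: "0 \<le> t + u" using t u by simp
  have i: "?\<rho> integrable_on {0..t + u}"
    using hazard_integral_integral(1)[OF s tu] by (rule set_borel_integral_eq_integral(1))
  have "integral {0..t} ?\<rho> + integral {t..t + u} ?\<rho> = integral {0..t + u} ?\<rho>"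
    using t u i by (intro Henstock_Kurzweil_Integration.integral_combine) auto
  moreover have "integral {t..t + u} ?\<rho> = integral {0..u} (\<lambda>r. ?\<rho> (r + t))"
    using integral_shift_real_ivl[of t t "t + u" ?\<rho>] by simp
  moreover have "integral {0..u} (\<lambda>r. ?\<rho> (r + t)) = integral {0..u} (\<lambda>r. rate (ES_flow (max 0 r) (ES_flow t s)))"
    using t by (intro integral_cong) (simp add: ES_flow_add max_absorb2 add.commute)
  ultimately show ?thesis
    using hazard_integral_integral(2)[OF s tu] hazard_integral_integral(2)[OF s t] hazard_integral_integral(2)[OF ES_flow_space[OF s t] u]
    by (simp add: exp_add[symmetric])
qed

text \<open>Gain part of the generator. The loss \<open>rate s * \<Phi> s\<close> does not appear
  because the survival function accounts for it.\<close>

definition jumps :: "(es_state \<Rightarrow> ennreal) \<Rightarrow> es_state \<Rightarrow> ennreal" where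
  "jumps \<Phi> s = ennreal (lam s / real (Suc (fst s))) * (\<Sum>j\<in>{1..Suc (fst s)}. \<Phi> (ES_ins j s))
     + (\<Sum>i\<in>{1..fst s}. ennreal (h (snd s i)) * \<Phi> (ES_del i s))"

text \<open>Here \<Phi> y v belongs to the state y with remaining time v, and it is evaluated right
  after the first jump.\<close>

definition first_jump :: "(es_state \<Rightarrow> real \<Rightarrow> ennreal) \<Rightarrow> es_state \<Rightarrow> real \<Rightarrow> ennreal" where
  "first_jump \<Phi> s t = (\<integral>\<^sup>+u\<in>{0..t}. ennreal (surv s u) * jumps (\<lambda>y. \<Phi> y (t - u)) (ES_flow (max 0 u) s) \<partial>lborel)"

text \<open>\<open>ES_P\<close> with a function instead of the indicator of a set: conditioning at
  an intermediate time applies these operators to functions of the state.\<close>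

primrec jump_op :: "nat \<Rightarrow> (es_state \<Rightarrow> ennreal) \<Rightarrow> es_state \<Rightarrow> real \<Rightarrow> ennreal" where
  "jump_op 0 f = (\<lambda>s t. ennreal (surv s t) * f (ES_flow (max 0 t) s))"
| "jump_op (Suc k) f = first_jump (jump_op k f)"

lemma ES_P_eq: "0 \<le> t \<Longrightarrow> ES_P lam h k s t A = jump_op k (indicator A) s t"
proof (induction k arbitrary: s t)
  case (Suc k)
  show ?case unfolding ES_P.simps jump_op.simps first_jump_def jumps_def
    by (intro nn_integral_cong) (auto simp: Suc.IH max_absorb2 split: split_indicator)
qed (simp add: max_absorb2)

lemma ES_trans_eq: "0 \<le> t \<Longrightarrow> ES_trans lam h s t A = (\<Sum>k. jump_op k (indicator A) s t)"
  unfolding ES_trans_def by (simp add: ES_P_eq)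

lemma jumps_mono:
  assumes "s \<in> ES_space" "\<And>y. y \<in> ES_space \<Longrightarrow> \<Phi> y \<le> \<Psi> y"
  shows "jumps \<Phi> s \<le> jumps \<Psi> s"
  unfolding jumps_def
  by (intro add_mono mult_left_mono sum_mono assms(2) ES_ins_space ES_del_space assms(1)) auto

lemma jumps_cong:
  assumes "s \<in> ES_space" "\<And>y. y \<in> ES_space \<Longrightarrow> \<Phi> y = \<Psi> y"
  shows "jumps \<Phi> s = jumps \<Psi> s"
  using assms by (intro antisym jumps_mono) auto

lemma first_jump_mono:
  assumes "s \<in> ES_space" "\<And>y t'. y \<in> ES_space \<Longrightarrow> 0 \<le> t' \<Longrightarrow> t' \<le> t \<Longrightarrow> \<Phi> y t' \<le> \<Psi> y t'"
  shows "first_jump \<Phi> s t \<le> first_jump \<Psi> s t"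
  unfolding first_jump_def
  by (intro nn_integral_mono) (auto split: split_indicator intro!: mult_left_mono jumps_mono assms(2) ES_flow_space assms(1))

lemma first_jump_cong:
  assumes "s \<in> ES_space" "\<And>y t'. y \<in> ES_space \<Longrightarrow> 0 \<le> t' \<Longrightarrow> t' \<le> t \<Longrightarrow> \<Phi> y t' = \<Psi> y t'"
  shows "first_jump \<Phi> s t = first_jump \<Psi> s t"
  using assms by (intro antisym first_jump_mono) auto

lemma jumps_measurable:
  assumes \<Phi> [measurable]: "case_prod \<Phi> \<in> borel_measurable (ES_M \<Otimes>\<^sub>M borel)"
    and f [measurable]: "f \<in> measurable N ES_M" and g [measurable]: "g \<in> borel_measurable N"
  shows "(\<lambda>x. jumps (\<lambda>y. \<Phi> y (g x)) (f x)) \<in> borel_measurable N"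
proof -
  have \<Phi>': "(\<lambda>x. \<Phi> (a x) (g x)) \<in> borel_measurable N" if [measurable]: "a \<in> measurable N ES_M" for a
  proof -
    have "(\<lambda>x. case_prod \<Phi> (a x, g x)) \<in> borel_measurable N" by measurable
    then show ?thesis by simp
  qed
  have [measurable]: "(\<lambda>x. \<Phi> (ES_ins j (f x)) (g x)) \<in> borel_measurable N" for j
    by (rule \<Phi>') measurable
  \<comment> \<open>For an index beyond the number of customers the deletion can leave the state
    space. The clamp prevents this and changes no term of the sum over departures.\<close>
  have [measurable]: "(\<lambda>x. \<Phi> (ES_del (min i (fst (f x))) (f x)) (g x)) \<in> borel_measurable N" for i
    by (rule \<Phi>') measurable
  have [measurable]: "(\<lambda>x. fst (f x)) \<in> measurable N (count_space UNIV)" by measurable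
  have 1: "(\<lambda>x. \<Sum>j\<in>{1..Suc (fst (f x))}. \<Phi> (ES_ins j (f x)) (g x)) \<in> borel_measurable N"
    by (rule measurable_compose_countable[where g="\<lambda>x. fst (f x)"]) measurable
  have 2: "(\<lambda>x. \<Sum>i\<in>{1..fst (f x)}. ennreal (h (snd (f x) i)) * \<Phi> (ES_del (min i (fst (f x))) (f x)) (g x)) \<in> borel_measurable N"
    by (rule measurable_compose_countable[where g="\<lambda>x. fst (f x)"]) measurable
  have 3: "(\<lambda>x. lam (f x)) \<in> borel_measurable N" by measurable
  have eq: "jumps (\<lambda>y. \<Phi> y (g x)) (f x) = ennreal (lam (f x) / real (Suc (fst (f x)))) * (\<Sum>j\<in>{1..Suc (fst (f x))}. \<Phi> (ES_ins j (f x)) (g x))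
     + (\<Sum>i\<in>{1..fst (f x)}. ennreal (h (snd (f x) i)) * \<Phi> (ES_del (min i (fst (f x))) (f x)) (g x))" for x
    unfolding jumps_def by simp
  show ?thesis unfolding eq using 1 2 3 by measurable
qed

lemma first_jump_integrand_measurable:
  assumes \<Phi> [measurable]: "case_prod \<Phi> \<in> borel_measurable (ES_M \<Otimes>\<^sub>M borel)"
    and s: "s \<in> ES_space"
  shows "(\<lambda>u. ennreal (surv s u) * jumps (\<lambda>y. \<Phi> y (t - u)) (ES_flow (max 0 u) s)) \<in> borel_measurable borel"
proof -
  have [measurable]: "(\<lambda>_::real. s) \<in> measurable borel ES_M" using s by simp
  have "(\<lambda>u. jumps (\<lambda>y. \<Phi> y (t - u)) (ES_flow (max 0 u) s)) \<in> borel_measurable borel"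
    by (rule jumps_measurable[OF \<Phi>]) measurable
  moreover have "(\<lambda>u. surv s u) \<in> borel_measurable borel" by measurable
  ultimately show ?thesis by measurable
qed

lemma first_jump_measurable:
  assumes \<Phi> [measurable]: "case_prod \<Phi> \<in> borel_measurable (ES_M \<Otimes>\<^sub>M borel)"
  shows "case_prod (first_jump \<Phi>) \<in> borel_measurable (ES_M \<Otimes>\<^sub>M borel)"
proof -
  let ?N = "(ES_M \<Otimes>\<^sub>M (borel :: real measure)) \<Otimes>\<^sub>M (lborel :: real measure)"
  have [measurable]: "(\<lambda>p. fst (fst p)) \<in> measurable ?N ES_M" "(\<lambda>p. snd (fst p)) \<in> borel_measurable ?N" 
    "(\<lambda>p. snd p) \<in> borel_measurable ?N"
    by measurable
  have 1: "(\<lambda>p. jumps (\<lambda>y. \<Phi> y (snd (fst p) - snd p)) (ES_flow (max 0 (snd p)) (fst (fst p)))) \<in> borel_measurable ?N"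
    by (rule jumps_measurable[OF \<Phi>]) measurable
  have 2: "(\<lambda>p. surv (fst (fst p)) (snd p)) \<in> borel_measurable ?N" by measurable
  have eq: "case_prod (first_jump \<Phi>) p = (\<integral>\<^sup>+u. ennreal (surv (fst p) u) * jumps (\<lambda>y. \<Phi> y (snd p - u)) (ES_flow (max 0 u) (fst p)) 
      * (if 0 \<le> u \<and> u \<le> snd p then 1 else 0) \<partial>lborel)" for p
    unfolding first_jump_def by (auto simp: split_beta intro!: nn_integral_cong split: split_indicator)
  have "(\<lambda>p. ennreal (surv (fst (fst p)) (snd p)) * jumps (\<lambda>y. \<Phi> y (snd (fst p) - snd p)) (ES_flow (max 0 (snd p)) (fst (fst p)))
      * (if 0 \<le> snd p \<and> snd p \<le> snd (fst p) then 1 else 0)) \<in> borel_measurable ?N"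
    using 1 2 by measurable
  then show ?thesis unfolding eq
    by (intro lborel.borel_measurable_nn_integral) (simp add: split_beta')
qed

lemma jump_op_measurable:
  assumes [measurable]: "f \<in> borel_measurable ES_M"
  shows "case_prod (jump_op k f) \<in> borel_measurable (ES_M \<Otimes>\<^sub>M borel)"
proof (induction k)
  case 0
  show ?case by (simp add: split_beta')
qed (simp only: jump_op.simps first_jump_measurable)

lemma jump_op_measurable':
  assumes "f \<in> borel_measurable ES_M"
  shows "(\<lambda>s. jump_op k f s t) \<in> borel_measurable ES_M"
proof -
  have "(\<lambda>s. case_prod (jump_op k f) (s, t)) \<in> borel_measurable ES_M"
    by (rule measurable_compose[OF _ jump_op_measurable[OF assms]]) simp
  then show ?thesis by simp
qed

lemma jumps_suminf: "jumps (\<lambda>y. \<Sum>n. F n y) s = (\<Sum>n. jumps (F n) s)" for F :: "nat \<Rightarrow> es_state \<Rightarrow> ennreal"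
  unfolding jumps_def by (simp add: suminf_sum suminf_add[symmetric])

lemma jumps_add: "jumps (\<lambda>y. F y + F' y) s = jumps F s + jumps F' s"
  unfolding jumps_def by (simp add: sum.distrib distrib_left ac_simps)

lemma jumps_cmult: "jumps (\<lambda>y. c * F y) s = c * jumps F s"
  unfolding jumps_def by (simp add: sum_distrib_left distrib_left ac_simps)

lemma jumps_SUP:
  fixes F :: "nat \<Rightarrow> es_state \<Rightarrow> ennreal"
  assumes "\<And>y. incseq (\<lambda>n. F n y)"
  shows "jumps (\<lambda>y. SUP n. F n y) s = (SUP n. jumps (F n) s)"
proof -
  have m: "i \<le> j \<Longrightarrow> F i y \<le> F j y" for i j y using assms by (auto simp: incseq_def)
  have "ennreal (lam s / real (Suc (fst s))) * (\<Sum>j\<in>{1..Suc (fst s)}. SUP n. F n (ES_ins j s))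
     = (SUP n. ennreal (lam s / real (Suc (fst s))) * (\<Sum>j\<in>{1..Suc (fst s)}. F n (ES_ins j s)))"
    by (subst ennreal_SUP_sum[symmetric]) (auto simp: assms SUP_mult_left_ennreal)
  moreover have "(\<Sum>i\<in>{1..fst s}. ennreal (h (snd s i)) * (SUP n. F n (ES_del i s)))
     = (SUP n. \<Sum>i\<in>{1..fst s}. ennreal (h (snd s i)) * F n (ES_del i s))"
    by (subst ennreal_SUP_sum) (auto simp: assms SUP_mult_left_ennreal incseq_def intro!: mult_left_mono m)
  moreover have "incseq (\<lambda>n. ennreal (lam s / real (Suc (fst s))) * (\<Sum>j\<in>{1..Suc (fst s)}. F n (ES_ins j s)))"
    "incseq (\<lambda>n. \<Sum>i\<in>{1..fst s}. ennreal (h (snd s i)) * F n (ES_del i s))"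
    unfolding incseq_def by (intro allI impI mult_left_mono sum_mono m; simp)+
  ultimately show ?thesis unfolding jumps_def by (simp only: ennreal_SUP_add)
qed

lemma first_jump_suminf:
  assumes "\<And>n. case_prod (F n) \<in> borel_measurable (ES_M \<Otimes>\<^sub>M borel)" and s: "s \<in> ES_space"
  shows "first_jump (\<lambda>s t. \<Sum>n. F n s t) s t = (\<Sum>n. first_jump (F n) s t)"
  unfolding first_jump_def jumps_suminf
  by (subst nn_integral_suminf[symmetric])
    (use first_jump_integrand_measurable[OF assms(1) s] in \<open>auto simp: ennreal_suminf_cmult ennreal_suminf_multc\<close>)

lemma first_jump_add:
  assumes "case_prod F \<in> borel_measurable (ES_M \<Otimes>\<^sub>M borel)" 
    "case_prod F' \<in> borel_measurable (ES_M \<Otimes>\<^sub>M borel)" and s: "s \<in> ES_space"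
  shows "first_jump (\<lambda>s t. F s t + F' s t) s t = first_jump F s t + first_jump F' s t"
  unfolding first_jump_def jumps_add
  by (subst nn_integral_add[symmetric])
    (use first_jump_integrand_measurable[OF assms(1) s] first_jump_integrand_measurable[OF assms(2) s] in \<open>auto simp: distrib_left distrib_right\<close>)

lemma first_jump_zero: "first_jump (\<lambda>s t. 0) s t = 0"
  by (simp add: first_jump_def jumps_def)

lemma first_jump_sum:
  assumes "finite I" "\<And>i. i \<in> I \<Longrightarrow> case_prod (F i) \<in> borel_measurable (ES_M \<Otimes>\<^sub>M borel)" and s: "s \<in> ES_space"
  shows "first_jump (\<lambda>s t. \<Sum>i\<in>I. F i s t) s t = (\<Sum>i\<in>I. first_jump (F i) s t)"
  using assms(1,2)
proof (induction I rule: finite_induct)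
  case (insert i I)
  have "(\<lambda>p. \<Sum>i\<in>I. case_prod (F i) p) \<in> borel_measurable (ES_M \<Otimes>\<^sub>M borel)"
    using insert.prems by (intro borel_measurable_sum) auto
  then have "case_prod (\<lambda>s t. \<Sum>i\<in>I. F i s t) \<in> borel_measurable (ES_M \<Otimes>\<^sub>M borel)"
    by (simp add: split_beta')
  then show ?case using insert by (simp add: first_jump_add[OF _ _ s])
qed (simp add: first_jump_zero)

lemma first_jump_cmult:
  assumes "case_prod F \<in> borel_measurable (ES_M \<Otimes>\<^sub>M borel)" and s: "s \<in> ES_space"
  shows "first_jump (\<lambda>s t. c * F s t) s t = c * first_jump F s t"
  unfolding first_jump_def jumps_cmult
  by (subst nn_integral_cmult[symmetric])
    (use first_jump_integrand_measurable[OF assms(1) s] in \<open>auto simp: ac_simps\<close>)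

lemma first_jump_SUP:
  assumes F: "\<And>n. case_prod (F n) \<in> borel_measurable (ES_M \<Otimes>\<^sub>M borel)" and s: "s \<in> ES_space"
    and inc: "\<And>y t. incseq (\<lambda>n. F n y t)"
  shows "first_jump (\<lambda>s t. SUP n. F n s t) s t = (SUP n. first_jump (F n) s t)"
proof -
  have m: "i \<le> j \<Longrightarrow> F i y t \<le> F j y t" for i j y t using inc by (auto simp: incseq_def)
  have jm: "i \<le> j \<Longrightarrow> jumps (\<lambda>y. F i y t) s \<le> jumps (\<lambda>y. F j y t) s" for i j t s
    unfolding jumps_def by (intro add_mono mult_left_mono sum_mono m) auto
  have "first_jump (\<lambda>s t. SUP n. F n s t) s t = (\<integral>\<^sup>+u. (SUP n. ennreal (surv s u) * jumps (\<lambda>y. F n y (t - u)) (ES_flow (max 0 u) s) * indicator {0..t} u) \<partial>lborel)"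
    unfolding first_jump_def 
    by (intro nn_integral_cong) (simp add: jumps_SUP[OF inc] SUP_mult_left_ennreal SUP_mult_right_ennreal)
  also have "\<dots> = (SUP n. first_jump (F n) s t)"
    unfolding first_jump_def
  proof (rule nn_integral_monotone_convergence_SUP)
    show "incseq (\<lambda>i x. ennreal (surv s x) * jumps (\<lambda>y. F i y (t - x)) (ES_flow (max 0 x) s) * indicator {0..t} x)"
      by (auto simp: incseq_def le_fun_def intro!: mult_right_mono mult_left_mono jm)
  qed (use first_jump_integrand_measurable[OF F s] in auto)
  finally show ?thesis .
qed

lemma jump_op_add:
  assumes f: "f \<in> borel_measurable ES_M" "g \<in> borel_measurable ES_M" and s: "s \<in> ES_space"
  shows "jump_op k (\<lambda>y. f y + g y) s t = jump_op k f s t + jump_op k g s t"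
  using s
proof (induction k arbitrary: s t)
  case (Suc k)
  have "jump_op (Suc k) (\<lambda>y. f y + g y) s t = first_jump (\<lambda>s t. jump_op k f s t + jump_op k g s t) s t"
    unfolding jump_op.simps by (intro first_jump_cong Suc)
  then show ?case using first_jump_add[OF jump_op_measurable[OF f(1)] jump_op_measurable[OF f(2)] Suc.prems] by simp
qed (simp add: distrib_left)

lemma jump_op_cmult:
  assumes f: "f \<in> borel_measurable ES_M" and s: "s \<in> ES_space"
  shows "jump_op k (\<lambda>y. c * f y) s t = c * jump_op k f s t"
  using s
proof (induction k arbitrary: s t)
  case (Suc k)
  have "jump_op (Suc k) (\<lambda>y. c * f y) s t = first_jump (\<lambda>s t. c * jump_op k f s t) s t"
    unfolding jump_op.simps by (intro first_jump_cong Suc)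
  then show ?case using first_jump_cmult[OF jump_op_measurable[OF f(1)] Suc.prems] by simp
qed (simp add: ac_simps)

lemma jump_op_mono:
  assumes s: "s \<in> ES_space" and le: "\<And>y. y \<in> ES_space \<Longrightarrow> f y \<le> g y"
  shows "jump_op k f s t \<le> jump_op k g s t"
  using s
proof (induction k arbitrary: s t)
  case 0
  then show ?case by (auto intro!: mult_left_mono le ES_flow_space)
next
  case (Suc k)
  then show ?case unfolding jump_op.simps by (intro first_jump_mono) auto
qed

lemma jump_op_cong:
  assumes "s \<in> ES_space" "\<And>y. y \<in> ES_space \<Longrightarrow> f y = g y"
  shows "jump_op k f s t = jump_op k g s t"
  using assms by (intro antisym jump_op_mono) auto

lemma jump_op_SUP:
  fixes f :: "nat \<Rightarrow> es_state \<Rightarrow> ennreal"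
  assumes f: "\<And>n. f n \<in> borel_measurable ES_M" and inc: "incseq f" and s: "s \<in> ES_space"
  shows "jump_op k (\<lambda>y. SUP n. f n y) s t = (SUP n. jump_op k (f n) s t)"
proof -
  have m: "i \<le> j \<Longrightarrow> f i y \<le> f j y" for i j y using inc unfolding incseq_def le_fun_def by blast
  \<comment> \<open>Monotonicity in n is known on the state space only, whereas
    \<open>first_jump_SUP\<close> wants it everywhere; the value 0 outside supplies it.\<close>
  define F where "F = (\<lambda>k n s t. if s \<in> ES_space then jump_op k (f n) s t else 0)"
  have F: "case_prod (F k n) \<in> borel_measurable (ES_M \<Otimes>\<^sub>M borel)" for k n
    using jump_op_measurable[OF f, of k n]
    by (rule measurable_cong[THEN iffD1, rotated]) (auto simp: F_def space_pair_measure)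
  have Finc: "incseq (\<lambda>n. F k n y t)" for k y t
    by (auto simp: F_def incseq_def intro!: jump_op_mono m)
  show ?thesis using s
  proof (induction k arbitrary: s t)
    case 0
    then show ?case by (simp add: SUP_mult_left_ennreal)
  next
    case (Suc k)
    have "jump_op (Suc k) (\<lambda>y. SUP n. f n y) s t = first_jump (\<lambda>s t. SUP n. F k n s t) s t"
      unfolding jump_op.simps by (intro first_jump_cong Suc.prems) (simp add: Suc.IH F_def)
    also have "\<dots> = (SUP n. first_jump (F k n) s t)"
      by (rule first_jump_SUP[OF F Suc.prems Finc])
    also have "\<dots> = (SUP n. jump_op (Suc k) (f n) s t)"
      unfolding jump_op.simps by (intro SUP_cong refl first_jump_cong Suc.prems) (simp add: F_def)
    finally show ?case .
  qed
qed

lemma jump_op_zero: "jump_op k (\<lambda>_. 0) s t = 0"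
proof (induction k arbitrary: s t)
  case (Suc k)
  then have "jump_op k (\<lambda>_. 0) = (\<lambda>s t. 0)" by (simp add: fun_eq_iff)
  then show ?case by (simp add: first_jump_zero)
qed simp

lemma jump_op_suminf:
  fixes f :: "nat \<Rightarrow> es_state \<Rightarrow> ennreal"
  assumes f: "\<And>n. f n \<in> borel_measurable ES_M" and s: "s \<in> ES_space"
  shows "jump_op k (\<lambda>y. \<Sum>n. f n y) s t = (\<Sum>n. jump_op k (f n) s t)"
  using s
proof (induction k arbitrary: s t)
  case (Suc k)
  have "jump_op (Suc k) (\<lambda>y. \<Sum>n. f n y) s t = first_jump (\<lambda>s t. \<Sum>n. jump_op k (f n) s t) s t"
    unfolding jump_op.simps by (intro first_jump_cong Suc)
  then show ?case using first_jump_suminf[OF jump_op_measurable[OF f] Suc.prems] by simp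
qed simp

text \<open>The k jumps are split into i before and k - i after time t. If the first jump falls
  before t, the induction hypothesis applies to what follows it; if it falls after t, the survival
  function factorizes and the term i = 0 results.\<close>

lemma jump_op_chapman_kolmogorov:
  assumes f: "f \<in> borel_measurable ES_M" and s: "s \<in> ES_space" and t: "0 \<le> t" and u: "0 \<le> u"
  shows "jump_op k f s (t + u) = (\<Sum>i\<le>k. jump_op i (\<lambda>y. jump_op (k - i) f y u) s t)"
  using s t
proof (induction k arbitrary: s t)
  case 0
  then show ?case using u
    by (simp add: surv_add ES_flow_add max_absorb2 ennreal_mult surv_nonneg ac_simps)
next
  case (Suc k)
  let ?J = "\<lambda>v. ennreal (surv s v) * jumps (\<lambda>y. jump_op k f y (t + u - v)) (ES_flow (max 0 v) s)"
  have Jm: "?J \<in> borel_measurable borel"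
    by (rule first_jump_integrand_measurable[OF jump_op_measurable[OF f] Suc.prems(1)])
  have "jump_op (Suc k) f s (t + u) = (\<integral>\<^sup>+v. ?J v * indicator {0..t} v + ?J v * indicator {t<..t+u} v \<partial>lborel)"
    unfolding jump_op.simps first_jump_def using Suc.prems(2) u
    by (intro nn_integral_cong) (auto split: split_indicator)
  also have "\<dots> = (\<integral>\<^sup>+v\<in>{0..t}. ?J v \<partial>lborel) + (\<integral>\<^sup>+v\<in>{t<..t+u}. ?J v \<partial>lborel)"
    using Jm by (intro nn_integral_add) auto
  also have "(\<integral>\<^sup>+v\<in>{0..t}. ?J v \<partial>lborel) = first_jump (\<lambda>y t'. \<Sum>i\<le>k. jump_op i (\<lambda>y. jump_op (k - i) f y u) y t') s t"
    unfolding first_jump_def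
  proof (intro nn_integral_cong)
    fix v :: real
    have "jumps (\<lambda>y. jump_op k f y (t + u - v)) (ES_flow (max 0 v) s) =
       jumps (\<lambda>y. \<Sum>i\<le>k. jump_op i (\<lambda>y. jump_op (k - i) f y u) y (t - v)) (ES_flow (max 0 v) s)" if "v \<in> {0..t}"
    proof (rule jumps_cong)
      show "ES_flow (max 0 v) s \<in> ES_space" using Suc.prems by (intro ES_flow_space) auto
      show "jump_op k f y (t + u - v) = (\<Sum>i\<le>k. jump_op i (\<lambda>y. jump_op (k - i) f y u) y (t - v))" if "y \<in> ES_space" for y
        using Suc.IH[OF that, of "t - v"] \<open>v \<in> {0..t}\<close> by (simp add: algebra_simps)
    qed
    then show "?J v * indicator {0..t} v = ennreal (surv s v) *
        jumps (\<lambda>y. \<Sum>i\<le>k. jump_op i (\<lambda>y. jump_op (k - i) f y u) y (t - v)) (ES_flow (max 0 v) s) * indicator {0..t} v"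
      by (auto split: split_indicator)
  qed
  also have "\<dots> = (\<Sum>i\<le>k. first_jump (jump_op i (\<lambda>y. jump_op (k - i) f y u)) s t)"
    by (intro first_jump_sum jump_op_measurable jump_op_measurable' f Suc.prems) auto
  also have "\<dots> = (\<Sum>i\<le>k. jump_op (Suc i) (\<lambda>y. jump_op (Suc k - Suc i) f y u) s t)" by simp
  also have "(\<integral>\<^sup>+v\<in>{t<..t+u}. ?J v \<partial>lborel) = jump_op 0 (\<lambda>y. jump_op (Suc k) f y u) s t"
  proof -
    have "(\<integral>\<^sup>+v\<in>{t<..t+u}. ?J v \<partial>lborel) = (\<integral>\<^sup>+v. ?J (t + v) * indicator {t<..t+u} (t + v) \<partial>lborel)"
      using nn_integral_real_affine[of "\<lambda>v. ?J v * indicator {t<..t+u} v" 1 t] Jm by simp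
    also have "\<dots> = (\<integral>\<^sup>+v. ennreal (surv s t) * (ennreal (surv (ES_flow t s) v) *
         jumps (\<lambda>y. jump_op k f y (u - v)) (ES_flow (max 0 v) (ES_flow t s)) * indicator {0..u} v) \<partial>lborel)"
    \<comment> \<open>After the shift by t the interval is half-open, and it differs from {0..u} by
      the null set {0}.\<close>
    proof (intro nn_integral_cong_AE)
      have "AE v in lborel. v \<noteq> (0::real)" by (rule AE_lborel_singleton)
      then show "AE v in lborel. ?J (t + v) * indicator {t<..t+u} (t + v) = ennreal (surv s t) * (ennreal (surv (ES_flow t s) v) *
         jumps (\<lambda>y. jump_op k f y (u - v)) (ES_flow (max 0 v) (ES_flow t s)) * indicator {0..u} v)"
      proof eventually_elim
        case (elim v)
        then show ?case using Suc.prems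
          by (auto split: split_indicator simp: surv_add ennreal_mult surv_nonneg ES_flow_add max_absorb2 ac_simps)
      qed
    qed
    also have "\<dots> = ennreal (surv s t) * (\<integral>\<^sup>+v. ennreal (surv (ES_flow t s) v) *
         jumps (\<lambda>y. jump_op k f y (u - v)) (ES_flow (max 0 v) (ES_flow t s)) * indicator {0..u} v \<partial>lborel)"
      using first_jump_integrand_measurable[OF jump_op_measurable[OF f] ES_flow_space[OF Suc.prems]]
      by (intro nn_integral_cmult) auto
    finally show ?thesis using Suc.prems by (simp add: first_jump_def max_absorb2)
  qed
  finally have "jump_op (Suc k) f s (t + u) = jump_op 0 (\<lambda>y. jump_op (Suc k - 0) f y u) s t
       + (\<Sum>i\<le>k. jump_op (Suc i) (\<lambda>y. jump_op (Suc k - Suc i) f y u) s t)" by (simp only: add.commute diff_zero)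
  then show ?case by (simp only: sum.atMost_Suc_shift)
qed

section \<open>Supersolutions of the first-jump equation and absence of explosion\<close>

lemma surv_by_parts:
  assumes s: "s \<in> ES_space" and t: "0 \<le> t"
    and \<phi>: "\<And>u. u \<in> {0..t} \<Longrightarrow> (\<phi> has_real_derivative \<phi>' u) (at u within {0..t})"
    and \<phi>': "continuous_on {0..t} \<phi>'"
    and nonneg: "\<And>u. u \<in> {0..t} \<Longrightarrow> 0 \<le> rate (ES_flow u s) * \<phi> u - \<phi>' u"
  shows "(\<integral>\<^sup>+u\<in>{0..t}. ennreal (surv s u) * ennreal (rate (ES_flow u s) * \<phi> u - \<phi>' u) \<partial>lborel)
      = ennreal (\<phi> 0 - surv s t * \<phi> t)"
    and "surv s t * \<phi> t \<le> \<phi> 0"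
proof -
  let ?\<rho> = "\<lambda>r. rate (ES_flow (max 0 r) s)"
  let ?N = "\<lambda>u. exp (- integral {0..u} ?\<rho>) * (?\<rho> u * \<phi> u - \<phi>' u)"
  have fs: "ES_flow (max 0 r) s \<in> ES_space" for r using s by (intro ES_flow_space) auto
  note H = hazard_integral_integral[OF s]
  note parts = survival_by_parts[OF t H(1)[OF t] rate_nonneg[OF fs] \<phi> \<phi>']
  have si: "set_integrable lborel {0..t} ?N"
    and eq: "integral {0..t} ?N = \<phi> 0 - exp (- integral {0..t} ?\<rho>) * \<phi> t"
    using parts by simp_all
  have N0: "0 \<le> indicator {0..t} u *\<^sub>R ?N u" for u
    using nonneg[of u] by (auto split: split_indicator simp: max_absorb2)
  have "(\<integral>\<^sup>+u\<in>{0..t}. ennreal (surv s u) * ennreal (rate (ES_flow u s) * \<phi> u - \<phi>' u) \<partial>lborel)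
     = (\<integral>\<^sup>+u. ennreal (indicator {0..t} u *\<^sub>R ?N u) \<partial>lborel)"
    using nonneg by (intro nn_integral_cong) (auto split: split_indicator simp: H(2) ennreal_mult[symmetric] max_absorb2)
  also have "\<dots> = ennreal (LINT u:{0..t}|lborel. ?N u)"
    unfolding set_lebesgue_integral_def using si N0
    by (intro nn_integral_eq_integral) (auto simp: set_integrable_def)
  also have "(LINT u:{0..t}|lborel. ?N u) = \<phi> 0 - surv s t * \<phi> t"
    using set_borel_integral_eq_integral(2)[OF si] eq H(2)[OF t] by simp
  finally show "(\<integral>\<^sup>+u\<in>{0..t}. ennreal (surv s u) * ennreal (rate (ES_flow u s) * \<phi> u - \<phi>' u) \<partial>lborel)
      = ennreal (\<phi> 0 - surv s t * \<phi> t)" .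
  have "0 \<le> (LINT u:{0..t}|lborel. ?N u)"
    unfolding set_lebesgue_integral_def using N0 by (intro integral_nonneg_AE) auto
  then show "surv s t * \<phi> t \<le> \<phi> 0"
    using set_borel_integral_eq_integral(2)[OF si] eq H(2)[OF t] by simp
qed

text \<open>Let \<phi> u be the value of a function along the flow at time u. Then \<open>le\<close>
  says that flow derivative plus jump gain minus rate times value is nonpositive, an inequality for
  the generator. Integration by parts turns it into one for the first jump.\<close>

lemma first_jump_supersolution:
  assumes s: "s \<in> ES_space" and t: "0 \<le> t"
    and \<phi>: "\<And>u. u \<in> {0..t} \<Longrightarrow> (\<phi> has_real_derivative \<phi>' u) (at u within {0..t})"
    and \<phi>': "continuous_on {0..t} \<phi>'" and pos: "0 \<le> \<phi> t"
    and nonneg: "\<And>u. u \<in> {0..t} \<Longrightarrow> 0 \<le> rate (ES_flow u s) * \<phi> u - \<phi>' u"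
    and le: "\<And>u. u \<in> {0..t} \<Longrightarrow> jumps (\<lambda>y. \<Phi> y (t - u)) (ES_flow u s) \<le> ennreal (rate (ES_flow u s) * \<phi> u - \<phi>' u)"
  shows "ennreal (surv s t) * ennreal (\<phi> t) + first_jump \<Phi> s t \<le> ennreal (\<phi> 0)"
proof -
  have "first_jump \<Phi> s t \<le> (\<integral>\<^sup>+u\<in>{0..t}. ennreal (surv s u) * ennreal (rate (ES_flow u s) * \<phi> u - \<phi>' u) \<partial>lborel)"
    unfolding first_jump_def using le
    by (intro nn_integral_mono) (auto split: split_indicator intro!: mult_left_mono simp: max_absorb2)
  also have "\<dots> = ennreal (\<phi> 0 - surv s t * \<phi> t)"
    by (rule surv_by_parts[OF s t \<phi> \<phi>' nonneg])
  finally have "ennreal (surv s t * \<phi> t) + first_jump \<Phi> s t \<le> ennreal (surv s t * \<phi> t) + ennreal (\<phi> 0 - surv s t * \<phi> t)"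
    by (rule add_left_mono)
  also have "\<dots> = ennreal (\<phi> 0)"
    using surv_by_parts(2)[OF s t \<phi> \<phi>' nonneg] pos surv_nonneg by (subst ennreal_plus[symmetric]) auto
  finally show ?thesis by (simp add: ennreal_mult' surv_nonneg)
qed

lemma jumps_eq_real:
  assumes s: "s \<in> ES_space" and A: "0 \<le> A" "\<And>j. j \<in> {1..Suc (fst s)} \<Longrightarrow> \<Phi> (ES_ins j s) = ennreal A"
    and b: "\<And>i. i \<in> {1..fst s} \<Longrightarrow> 0 \<le> b i" "\<And>i. i \<in> {1..fst s} \<Longrightarrow> \<Phi> (ES_del i s) = ennreal (b i)"
  shows "jumps \<Phi> s = ennreal (lam s * A + (\<Sum>i\<in>{1..fst s}. h (snd s i) * b i))"
proof -
  have h0: "0 \<le> h (snd s i)" for i using s by (intro h_nonneg ES_space_nonneg)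
  have "(\<Sum>j\<in>{1..Suc (fst s)}. \<Phi> (ES_ins j s)) = (\<Sum>j\<in>{1..Suc (fst s)}. ennreal A)"
    by (intro sum.cong refl A(2))
  also have "\<dots> = ennreal (real (Suc (fst s)) * A)"
    using A(1) by (simp add: ennreal_mult ennreal_of_nat_eq_real_of_nat)
  finally have "ennreal (lam s / real (Suc (fst s))) * (\<Sum>j\<in>{1..Suc (fst s)}. \<Phi> (ES_ins j s)) = ennreal (lam s * A)"
    using A(1) lam_nonneg[OF s] by (simp add: ennreal_mult[symmetric])
  moreover have "(\<Sum>i\<in>{1..fst s}. ennreal (h (snd s i)) * \<Phi> (ES_del i s)) = (\<Sum>i\<in>{1..fst s}. ennreal (h (snd s i) * b i))"
    by (intro sum.cong refl) (simp add: b ennreal_mult h0)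
  moreover have "\<dots> = ennreal (\<Sum>i\<in>{1..fst s}. h (snd s i) * b i)"
    using b(1) h0 by (intro sum_ennreal) auto
  moreover have "0 \<le> lam s * A" using A(1) lam_nonneg[OF s] by simp
  moreover have "0 \<le> (\<Sum>i\<in>{1..fst s}. h (snd s i) * b i)"
    using b(1) h0 by (intro sum_nonneg mult_nonneg_nonneg) auto
  ultimately show ?thesis unfolding jumps_def by (simp only: ennreal_plus)
qed

lemma jumps_one: "s \<in> ES_space \<Longrightarrow> jumps (\<lambda>_. 1) s = ennreal (rate s)"
  using jumps_eq_real[of s 1 "\<lambda>_. 1" "\<lambda>_. 1"] by (simp add: ES_rate_def)

lemma surv_first_jump_one:
  assumes s: "s \<in> ES_space" and t: "0 \<le> t"
  shows "ennreal (surv s t) + first_jump (\<lambda>_ _. 1) s t = 1"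
proof -
  have r: "0 \<le> rate (ES_flow u s)" if "u \<in> {0..t}" for u
    using s that by (intro rate_nonneg ES_flow_space) auto
  have "first_jump (\<lambda>_ _. 1) s t = (\<integral>\<^sup>+u\<in>{0..t}. ennreal (surv s u) * ennreal (rate (ES_flow u s) * 1 - 0) \<partial>lborel)"
    unfolding first_jump_def using s
    by (intro nn_integral_cong) (auto split: split_indicator simp: jumps_one ES_flow_space max_absorb2)
  also have "\<dots> = ennreal (1 - surv s t * 1)"
    by (rule surv_by_parts(1)[OF s t]) (use r in auto)
  finally show ?thesis using surv_le_1 surv_nonneg by (simp add: ennreal_plus[symmetric] del: ennreal_plus)
qed

lemma sum_jump_op_Suc:
  assumes f: "f \<in> borel_measurable ES_M" and s: "s \<in> ES_space"
  shows "(\<Sum>k<Suc K. jump_op k f s t) = jump_op 0 f s t + first_jump (\<lambda>s t. \<Sum>k<K. jump_op k f s t) s t"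
  unfolding sum.lessThan_Suc_shift
  by (subst first_jump_sum[OF _ jump_op_measurable[OF f] s]) auto

text \<open>The partial sums over the number of jumps are the iterates of the first-jump equation
  started at 0. By monotonicity a supersolution stays above each iterate, hence above their
  supremum.\<close>

lemma jump_op_suminf_le:
  assumes f: "f \<in> borel_measurable ES_M" and s: "s \<in> ES_space" and t: "0 \<le> t" "t \<le> T"
    and \<Phi>: "\<And>y t. y \<in> ES_space \<Longrightarrow> 0 \<le> t \<Longrightarrow> t \<le> T \<Longrightarrow>
      ennreal (surv y t) * f (ES_flow t y) + first_jump \<Phi> y t \<le> \<Phi> y t"
  shows "(\<Sum>k. jump_op k f s t) \<le> \<Phi> s t"
proof -
  have "(\<Sum>k<K. jump_op k f s t) \<le> \<Phi> s t" for K
    using s t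
  proof (induction K arbitrary: s t)
    case (Suc K)
    have "first_jump (\<lambda>s t. \<Sum>k<K. jump_op k f s t) s t \<le> first_jump \<Phi> s t"
      using Suc by (intro first_jump_mono) auto
    then have "(\<Sum>k<Suc K. jump_op k f s t) \<le> jump_op 0 f s t + first_jump \<Phi> s t"
      unfolding sum_jump_op_Suc[OF f Suc.prems(1)] by (rule add_left_mono)
    also have "\<dots> \<le> \<Phi> s t" using \<Phi>[OF Suc.prems] Suc.prems by (simp add: max_absorb2)
    finally show ?case .
  qed simp
  then show ?thesis unfolding suminf_eq_SUP by (intro SUP_least)
qed

text \<open>\<open>late k s t\<close> is the probability of at least \<open>k\<close> jumps in \<open>[0, t]\<close>. Explosion is excluded because the sum
  over \<open>k \<ge> 1\<close>, the mean number of jumps, is finite.\<close>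

primrec late :: "nat \<Rightarrow> es_state \<Rightarrow> real \<Rightarrow> ennreal" where
  "late 0 = (\<lambda>_ _. 1)"
| "late (Suc k) = first_jump (late k)"

lemma late_measurable: "case_prod (late k) \<in> borel_measurable (ES_M \<Otimes>\<^sub>M borel)"
  by (induction k) (simp_all only: late.simps first_jump_measurable, simp)

lemma late_decreasing: "s \<in> ES_space \<Longrightarrow> 0 \<le> t \<Longrightarrow> late (Suc k) s t \<le> late k s t"
proof (induction k arbitrary: s t)
  case 0
  have "first_jump (\<lambda>_ _. 1) s t \<le> ennreal (surv s t) + first_jump (\<lambda>_ _. 1) s t"
    by (rule add_increasing) auto
  then show ?case using surv_first_jump_one[OF 0] by simp
next
  case (Suc k)
  have "first_jump (late (Suc k)) s t \<le> first_jump (late k) s t"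
    by (intro first_jump_mono Suc.prems Suc.IH)
  then show ?case by (simp only: late.simps(2))
qed

lemma jump_op_late: "s \<in> ES_space \<Longrightarrow> 0 \<le> t \<Longrightarrow> (\<Sum>k<K. jump_op k (\<lambda>_. 1) s t) + late K s t = 1"
proof (induction K arbitrary: s t)
  case (Suc K)
  let ?S = "\<lambda>s t. \<Sum>k<K. jump_op k (\<lambda>_. 1) s t"
  have "(\<lambda>p. \<Sum>k<K. case_prod (jump_op k (\<lambda>_. 1)) p) \<in> borel_measurable (ES_M \<Otimes>\<^sub>M borel)"
    by (intro borel_measurable_sum jump_op_measurable) auto
  then have m: "case_prod ?S \<in> borel_measurable (ES_M \<Otimes>\<^sub>M borel)" by (simp add: split_beta')
  have "(\<Sum>k<Suc K. jump_op k (\<lambda>_. 1) s t) + late (Suc K) s t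
      = jump_op 0 (\<lambda>_. 1) s t + (first_jump ?S s t + first_jump (late K) s t)"
    using Suc.prems by (subst sum_jump_op_Suc) (auto simp: add.assoc)
  also have "first_jump ?S s t + first_jump (late K) s t = first_jump (\<lambda>s t. ?S s t + late K s t) s t"
    by (rule first_jump_add[OF m late_measurable Suc.prems(1), symmetric])
  also have "\<dots> = first_jump (\<lambda>_ _. 1) s t" using Suc by (intro first_jump_cong) auto
  finally show ?case using surv_first_jump_one[OF Suc.prems] by simp
qed simp

text \<open>Heuristic for B: the number of customers plus 1 grows no faster than a pure birth
  process with rate \<open>Lam\<close> per head, so at most (n + 1) (exp (Lam v) - 1) arrivals are
  expected up to time v. Departures are at most n plus the arrivals, and n plus twice the arrivals
  is then at most B n v.\<close>

lemma mean_jumps_supersolution: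
  assumes s: "s \<in> ES_space" and t: "0 \<le> t"
  defines "B \<equiv> \<lambda>n v. (real n + 1) * (2 * exp (Lam * v) - 1)"
  shows "first_jump (\<lambda>y v. 1 + ennreal (B (fst y) v)) s t \<le> ennreal (B (fst s) t)"
proof -
  let ?n = "fst s"
  let ?\<phi> = "\<lambda>u. B ?n (t - u)"
  let ?\<phi>' = "\<lambda>u. - ((real ?n + 1) * (2 * (Lam * exp (Lam * (t - u)))))"
  have B0: "0 \<le> B n v" if "0 \<le> v" for n v
  proof -
    have "0 \<le> exp (Lam * v) + (exp (Lam * v) - 1)" using Lam_nonneg that by (intro add_nonneg_nonneg) auto
    then have "0 \<le> 2 * exp (Lam * v) - 1" by (simp only: mult_2 add_diff_eq)
    then show ?thesis unfolding B_def by (rule mult_nonneg_nonneg[rotated]) simp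
  qed
  have key: "jumps (\<lambda>y. 1 + ennreal (B (fst y) (t - u))) (ES_flow u s) \<le> ennreal (rate (ES_flow u s) * ?\<phi> u - ?\<phi>' u)"
    "0 \<le> rate (ES_flow u s) * ?\<phi> u - ?\<phi>' u"
    if u: "u \<in> {0..t}" for u
  proof -
    let ?s = "ES_flow u s"
    have fs: "?s \<in> ES_space" using s u by (intro ES_flow_space) auto
    define v where "v = t - u"
    have v: "0 \<le> v" using u by (simp add: v_def)
    define a where "a = 2 * exp (Lam * v) - 1"
    have a: "1 \<le> a" using Lam_nonneg v by (simp add: a_def)
    define H where "H = (\<Sum>i\<in>{1..?n}. h (snd ?s i))"
    have H: "0 \<le> H" unfolding H_def using fs by (intro sum_nonneg h_nonneg ES_space_nonneg)
    have r: "rate ?s = lam ?s + H" by (simp add: ES_rate_def H_def)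
    have nn: "0 \<le> rate ?s * ?\<phi> u" using rate_nonneg[OF fs] B0 v by (simp add: v_def)
    have nn': "0 \<le> - ?\<phi>' u" using Lam_nonneg by simp
    show "0 \<le> rate (ES_flow u s) * ?\<phi> u - ?\<phi>' u" using nn nn' by simp
    have "jumps (\<lambda>y. 1 + ennreal (B (fst y) v)) ?s = ennreal (lam ?s * (1 + B (?n + 1) v) + (\<Sum>i\<in>{1..fst ?s}. h (snd ?s i) * (1 + B (?n - 1) v)))"
      using B0[OF v] by (intro jumps_eq_real fs) (auto simp: ES_ins_def ES_del_def)
    also have "(\<Sum>i\<in>{1..fst ?s}. h (snd ?s i) * (1 + B (?n - 1) v)) = H * (1 + real ?n * a)"
      by (cases "?n = 0") (auto simp: H_def sum_distrib_right B_def a_def of_nat_diff)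
    also have "lam ?s * (1 + B (?n + 1) v) + H * (1 + real ?n * a) \<le> rate ?s * ?\<phi> u - ?\<phi>' u"
    proof -
      have l: "lam ?s \<le> Lam * (real ?n + 1)"
      proof -
        have "Lam * real (max 1 ?n) \<le> Lam * (real ?n + 1)" using Lam_nonneg by (intro mult_left_mono) auto
        then show ?thesis using lam_le[OF fs] by simp
      qed
      have "lam ?s * (1 + a) \<le> Lam * (real ?n + 1) * (1 + a)" using a by (intro mult_right_mono l) auto
      moreover have "H * 1 \<le> H * a" using H a by (intro mult_left_mono) auto
      moreover have "?\<phi> u = (real ?n + 1) * a" "- ?\<phi>' u = Lam * (real ?n + 1) * (1 + a)" "B (?n + 1) v = (real ?n + 2) * a"
        by (simp_all add: B_def a_def v_def algebra_simps)
      ultimately show ?thesis unfolding r by (simp add: algebra_simps)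
    qed
    finally show "jumps (\<lambda>y. 1 + ennreal (B (fst y) (t - u))) ?s \<le> ennreal (rate ?s * ?\<phi> u - ?\<phi>' u)"
      by (simp add: v_def ennreal_leI)
  qed
  have "ennreal (surv s t) * ennreal (?\<phi> t) + first_jump (\<lambda>y v. 1 + ennreal (B (fst y) v)) s t \<le> ennreal (?\<phi> 0)"
  proof (rule first_jump_supersolution[OF s t, where \<phi>'="?\<phi>'"])
    show "(?\<phi> has_real_derivative ?\<phi>' u) (at u within {0..t})" for u
      unfolding B_def by (auto intro!: derivative_eq_intros)
    show "continuous_on {0..t} ?\<phi>'" by (intro continuous_intros)
    show "0 \<le> ?\<phi> t" by (simp add: B0)
  qed (use key in auto)
  moreover have "first_jump (\<lambda>y v. 1 + ennreal (B (fst y) v)) s t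
      \<le> ennreal (surv s t) * ennreal (?\<phi> t) + first_jump (\<lambda>y v. 1 + ennreal (B (fst y) v)) s t"
    by (rule add_increasing) auto
  ultimately have "first_jump (\<lambda>y v. 1 + ennreal (B (fst y) v)) s t \<le> ennreal (?\<phi> 0)"
    by (rule order_trans[rotated])
  then show ?thesis by simp
qed

lemma sum_late_le:
  "s \<in> ES_space \<Longrightarrow> 0 \<le> t \<Longrightarrow> (\<Sum>k<K. late (Suc k) s t) \<le> ennreal ((real (fst s) + 1) * (2 * exp (Lam * t) - 1))"
proof (induction K arbitrary: s t)
  case (Suc K)
  have "(\<Sum>k<Suc K. late (Suc k) s t) = first_jump (\<lambda>s t. \<Sum>k<Suc K. late k s t) s t"
    by (subst first_jump_sum[OF _ late_measurable Suc.prems(1)]) auto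
  also have "\<dots> = first_jump (\<lambda>s t. 1 + (\<Sum>k<K. late (Suc k) s t)) s t"
    unfolding sum.lessThan_Suc_shift by simp
  also have "\<dots> \<le> first_jump (\<lambda>y v. 1 + ennreal ((real (fst y) + 1) * (2 * exp (Lam * v) - 1))) s t"
    by (intro first_jump_mono Suc.prems add_left_mono Suc.IH)
  also have "\<dots> \<le> ennreal ((real (fst s) + 1) * (2 * exp (Lam * t) - 1))"
    by (rule mean_jumps_supersolution[OF Suc.prems])
  finally show ?case .
qed simp

text \<open>\<open>late K\<close> decreases in K while its sum is at most B, so K
  \<open>late K\<close> <= B and \<open>late K\<close> tends to 0: no mass is lost to infinitely
  many jumps.\<close>

lemma jump_op_mass:
  assumes s: "s \<in> ES_space" and t: "0 \<le> t"
  shows "(\<Sum>k. jump_op k (\<lambda>_. 1) s t) = 1"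
proof (rule antisym)
  show "(\<Sum>k. jump_op k (\<lambda>_. 1) s t) \<le> 1"
    unfolding suminf_eq_SUP
  proof (rule SUP_least)
    show "(\<Sum>k<K. jump_op k (\<lambda>_. 1) s t) \<le> 1" for K
      using jump_op_late[OF s t, of K] by (metis le_iff_add)
  qed
  define B where "B = (real (fst s) + 1) * (2 * exp (Lam * t) - 1)"
  have "0 \<le> exp (Lam * t) + (exp (Lam * t) - 1)" using Lam_nonneg t by (intro add_nonneg_nonneg) auto
  then have "0 \<le> 2 * exp (Lam * t) - 1" by (simp only: mult_2 add_diff_eq)
  then have B: "0 \<le> B" unfolding B_def by (rule mult_nonneg_nonneg[rotated]) simp
  show "1 \<le> (\<Sum>k. jump_op k (\<lambda>_. 1) s t)"
  proof (rule ennreal_le_epsilon)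
    fix \<epsilon> :: real assume \<epsilon>: "0 < \<epsilon>"
    obtain K :: nat where K: "B / \<epsilon> < real K" using reals_Archimedean2 by blast
    moreover have "0 \<le> B / \<epsilon>" using B \<epsilon> by simp
    ultimately have K0: "0 < real K" by linarith
    have dec: "decseq (\<lambda>k. late k s t)" by (rule decseq_SucI) (rule late_decreasing[OF s t])
    have "of_nat K * late K s t = (\<Sum>k<K. late K s t)" by simp
    also have "\<dots> \<le> (\<Sum>k<K. late (Suc k) s t)" by (intro sum_mono decseqD[OF dec]) auto
    also have "\<dots> \<le> ennreal B" unfolding B_def by (rule sum_late_le[OF s t])
    finally have "ennreal (real K) * late K s t \<le> ennreal B" by (simp add: ennreal_of_nat_eq_real_of_nat)
    then have "ennreal (1 / real K) * (ennreal (real K) * late K s t) \<le> ennreal (1 / real K) * ennreal B"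
      by (rule mult_left_mono) simp
    then have "late K s t \<le> ennreal (1 / real K) * ennreal B"
      using K0 by (simp add: mult.assoc[symmetric] ennreal_mult[symmetric])
    also have "\<dots> \<le> ennreal \<epsilon>" using K K0 B \<epsilon> by (simp add: ennreal_mult[symmetric] field_simps ennreal_leI)
    finally have l: "late K s t \<le> ennreal \<epsilon>" .
    have "1 = (\<Sum>k<K. jump_op k (\<lambda>_. 1) s t) + late K s t" by (rule jump_op_late[OF s t, symmetric])
    also have "\<dots> \<le> (\<Sum>k. jump_op k (\<lambda>_. 1) s t) + ennreal \<epsilon>"
      by (intro add_mono l sum_le_suminf) auto
    finally show "1 \<le> (\<Sum>k. jump_op k (\<lambda>_. 1) s t) + ennreal \<epsilon>" .
  qed
qed

section \<open>The transition laws form a Markov semigroup\<close>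

lemma sets_ES_law [simp]: "sets (ES_law lam h s t) = sets ES_M"
  unfolding ES_law_def using sets.space_closed[of ES_M] sets.sigma_sets_eq[of ES_M] by simp

lemma space_ES_law [simp]: "space (ES_law lam h s t) = ES_space"
  using sets_eq_imp_space_eq[OF sets_ES_law] by simp

text \<open>\<open>measure_of\<close> returns the zero measure unless the set function is positive
  and countably additive, so \<open>ES_law\<close> carries the values of \<open>ES_trans\<close>
  only after this check.\<close>

lemma emeasure_ES_law:
  assumes s: "s \<in> ES_space" and t: "0 \<le> t" and A: "A \<in> sets ES_M"
  shows "emeasure (ES_law lam h s t) A = ES_trans lam h s t A"
proof -
  have "countably_additive (sets ES_M) (ES_trans lam h s t)"
    unfolding countably_additive_def
  proof (intro allI impI)
    fix A :: "nat \<Rightarrow> es_state set"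
    assume A: "range A \<subseteq> sets ES_M" "disjoint_family A" "\<Union> (range A) \<in> sets ES_M"
    have ind: "indicator (\<Union> (range A)) = (\<lambda>y. \<Sum>i. indicator (A i) y :: ennreal)"
      using suminf_indicator[OF A(2)] by simp
    have "(\<Sum>i. ES_trans lam h s t (A i)) = (\<Sum>k. \<Sum>i. jump_op k (indicator (A i)) s t)"
      unfolding ES_trans_eq[OF t] by (rule suminf_ennreal_swap)
    also have "\<dots> = (\<Sum>k. jump_op k (\<lambda>y. \<Sum>i. indicator (A i) y) s t)"
      using A(1) by (subst jump_op_suminf[OF _ s]) auto
    also have "\<dots> = ES_trans lam h s t (\<Union> (range A))" unfolding ES_trans_eq[OF t] ind ..
    finally show "(\<Sum>i. ES_trans lam h s t (A i)) = ES_trans lam h s t (\<Union> (range A))" .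
  qed
  moreover have "positive (sets ES_M) (ES_trans lam h s t)"
  proof -
    have "(indicator {} :: es_state \<Rightarrow> ennreal) = (\<lambda>_. 0)" by (simp add: fun_eq_iff)
    then show ?thesis unfolding positive_def ES_trans_eq[OF t] by (simp add: jump_op_zero)
  qed
  ultimately show ?thesis
    unfolding ES_law_def using emeasure_measure_of_sigma[OF sets.sigma_algebra_axioms[of ES_M] _ _ A] by simp
qed

lemma nn_integral_ES_law:
  assumes s: "s \<in> ES_space" and t: "0 \<le> t" and f: "f \<in> borel_measurable ES_M"
  shows "(\<integral>\<^sup>+y. f y \<partial>ES_law lam h s t) = (\<Sum>k. jump_op k f s t)"
proof -
  have f': "f \<in> borel_measurable (ES_law lam h s t)" using f by (simp only: measurable_cong_sets[OF sets_ES_law refl])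
  note mc = measurable_cong_sets[OF sets_ES_law refl]
  show ?thesis using f'
  proof (induction rule: borel_measurable_induct)
    case (cong f g)
    have "(\<integral>\<^sup>+y. f y \<partial>ES_law lam h s t) = (\<integral>\<^sup>+y. g y \<partial>ES_law lam h s t)"
      by (intro nn_integral_cong cong) auto
    moreover have "jump_op k f s t = jump_op k g s t" for k by (intro jump_op_cong s cong) auto
    ultimately show ?case using cong by simp
  next
    case (set A)
    then show ?case using emeasure_ES_law[OF s t, of A] by (simp add: ES_trans_eq[OF t])
  next
    case (mult u c)
    then have "u \<in> borel_measurable ES_M" by (simp only: mc)
    then show ?case using mult by (simp add: nn_integral_cmult jump_op_cmult s)
  next
    case (add u v)
    then have "u \<in> borel_measurable ES_M" "v \<in> borel_measurable ES_M" by (simp_all only: mc)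
    then show ?case using add by (simp add: nn_integral_add jump_op_add s suminf_add)
  next
    case (seq U)
    then have U: "U i \<in> borel_measurable ES_M" for i by (simp only: mc)
    have sup: "(SUP i. U i) = (\<lambda>y. SUP i. U i y)" by (simp add: fun_eq_iff image_comp)
    have "(\<integral>\<^sup>+y. (SUP i. U i) y \<partial>ES_law lam h s t) = (SUP i. \<integral>\<^sup>+y. U i y \<partial>ES_law lam h s t)"
      unfolding sup using seq(1,3) by (intro nn_integral_monotone_convergence_SUP)
    also have "\<dots> = (SUP i. \<integral>\<^sup>+k. jump_op k (U i) s t \<partial>count_space UNIV)"
      using seq by (simp add: nn_integral_count_space_nat)
    also have "\<dots> = (\<integral>\<^sup>+k. (SUP i. jump_op k (U i) s t) \<partial>count_space UNIV)"
    proof (rule nn_integral_monotone_convergence_SUP[symmetric])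
      have "i \<le> j \<Longrightarrow> U i y \<le> U j y" for i j y using seq(3) unfolding incseq_def le_fun_def by blast
      then show "incseq (\<lambda>i k. jump_op k (U i) s t)" unfolding incseq_def le_fun_def by (intro allI impI jump_op_mono s) auto
    qed simp
    also have "\<dots> = (\<Sum>k. jump_op k (SUP i. U i) s t)"
      unfolding sup jump_op_SUP[OF U seq(3) s] by (rule nn_integral_count_space_nat)
    finally show ?case .
  qed
qed

sublocale markov_semigroup ES_M "\<lambda>t s. ES_law lam h s t"
proof (rule markov_semigroup.intro)
  fix s t assume "s \<in> space ES_M" and t: "0 \<le> (t::real)"
  then have s: "s \<in> ES_space" by simp
  show "sets (ES_law lam h s t) = sets ES_M" by simp
  show "prob_space (ES_law lam h s t)"
  proof (rule prob_spaceI)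
    have "emeasure (ES_law lam h s t) (space (ES_law lam h s t)) = (\<integral>\<^sup>+y. 1 \<partial>ES_law lam h s t)" by simp
    also have "\<dots> = 1" using nn_integral_ES_law[OF s t, of "\<lambda>_. 1"] jump_op_mass[OF s t] by simp
    finally show "emeasure (ES_law lam h s t) (space (ES_law lam h s t)) = 1" .
  qed
next
  fix t A assume t: "0 \<le> (t::real)" and A: "A \<in> sets ES_M"
  have "(\<lambda>s. \<Sum>k. jump_op k (indicator A) s t) \<in> borel_measurable ES_M"
    using A by (intro borel_measurable_suminf_order jump_op_measurable') auto
  then show "(\<lambda>s. emeasure (ES_law lam h s t) A) \<in> borel_measurable ES_M"
    by (rule measurable_cong[THEN iffD1, rotated]) (use t A in \<open>simp add: emeasure_ES_law ES_trans_eq\<close>)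
next
  fix s t u A assume "s \<in> space ES_M" and t: "0 \<le> (t::real)" and u: "0 \<le> (u::real)" and A: "A \<in> sets ES_M"
  then have s: "s \<in> ES_space" by simp
  have fA: "(indicator A :: es_state \<Rightarrow> ennreal) \<in> borel_measurable ES_M" using A by auto
  have gm: "(\<lambda>y. \<Sum>j. jump_op j (indicator A) y u) \<in> borel_measurable ES_M"
    by (intro borel_measurable_suminf_order jump_op_measurable' fA)
  have "emeasure (ES_law lam h s (t + u)) A = (\<Sum>k. jump_op k (indicator A) s (t + u))"
    using t u s A by (simp add: emeasure_ES_law ES_trans_eq)
  also have "\<dots> = (\<Sum>k. \<Sum>i\<le>k. jump_op i (\<lambda>y. jump_op (k - i) (indicator A) y u) s t)"
    by (simp only: jump_op_chapman_kolmogorov[OF fA s t u])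
  also have "\<dots> = (\<Sum>i. \<Sum>j. jump_op i (\<lambda>y. jump_op j (indicator A) y u) s t)"
    by (rule suminf_ennreal_triangle)
  also have "\<dots> = (\<Sum>i. jump_op i (\<lambda>y. \<Sum>j. jump_op j (indicator A) y u) s t)"
    by (simp add: jump_op_suminf[OF jump_op_measurable'[OF fA] s])
  also have "\<dots> = (\<integral>\<^sup>+y. (\<Sum>j. jump_op j (indicator A) y u) \<partial>ES_law lam h s t)"
    by (rule nn_integral_ES_law[OF s t gm, symmetric])
  also have "\<dots> = (\<integral>\<^sup>+y. emeasure (ES_law lam h y u) A \<partial>ES_law lam h s t)"
    using u A by (intro nn_integral_cong) (simp add: emeasure_ES_law ES_trans_eq)
  finally show "emeasure (ES_law lam h s (t + u)) A = (\<integral>\<^sup>+y. emeasure (ES_law lam h y u) A \<partial>ES_law lam h s t)" .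
qed

end

section \<open>Drift and minorization for the service process\<close>

text \<open>The slot given to the newcomer is irrelevant for symmetric functions of the ages:
  removing slot j and closing the gap restores the old numbering.\<close>

lemma sum_ES_ins:
  fixes w :: "real \<Rightarrow> real"
  assumes j: "j \<in> {1..Suc (fst s)}"
  shows "(\<Sum>k\<in>{1..fst (ES_ins j s)}. w (snd (ES_ins j s) k)) = w 0 + (\<Sum>k\<in>{1..fst s}. w (snd s k))"
proof -
  have "(\<Sum>k\<in>{1..fst (ES_ins j s)}. w (snd (ES_ins j s) k))
      = w (snd (ES_ins j s) j) + (\<Sum>k\<in>{1..Suc (fst s)} - {j}. w (snd (ES_ins j s) k))"
  proof -
    have "fst (ES_ins j s) = Suc (fst s)" by (simp add: ES_ins_def)
    then show ?thesis using j by (simp only:) (rule sum.remove; simp)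
  qed
  also have "snd (ES_ins j s) j = 0" using j by (simp add: ES_ins_def)
  also have "(\<Sum>k\<in>{1..Suc (fst s)} - {j}. w (snd (ES_ins j s) k)) = (\<Sum>k\<in>{1..fst s}. w (snd s k))"
    by (rule sum.reindex_bij_witness[of _ "\<lambda>k. if k < j then k else Suc k" "\<lambda>k. if k < j then k else k - 1"])
      (use j in \<open>auto simp: ES_ins_def split: if_splits\<close>)
  finally show ?thesis .
qed

lemma sum_ES_del:
  fixes w :: "real \<Rightarrow> real"
  assumes i: "i \<in> {1..fst s}"
  shows "(\<Sum>k\<in>{1..fst (ES_del i s)}. w (snd (ES_del i s) k)) = (\<Sum>k\<in>{1..fst s}. w (snd s k)) - w (snd s i)"
proof -
  have "(\<Sum>k\<in>{1..fst s}. w (snd s k)) = w (snd s i) + (\<Sum>k\<in>{1..fst s} - {i}. w (snd s k))"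
    by (rule sum.remove) (use i in auto)
  also have "(\<Sum>k\<in>{1..fst s} - {i}. w (snd s k)) = (\<Sum>k\<in>{1..fst (ES_del i s)}. w (snd (ES_del i s) k))"
    by (rule sum.reindex_bij_witness[of _ "\<lambda>k. if k < i then k else Suc k" "\<lambda>k. if k < i then k else k - 1"])
      (use i in \<open>auto simp: ES_del_def split: if_splits\<close>)
  finally show ?thesis by simp
qed

text \<open>The Lyapunov function is \<open>ES_L\<close> with every age shifted by \<open>\<theta>\<close>. Letting the shift grow with time
  yields a drift condition directly, without solving a differential inequality.\<close>

definition age_sum :: "real \<Rightarrow> real \<Rightarrow> es_state \<Rightarrow> real" where
  "age_sum m \<theta> s = (\<Sum>j\<in>{1..fst s}. (1 + \<theta> + snd s j) powr m)"

lemma ES_L_eq: "ES_L m p s = age_sum m 0 s powr p"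
  by (simp add: ES_L_def age_sum_def)

lemma age_sum_nonneg: "0 \<le> age_sum m \<theta> s"
  unfolding age_sum_def by (intro sum_nonneg) simp

lemma age_sum_measurable [measurable]: "age_sum m \<theta> \<in> borel_measurable ES_M"
  unfolding age_sum_def by (rule measurable_compose_countable[OF _ measurable_ES_fst]) measurable

lemma age_sum_ins:
  "j \<in> {1..Suc (fst s)} \<Longrightarrow> age_sum m \<theta> (ES_ins j s) = age_sum m \<theta> s + (1 + \<theta>) powr m"
  unfolding age_sum_def using sum_ES_ins[of j s "\<lambda>x. (1 + \<theta> + x) powr m"] by simp

lemma age_sum_del:
  "i \<in> {1..fst s} \<Longrightarrow> age_sum m \<theta> (ES_del i s) = age_sum m \<theta> s - (1 + \<theta> + snd s i) powr m"
  unfolding age_sum_def using sum_ES_del[of i s "\<lambda>x. (1 + \<theta> + x) powr m"] by simp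

lemma age_le_age_sum: "i \<in> {1..fst s} \<Longrightarrow> (1 + \<theta> + snd s i) powr m \<le> age_sum m \<theta> s"
  unfolding age_sum_def by (rule member_le_sum) auto

lemma age_sum_ge:
  assumes s: "s \<in> ES_space" and m: "1 \<le> m"
  shows "real (fst s) \<le> age_sum m 0 s" "i \<in> {1..fst s} \<Longrightarrow> 1 + snd s i \<le> age_sum m 0 s"
proof -
  have ge: "1 + snd s i \<le> (1 + 0 + snd s i) powr m" for i
    using ES_space_nonneg[OF s, of i] m powr_mono[of 1 m "1 + snd s i"] by simp
  have "(\<Sum>j\<in>{1..fst s}. 1) \<le> age_sum m 0 s"
    unfolding age_sum_def 
  proof (rule sum_mono)
    fix i show "1 \<le> (1 + 0 + snd s i) powr m" using ge[of i] ES_space_nonneg[OF s, of i] by linarith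
  qed
  then show "real (fst s) \<le> age_sum m 0 s" by simp
  show "1 + snd s i \<le> age_sum m 0 s" if "i \<in> {1..fst s}"
    using ge[of i] age_le_age_sum[OF that, of 0 m] by linarith
qed

text \<open>At shift 0 the age sum S grows in the shift at rate m times the sum of (1 + x) powr (m -
  1). Since each 1 + x is at most S powr (1/m), that sum is at least S powr (1 - 1/m). For V = S
  powr p the gained power S powr (p - 1/m) is V powr (1 - 1/(m p)), the loss in the drift.\<close>

lemma age_sum_growth:
  assumes s: "s \<in> ES_space" and m: "1 \<le> m" and p: "1 \<le> p" and \<theta>: "0 \<le> \<theta>"
  shows "age_sum m 0 s powr p + p * m * \<theta> * age_sum m 0 s powr (p - 1/m) \<le> age_sum m \<theta> s powr p"
proof (cases "fst s = 0")
  case True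
  then show ?thesis using p by (simp add: age_sum_def)
next
  case False
  let ?S = "age_sum m 0 s"
  have S: "1 \<le> ?S" using age_sum_ge(1)[OF s m] False by linarith
  have x0: "0 \<le> snd s j" for j by (rule ES_space_nonneg[OF s])
  have "?S powr (1 - 1/m) = ?S powr (- (1/m)) * ?S" using S powr_add[of ?S "-(1/m)" 1] by simp
  also have "\<dots> = (\<Sum>j\<in>{1..fst s}. ?S powr (- (1/m)) * (1 + 0 + snd s j) powr m)"
    by (subst (2) age_sum_def) (simp only: sum_distrib_left)
  also have "\<dots> \<le> (\<Sum>j\<in>{1..fst s}. (1 + snd s j) powr (m - 1))"
  proof (rule sum_mono)
    fix j assume j: "j \<in> {1..fst s}"
    have "1 + snd s j = ((1 + snd s j) powr m) powr (1/m)" using m x0[of j] by (simp add: powr_powr)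
    also have "\<dots> \<le> ?S powr (1/m)" using age_le_age_sum[OF j, of 0 m] m by (intro powr_mono2) auto
    finally have "?S powr (- (1/m)) \<le> inverse (1 + snd s j)"
      using x0[of j] S by (simp add: powr_minus)
    then have "?S powr (- (1/m)) * (1 + snd s j) powr m \<le> inverse (1 + snd s j) * (1 + snd s j) powr m"
      by (intro mult_right_mono) auto
    also have "\<dots> = (1 + snd s j) powr (m - 1)" using x0[of j] by (simp add: powr_diff field_simps)
    finally show "?S powr (- (1/m)) * (1 + 0 + snd s j) powr m \<le> (1 + snd s j) powr (m - 1)" by simp
  qed
  finally have D: "?S powr (1 - 1/m) \<le> (\<Sum>j\<in>{1..fst s}. (1 + snd s j) powr (m - 1))" .
  have "?S + m * \<theta> * ?S powr (1 - 1/m) \<le> ?S + m * \<theta> * (\<Sum>j\<in>{1..fst s}. (1 + snd s j) powr (m - 1))"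
    using D m \<theta> by (intro add_left_mono mult_left_mono) auto
  also have "\<dots> = (\<Sum>j\<in>{1..fst s}. (1 + snd s j) powr m + m * \<theta> * (1 + snd s j) powr (m - 1))"
    by (simp add: age_sum_def sum.distrib sum_distrib_left)
  also have "\<dots> \<le> age_sum m \<theta> s"
    unfolding age_sum_def
  proof (rule sum_mono)
    fix j
    show "(1 + snd s j) powr m + m * \<theta> * (1 + snd s j) powr (m - 1) \<le> (1 + \<theta> + snd s j) powr m"
      using powr_add_ge[of "1 + snd s j" \<theta> m] x0[of j] \<theta> m by (simp add: ac_simps)
  qed
  finally have le: "?S + m * \<theta> * ?S powr (1 - 1/m) \<le> age_sum m \<theta> s" .
  have "?S powr p + p * m * \<theta> * ?S powr (p - 1/m) = ?S powr p + p * (m * \<theta> * ?S powr (1 - 1/m)) * ?S powr (p - 1)"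
  proof -
    have "?S powr (1 - 1/m) * ?S powr (p - 1) = ?S powr (p - 1/m)" by (simp add: powr_add[symmetric])
    then show ?thesis by (simp add: mult.assoc)
  qed
  also have "\<dots> \<le> (?S + m * \<theta> * ?S powr (1 - 1/m)) powr p"
    using S m \<theta> p by (intro powr_add_ge) (auto intro!: add_nonneg_nonneg)
  also have "\<dots> \<le> age_sum m \<theta> s powr p" using le p S m \<theta> by (intro powr_mono2) (auto intro!: add_nonneg_nonneg)
  finally show ?thesis .
qed

locale ES_heavy_service = ES_process +
  fixes C0 m lmin :: real
  assumes C0_pos: "0 < C0" and m_gt_1: "1 < m" and h_lower: "0 \<le> x \<Longrightarrow> C0 / (1 + x) \<le> h x"
    and lmin_pos: "0 < lmin" and lam_empty: "0 \<le> y \<Longrightarrow> lmin \<le> lam (ES_empty y)"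
begin

text \<open>Three effects are compared with S powr (p - 1) D, where D is the sum of (1 + \<theta> +
  x) powr (m - 1). Departures remove at least C0 times it, arrivals add at most (1 + \<eta>) p Lam 2
  powr p times it, and ageing adds p m (1 + \<gamma>) times it, as the shift itself moves at speed
  \<gamma>. The slack in the condition on \<open>C0\<close> leaves room for \<eta>.\<close>

lemma generator_bound:
  assumes s: "s \<in> ES_space" and p: "1 \<le> p" and \<theta>: "0 \<le> \<theta>" "\<theta> \<le> \<eta>" and \<gamma>: "0 \<le> \<gamma>" "\<gamma> \<le> \<eta>"
    and \<eta>: "(1 + \<eta>) * (p * (m + Lam * 2 powr p)) \<le> C0"
  shows "lam s * (age_sum m \<theta> s + (1 + \<theta>) powr m) powr p
      + (\<Sum>i\<in>{1..fst s}. h (snd s i) * (age_sum m \<theta> s - (1 + \<theta> + snd s i) powr m) powr p)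
    \<le> rate s * age_sum m \<theta> s powr p
      - p * age_sum m \<theta> s powr (p - 1) * (m * (1 + \<gamma>) * (\<Sum>i\<in>{1..fst s}. (1 + \<theta> + snd s i) powr (m - 1)))
      + Lam * (1 + \<eta>) powr (m * p)"
proof (cases "fst s = 0")
  case True
  \<comment> \<open>In the empty state no departure compensates an arrival; this is the only source
    of the additive constant.\<close>
  have "((1 + \<theta>) powr m) powr p \<le> (1 + \<eta>) powr (m * p)"
    unfolding powr_powr using \<theta> m_gt_1 p by (intro powr_mono2) auto
  moreover have "lam s \<le> Lam" using lam_le[OF s] True by simp
  ultimately have "lam s * ((1 + \<theta>) powr m) powr p \<le> Lam * (1 + \<eta>) powr (m * p)"
    using Lam_nonneg by (intro mult_mono) auto
  then show ?thesis using True p by (simp add: age_sum_def ES_rate_def)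
next
  case False
  let ?n = "fst s" and ?S = "age_sum m \<theta> s" and ?d = "(1 + \<theta>) powr m"
  let ?di = "\<lambda>i. (1 + \<theta> + snd s i) powr m" and ?e = "\<lambda>i. (1 + \<theta> + snd s i) powr (m - 1)"
  define D where "D = (\<Sum>i\<in>{1..?n}. ?e i)"
  have x0: "0 \<le> snd s j" for j by (rule ES_space_nonneg[OF s])
  have h0: "0 \<le> h (snd s j)" for j by (rule h_nonneg[OF x0])
  have D0: "0 \<le> D" unfolding D_def by (intro sum_nonneg) auto
  have d1: "1 \<le> ?d" using \<theta> m_gt_1 by (intro ge_one_powr_ge_zero) auto
  have ddi: "?d \<le> ?di i" for i using x0[of i] \<theta> m_gt_1 by (intro powr_mono2) auto
  have dS: "?d \<le> ?S" using age_le_age_sum[of 1 s \<theta> m] ddi[of 1] False by (intro order_trans[OF ddi[of 1]]) auto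
  have S: "1 \<le> ?S" using d1 dS by linarith
  \<comment> \<open>Each customer contributes at least (1 + \<theta>) powr (m - 1) to D. This
    converts the arrival rate, bounded by Lam n, into a multiple of D.\<close>
  have nd: "real ?n * ?d \<le> (1 + \<eta>) * D"
  proof -
    have "real ?n * ?d = (1 + \<theta>) * (\<Sum>i\<in>{1..?n}. (1 + \<theta>) powr (m - 1))"
      using \<theta> by (simp add: powr_diff)
    also have "\<dots> \<le> (1 + \<eta>) * D"
      unfolding D_def using \<theta> x0 m_gt_1 by (intro mult_mono sum_mono powr_mono2 sum_nonneg) auto
    finally show ?thesis .
  qed
  \<comment> \<open>With someone present the newcomer's share is at most S, so the age sum at most
    doubles; this is where 2 powr p comes from.\<close>
  have arr: "lam s * (?S + ?d) powr p \<le> lam s * ?S powr p + ?S powr (p - 1) * D * ((1 + \<eta>) * (p * (Lam * 2 powr p)))"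
  proof -
    have "(?S + ?d) powr p - ?S powr p \<le> p * ?d * (?S + ?d) powr (p - 1)"
      using powr_add_le[of ?S ?d p] S d1 p by simp
    also have "\<dots> \<le> p * ?d * (2 powr p * ?S powr (p - 1))"
    proof (rule mult_left_mono)
      have "(?S + ?d) powr (p - 1) \<le> (2 * ?S) powr (p - 1)"
        using S dS p by (intro powr_mono2) auto
      also have "\<dots> = 2 powr (p - 1) * ?S powr (p - 1)" using S by (simp add: powr_mult)
      also have "\<dots> \<le> 2 powr p * ?S powr (p - 1)" by (intro mult_right_mono) auto
      finally show "(?S + ?d) powr (p - 1) \<le> 2 powr p * ?S powr (p - 1)" .
    qed (use p d1 in auto)
    finally have 1: "(?S + ?d) powr p - ?S powr p \<le> p * ?d * (2 powr p * ?S powr (p - 1))" .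
    have "lam s \<le> Lam * real ?n" using lam_le[OF s] False by (simp add: max_absorb2)
    then have "lam s * ((?S + ?d) powr p - ?S powr p) \<le> (Lam * real ?n) * (p * ?d * (2 powr p * ?S powr (p - 1)))"
      using 1 lam_nonneg[OF s] Lam_nonneg p d1 S
      by (intro mult_mono) (auto simp: powr_mono2)
    also have "\<dots> = (real ?n * ?d) * (Lam * p * 2 powr p * ?S powr (p - 1))" by simp
    also have "\<dots> \<le> ((1 + \<eta>) * D) * (Lam * p * 2 powr p * ?S powr (p - 1))"
      using Lam_nonneg p by (intro mult_right_mono nd) auto
    finally show ?thesis by (simp add: algebra_simps)
  qed
  have dep: "(\<Sum>i\<in>{1..?n}. h (snd s i) * (?S - ?di i) powr p) \<le> (\<Sum>i\<in>{1..?n}. h (snd s i)) * ?S powr p - C0 * ?S powr (p - 1) * D"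
  proof -
    have "(\<Sum>i\<in>{1..?n}. h (snd s i) * (?S - ?di i) powr p) \<le> (\<Sum>i\<in>{1..?n}. h (snd s i) * ?S powr p - C0 * ?S powr (p - 1) * ?e i)"
    proof (rule sum_mono)
      fix i assume i: "i \<in> {1..?n}"
      have "h (snd s i) * (?S - ?di i) powr p \<le> h (snd s i) * (?S powr p - ?di i * ?S powr (p - 1))"
        using S p age_le_age_sum[OF i] by (intro mult_left_mono h0 powr_minus_le) auto
      moreover have "C0 * ?S powr (p - 1) * ?e i \<le> h (snd s i) * (?di i * ?S powr (p - 1))"
      proof -
        have "C0 / (1 + \<theta> + snd s i) \<le> C0 / (1 + snd s i)" using C0_pos \<theta> x0[of i] by (intro divide_left_mono) auto
        also have "\<dots> \<le> h (snd s i)" by (rule h_lower[OF x0])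
        finally have "C0 / (1 + \<theta> + snd s i) * (?di i * ?S powr (p - 1)) \<le> h (snd s i) * (?di i * ?S powr (p - 1))"
          by (intro mult_right_mono) auto
        moreover have "C0 / (1 + \<theta> + snd s i) * (?di i * ?S powr (p - 1))
            = C0 * ?S powr (p - 1) * (?di i / (1 + \<theta> + snd s i))" by simp
        moreover have "?di i / (1 + \<theta> + snd s i) = ?e i" using x0[of i] \<theta> by (simp add: powr_diff)
        ultimately show ?thesis by simp
      qed
      ultimately show "h (snd s i) * (?S - ?di i) powr p \<le> h (snd s i) * ?S powr p - C0 * ?S powr (p - 1) * ?e i"
        by (simp add: right_diff_distrib)
    qed
    also have "\<dots> = (\<Sum>i\<in>{1..?n}. h (snd s i)) * ?S powr p - C0 * ?S powr (p - 1) * D"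
      by (simp add: sum_subtractf sum_distrib_right sum_distrib_left D_def)
    finally show ?thesis .
  qed
  have "?S powr (p - 1) * D * ((1 + \<eta>) * (p * (Lam * 2 powr p))) + ?S powr (p - 1) * D * (p * m * (1 + \<gamma>)) \<le> ?S powr (p - 1) * D * C0"
  proof -
    have "p * m * (1 + \<gamma>) \<le> p * m * (1 + \<eta>)" using p m_gt_1 \<gamma> by (intro mult_left_mono) auto
    then have "(1 + \<eta>) * (p * (Lam * 2 powr p)) + p * m * (1 + \<gamma>) \<le> C0"
      using \<eta> by (simp add: algebra_simps)
    then have "?S powr (p - 1) * D * ((1 + \<eta>) * (p * (Lam * 2 powr p)) + p * m * (1 + \<gamma>)) \<le> ?S powr (p - 1) * D * C0"
      using D0 by (intro mult_left_mono) auto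
    then show ?thesis by (simp add: distrib_left)
  qed
  moreover have "0 \<le> Lam * (1 + \<eta>) powr (m * p)" using Lam_nonneg by simp
  moreover have "rate s = lam s + (\<Sum>i\<in>{1..?n}. h (snd s i))" by (simp add: ES_rate_def)
  ultimately show ?thesis using arr dep unfolding D_def[symmetric] by (simp add: algebra_simps)
qed

lemma age_sum_flow:
  "age_sum m \<theta> (ES_flow u s) = (\<Sum>i\<in>{1..fst s}. (1 + \<theta> + (snd s i + u)) powr m)"
  by (simp add: age_sum_def snd_ES_flow)

text \<open>With t the remaining time the shift is \<gamma> (T - t), so it rises from 0 to \<gamma>
  T during the run. The bound then has a larger shift on the left than on the right, and
  \<open>age_sum_growth\<close> turns this difference into a drift. For \<gamma> = 0 it is a plain
  moment bound.\<close>

lemma lyapunov: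
  assumes s: "s \<in> ES_space" and p: "1 \<le> p" and T: "0 \<le> T" and \<gamma>: "0 \<le> \<gamma>" "\<gamma> \<le> \<eta>" "\<gamma> * T \<le> \<eta>"
    and \<eta>: "(1 + \<eta>) * (p * (m + Lam * 2 powr p)) \<le> C0"
  shows "(\<integral>\<^sup>+y. ennreal (age_sum m (\<gamma> * T) y powr p) \<partial>ES_law lam h s T)
      \<le> ennreal (age_sum m 0 s powr p + Lam * (1 + \<eta>) powr (m * p) * T)"
proof -
  define b where "b = Lam * (1 + \<eta>) powr (m * p)"
  have b: "0 \<le> b" using Lam_nonneg by (simp add: b_def)
  define \<Phi> where "\<Phi> = (\<lambda>y t. ennreal (age_sum m (\<gamma> * (T - t)) y powr p + b * t))"
  have fm: "(\<lambda>y. ennreal (age_sum m (\<gamma> * T) y powr p)) \<in> borel_measurable ES_M" by measurable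
  have "(\<Sum>k. jump_op k (\<lambda>y. ennreal (age_sum m (\<gamma> * T) y powr p)) s T) \<le> \<Phi> s T"
  proof (rule jump_op_suminf_le[OF fm s T order_refl])
    fix y t assume y: "y \<in> ES_space" and t: "0 \<le> t" "t \<le> T"
    define S where "S = (\<lambda>u. age_sum m (\<gamma> * (T - t + u)) (ES_flow u y))"
    define D where "D = (\<lambda>u. \<Sum>i\<in>{1..fst y}. (1 + \<gamma> * (T - t + u) + (snd y i + u)) powr (m - 1))"
    define \<phi> where "\<phi> = (\<lambda>u. S u powr p + b * (t - u))"
    define \<phi>' where "\<phi>' = (\<lambda>u. p * S u powr (p - 1) * (m * (1 + \<gamma>) * D u) - b)"
    have x0: "0 \<le> snd y j" for j by (rule ES_space_nonneg[OF y])
    have Seq: "S = (\<lambda>u. \<Sum>i\<in>{1..fst y}. (1 + \<gamma> * (T - t + u) + (snd y i + u)) powr m)"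
      by (simp add: S_def age_sum_flow)
    have base: "0 < 1 + \<gamma> * (T - t + u) + (snd y i + u)" if "0 \<le> u" for u i
      using that x0[of i] \<gamma> t by (intro add_pos_nonneg add_nonneg_nonneg mult_nonneg_nonneg) auto
    have base': "1 + \<gamma> * (T - t + u) + (snd y i + u) \<noteq> 0" if "0 \<le> u" for u i
      using base[OF that, of i] by (rule less_imp_neq[symmetric])
    \<comment> \<open>In an empty state S vanishes identically and the rule for differentiating
      \<open>powr\<close>, which wants a positive base, does not apply; that case is treated apart
      below.\<close>
    have S0: "0 < S u" if "0 \<le> u" "fst y \<noteq> 0" for u
      unfolding Seq using base'[OF that(1)] that(2) by (intro sum_pos) auto
    have key: "jumps (\<lambda>z. \<Phi> z (t - u)) (ES_flow u y) \<le> ennreal (rate (ES_flow u y) * \<phi> u - \<phi>' u)"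
      "0 \<le> rate (ES_flow u y) * \<phi> u - \<phi>' u" if u: "u \<in> {0..t}" for u
    proof -
      let ?y = "ES_flow u y" and ?\<theta> = "\<gamma> * (T - t + u)"
      have fy: "?y \<in> ES_space" using y u by (intro ES_flow_space) auto
      have \<theta>: "0 \<le> ?\<theta>" "?\<theta> \<le> \<eta>"
      proof -
        show "0 \<le> ?\<theta>" using \<gamma> t u by simp
        have "?\<theta> \<le> \<gamma> * T" using \<gamma> t u by (intro mult_left_mono) auto
        then show "?\<theta> \<le> \<eta>" using \<gamma> by simp
      qed
      have tt: "T - (t - u) = T - t + u" by simp
      have jeq: "jumps (\<lambda>z. \<Phi> z (t - u)) ?y = ennreal (lam ?y * ((S u + (1 + ?\<theta>) powr m) powr p + b * (t - u))
          + (\<Sum>i\<in>{1..fst ?y}. h (snd ?y i) * ((S u - (1 + ?\<theta> + snd ?y i) powr m) powr p + b * (t - u))))"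
        using u b by (intro jumps_eq_real fy) (auto simp: \<Phi>_def tt age_sum_ins age_sum_del S_def)
      have "lam ?y * ((S u + (1 + ?\<theta>) powr m) powr p + b * (t - u))
          + (\<Sum>i\<in>{1..fst ?y}. h (snd ?y i) * ((S u - (1 + ?\<theta> + snd ?y i) powr m) powr p + b * (t - u)))
        = (lam ?y * (S u + (1 + ?\<theta>) powr m) powr p
          + (\<Sum>i\<in>{1..fst ?y}. h (snd ?y i) * (S u - (1 + ?\<theta> + snd ?y i) powr m) powr p)) + rate ?y * (b * (t - u))"
        by (simp add: ES_rate_def distrib_left distrib_right sum.distrib sum_distrib_right)
      also have "\<dots> \<le> (rate ?y * S u powr p - p * S u powr (p - 1) * (m * (1 + \<gamma>) * (\<Sum>i\<in>{1..fst ?y}. (1 + ?\<theta> + snd ?y i) powr (m - 1))) + b)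
           + rate ?y * (b * (t - u))"
        unfolding S_def b_def by (intro add_right_mono generator_bound[OF fy p \<theta> \<gamma>(1,2) \<eta>])
      also have "(\<Sum>i\<in>{1..fst ?y}. (1 + ?\<theta> + snd ?y i) powr (m - 1)) = D u"
        by (simp add: D_def snd_ES_flow)
      also have "(rate ?y * S u powr p - p * S u powr (p - 1) * (m * (1 + \<gamma>) * D u) + b) + rate ?y * (b * (t - u)) = rate ?y * \<phi> u - \<phi>' u"
        by (simp add: \<phi>_def \<phi>'_def algebra_simps)
      finally have le: "lam ?y * ((S u + (1 + ?\<theta>) powr m) powr p + b * (t - u))
          + (\<Sum>i\<in>{1..fst ?y}. h (snd ?y i) * ((S u - (1 + ?\<theta> + snd ?y i) powr m) powr p + b * (t - u))) \<le> rate ?y * \<phi> u - \<phi>' u" .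
      have "0 \<le> lam ?y * ((S u + (1 + ?\<theta>) powr m) powr p + b * (t - u))
          + (\<Sum>i\<in>{1..fst ?y}. h (snd ?y i) * ((S u - (1 + ?\<theta> + snd ?y i) powr m) powr p + b * (t - u)))"
        using lam_nonneg[OF fy] h_nonneg[OF ES_space_nonneg[OF fy]] b u
        by (intro add_nonneg_nonneg mult_nonneg_nonneg sum_nonneg) auto
      then show "0 \<le> rate ?y * \<phi> u - \<phi>' u" using le by linarith
      show "jumps (\<lambda>z. \<Phi> z (t - u)) ?y \<le> ennreal (rate ?y * \<phi> u - \<phi>' u)"
        unfolding jeq by (rule ennreal_leI[OF le])
    qed
    have deriv: "(\<phi> has_real_derivative \<phi>' u) (at u within {0..t})" if u: "u \<in> {0..t}" for u
    proof -
      have SD: "(S has_real_derivative m * (1 + \<gamma>) * D u) (at u)"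
      proof -
        have "((\<lambda>u. (1 + \<gamma> * (T - t + u) + (snd y i + u)) powr m) has_real_derivative
            m * (1 + \<gamma> * (T - t + u) + (snd y i + u)) powr (m - of_nat 1) * (1 + \<gamma>)) (at u)" for i
          using base[of u i] u by (intro DERIV_fun_powr) (auto intro!: derivative_eq_intros)
        then have "(S has_real_derivative (\<Sum>i\<in>{1..fst y}. m * (1 + \<gamma> * (T - t + u) + (snd y i + u)) powr (m - of_nat 1) * (1 + \<gamma>))) (at u)"
          unfolding Seq by (intro DERIV_sum)
        then show ?thesis by (simp add: D_def sum_distrib_left ac_simps)
      qed
      have "((\<lambda>u. S u powr p) has_real_derivative p * S u powr (p - 1) * (m * (1 + \<gamma>) * D u)) (at u)"
      proof (cases "fst y = 0")
        case True
        then show ?thesis by (simp add: Seq D_def)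
      next
        case False
        then show ?thesis using DERIV_fun_powr[OF SD S0, of p] u by simp
      qed
      moreover have "((\<lambda>u. b * (t - u)) has_real_derivative - b) (at u)"
        by (auto intro!: derivative_eq_intros)
      ultimately have "(\<phi> has_real_derivative \<phi>' u) (at u)"
        unfolding \<phi>_def \<phi>'_def using DERIV_add by fastforce
      then show ?thesis by (rule has_field_derivative_at_within)
    qed
    have cont: "continuous_on {0..t} \<phi>'"
    proof (cases "fst y = 0")
      case True
      then show ?thesis by (simp add: \<phi>'_def D_def)
    next
      case False
      have D: "continuous_on {0..t} D" unfolding D_def
        using base' by (intro continuous_intros) auto
      have "continuous_on {0..t} S" unfolding Seq
        using base' by (intro continuous_intros) auto
      then have "continuous_on {0..t} (\<lambda>u. S u powr (p - 1))"
      proof (intro continuous_intros ballI)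
        fix u assume "u \<in> {0..t}"
        then show "S u \<noteq> 0" using S0[of u] False by auto
      qed
      with D show ?thesis unfolding \<phi>'_def
        by (intro continuous_on_diff continuous_on_mult continuous_on_const)
    qed
    have "ennreal (surv y t) * ennreal (\<phi> t) + first_jump \<Phi> y t \<le> ennreal (\<phi> 0)"
    proof (rule first_jump_supersolution[OF y t(1), where \<phi>=\<phi> and \<phi>'=\<phi>'])
      show "0 \<le> \<phi> t" by (simp add: \<phi>_def)
    qed (use deriv cont key in auto)
    moreover have "\<phi> t = age_sum m (\<gamma> * T) (ES_flow t y) powr p" by (simp add: \<phi>_def S_def)
    moreover have "ennreal (\<phi> 0) = \<Phi> y t" by (simp add: \<phi>_def S_def \<Phi>_def ES_flow_0[OF y])
    ultimately show "ennreal (surv y t) * ennreal (age_sum m (\<gamma> * T) (ES_flow t y) powr p) + first_jump \<Phi> y t \<le> \<Phi> y t"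
      by simp
  qed
  then show ?thesis by (simp add: nn_integral_ES_law[OF s T fm] \<Phi>_def b_def)
qed

text \<open>Up to time t every age stays in [0, X + t], so each customer's integrated hazard is at
  most the integral of \<open>h\<close> over this interval, uniformly in the state.\<close>

lemma surv_lower:
  obtains \<sigma> where "0 < \<sigma>"
    "\<And>s u. s \<in> ES_space \<Longrightarrow> fst s = n \<Longrightarrow> (\<And>i. i \<in> {1..n} \<Longrightarrow> snd s i \<le> X) \<Longrightarrow> 0 \<le> u \<Longrightarrow> u \<le> t \<Longrightarrow> \<sigma> \<le> surv s u"
proof -
  define X' where "X' = max 0 X" define t' where "t' = max 0 t"
  define H where "H = (\<integral>\<^sup>+r\<in>{0..X' + t'}. ennreal (h (0 + r)) \<partial>lborel)"
  have H: "H < \<infinity>" unfolding H_def by (rule h_integrable) (auto simp: X'_def t'_def)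
  define B where "B = ennreal (Lam * real (max 1 n)) * ennreal t' + of_nat n * H"
  have B: "B < \<infinity>" using H by (auto simp: B_def ennreal_mult_less_top ennreal_add_less_top of_nat_less_top)
  show thesis
  proof (rule that[of "exp (- enn2real B)"])
    fix s u assume s: "s \<in> ES_space" "fst s = n" and X: "\<And>i. i \<in> {1..n} \<Longrightarrow> snd s i \<le> X" and u: "0 \<le> u" "u \<le> t"
    have ut: "u \<le> t'" using u by (simp add: t'_def)
    have "(\<integral>\<^sup>+r\<in>{0..u}. ennreal (h (snd s i + r)) \<partial>lborel) \<le> H" if i: "i \<in> {1..n}" for i
    proof -
      let ?x = "snd s i"
      have x: "0 \<le> ?x" "?x \<le> X'" using ES_space_nonneg[OF s(1)] X[OF i] by (auto simp: X'_def)
      have "(\<integral>\<^sup>+r\<in>{0..u}. ennreal (h (?x + r)) \<partial>lborel) \<le> (\<integral>\<^sup>+r. ennreal (h (max 0 (?x + r))) * indicator {0..X' + t'} (?x + r) \<partial>lborel)"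
        using x ut by (intro nn_integral_mono) (auto split: split_indicator)
      also have "\<dots> = (\<integral>\<^sup>+r. ennreal (h (max 0 r)) * indicator {0..X' + t'} r \<partial>lborel)"
        using nn_integral_real_affine[of "\<lambda>r. ennreal (h (max 0 r)) * indicator {0..X' + t'} r" 1 ?x] by simp
      also have "\<dots> = H" unfolding H_def by (intro nn_integral_cong) (auto split: split_indicator)
      finally show ?thesis .
    qed
    then have "(\<Sum>i\<in>{1..n}. \<integral>\<^sup>+r\<in>{0..u}. ennreal (h (snd s i + r)) \<partial>lborel) \<le> (\<Sum>i\<in>{1..n}. H)"
      by (intro sum_mono) auto
    also have "\<dots> = of_nat n * H" by simp
    finally have "(\<Sum>i\<in>{1..n}. \<integral>\<^sup>+r\<in>{0..u}. ennreal (h (snd s i + r)) \<partial>lborel) \<le> of_nat n * H" .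
    moreover have "ennreal (Lam * real (max 1 n)) * ennreal u \<le> ennreal (Lam * real (max 1 n)) * ennreal t'"
      using ut by (intro mult_left_mono ennreal_leI) auto
    ultimately have "hazard_integral s u \<le> B"
      unfolding B_def by (intro order_trans[OF hazard_integral_le[OF s(1) u(1), unfolded s(2)]] add_mono)
    then have "enn2real (hazard_integral s u) \<le> enn2real B" using B by (intro enn2real_mono) auto
    then show "exp (- enn2real B) \<le> surv s u" by (simp add: surv_eq[OF s(1) u(1)])
  qed simp
qed

section \<open>Minorization on sublevel sets of the age sum\<close>

lemma ES_empty_cases:
  assumes "s \<in> ES_space" "fst s = 0"
  shows "s = ES_empty (snd s 0)"
  using assms by (cases s) (auto simp: ES_empty_def ES_space_def fun_eq_iff)

text \<open>Each step serves customer \<open>1\<close> within the first half of the available time.\<close>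

lemma empties:
  assumes "0 < t1" "t1 \<le> t2"
  shows "\<exists>\<delta>>0. \<forall>s\<in>ES_space. fst s = n \<longrightarrow> (\<forall>i\<in>{1..n}. snd s i \<le> X) \<longrightarrow>
      (\<forall>t\<in>{t1..t2}. ennreal \<delta> \<le> jump_op n (indicator {y \<in> ES_space. fst y = 0}) s t)"
  using assms
proof (induction n arbitrary: t1 t2 X)
  case 0
  obtain \<sigma> where \<sigma>: "0 < \<sigma>" "\<And>s u. s \<in> ES_space \<Longrightarrow> fst s = 0 \<Longrightarrow> 0 \<le> u \<Longrightarrow> u \<le> t2 \<Longrightarrow> \<sigma> \<le> surv s u"
    using surv_lower[of 0 0 t2] by auto
  show ?case
    using \<sigma> 0 by (intro exI[of _ \<sigma>]) (auto simp: ES_flow_space max_absorb2 intro!: ennreal_leI)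
next
  case (Suc n)
  obtain \<sigma> where \<sigma>: "0 < \<sigma>" "\<And>s u. s \<in> ES_space \<Longrightarrow> fst s = Suc n \<Longrightarrow> (\<And>i. i \<in> {1..Suc n} \<Longrightarrow> snd s i \<le> X) \<Longrightarrow> 0 \<le> u \<Longrightarrow> u \<le> t2 \<Longrightarrow> \<sigma> \<le> surv s u"
    using surv_lower[of "Suc n" X t2] by blast
  \<comment> \<open>After a departure at some u <= t1/2 the remaining time lies in [t1/2, t2] and
    the ages are at most X + t2. A whole range of times and an arbitrary age bound are part of the
    induction so that this fits.\<close>
  obtain \<delta> where \<delta>: "0 < \<delta>" "\<And>s t. s \<in> ES_space \<Longrightarrow> fst s = n \<Longrightarrow> (\<And>i. i \<in> {1..n} \<Longrightarrow> snd s i \<le> X + t2) \<Longrightarrow> t \<in> {t1/2..t2} \<Longrightarrow>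
      ennreal \<delta> \<le> jump_op n (indicator {y \<in> ES_space. fst y = 0}) s t"
    using Suc.IH[of "t1/2" t2 "X + t2"] Suc.prems by (auto simp: Ball_def)
  define X' where "X' = max 0 X"
  \<comment> \<open>Lower bound for the hazard of customer 1, from \<open>h_lower\<close> at the
    largest age it can have.\<close>
  define c where "c = C0 / (1 + (X' + t2))"
  have c: "0 < c" using C0_pos Suc.prems by (auto simp: c_def X'_def)
  show ?case
  proof (intro exI[of _ "\<sigma> * c * \<delta> * (t1/2)"] conjI ballI impI)
    show "0 < \<sigma> * c * \<delta> * (t1/2)" using \<sigma>(1) c \<delta>(1) Suc.prems by simp
    fix s t assume s: "s \<in> ES_space" "fst s = Suc n" and X: "\<forall>i\<in>{1..Suc n}. snd s i \<le> X" and t: "t \<in> {t1..t2}"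
    let ?f = "indicator {y \<in> ES_space. fst y = 0} :: es_state \<Rightarrow> ennreal"
    have "ennreal (\<sigma> * c * \<delta> * (t1/2)) = (\<integral>\<^sup>+u. ennreal \<sigma> * (ennreal c * ennreal \<delta>) * indicator {0..t1/2} u \<partial>lborel)"
      using \<sigma>(1) c \<delta>(1) Suc.prems by (simp add: nn_integral_cmult_indicator ennreal_mult[symmetric] mult.assoc)
    also have "\<dots> \<le> (\<integral>\<^sup>+u. ennreal (surv s u) * jumps (\<lambda>y. jump_op n ?f y (t - u)) (ES_flow (max 0 u) s) * indicator {0..t} u \<partial>lborel)"
    proof (intro nn_integral_mono)
      fix u :: real
      have "ennreal \<sigma> * (ennreal c * ennreal \<delta>) \<le> ennreal (surv s u) * jumps (\<lambda>y. jump_op n ?f y (t - u)) (ES_flow u s)"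
        if u: "0 \<le> u" "u \<le> t1/2"
      proof (rule mult_mono)
        show "ennreal \<sigma> \<le> ennreal (surv s u)" using s X u t Suc.prems by (intro ennreal_leI \<sigma>(2)) auto
        let ?s = "ES_flow u s"
        have fs: "?s \<in> ES_space" using s(1) u(1) by (rule ES_flow_space)
        have x1: "snd ?s 1 = snd s 1 + u" "0 \<le> snd s 1" "snd s 1 \<le> X'"
        proof -
          have "snd s 1 \<le> X" using X by auto
          then show "snd s 1 \<le> X'" by (simp add: X'_def)
        qed (use s ES_space_nonneg[OF s(1), of 1] in \<open>auto simp: snd_ES_flow\<close>)
        have "c \<le> C0 / (1 + snd ?s 1)"
          unfolding c_def x1(1) using x1 u t Suc.prems C0_pos by (intro divide_left_mono) (auto simp: X'_def)
        also have "\<dots> \<le> h (snd ?s 1)" using ES_space_nonneg[OF fs] by (rule h_lower)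
        finally have hc: "ennreal c \<le> ennreal (h (snd ?s 1))" by (rule ennreal_leI)
        have "ennreal \<delta> \<le> jump_op n ?f (ES_del 1 ?s) (t - u)"
        proof (rule \<delta>(2))
          show "ES_del 1 ?s \<in> ES_space" using fs s by (intro ES_del_space) auto
          show "fst (ES_del 1 ?s) = n" using s by (simp add: ES_del_def)
          show "snd (ES_del 1 ?s) i \<le> X + t2" if "i \<in> {1..n}" for i
          proof -
            have "snd (ES_del 1 ?s) i = snd s (Suc i) + u" using that s by (auto simp: ES_del_def snd_ES_flow)
            moreover have "snd s (Suc i) \<le> X" using X that by auto
            ultimately show ?thesis using u t Suc.prems by auto
          qed
          show "t - u \<in> {t1/2..t2}" using u t by auto
        qed
        then have "ennreal c * ennreal \<delta> \<le> ennreal (h (snd ?s 1)) * jump_op n ?f (ES_del 1 ?s) (t - u)"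
          by (intro mult_mono hc) auto
        also have "\<dots> \<le> (\<Sum>i\<in>{1..fst ?s}. ennreal (h (snd ?s i)) * jump_op n ?f (ES_del i ?s) (t - u))"
          using s by (intro member_le_sum[of 1 _ "\<lambda>i. ennreal (h (snd ?s i)) * jump_op n ?f (ES_del i ?s) (t - u)"]) auto
        also have "\<dots> \<le> jumps (\<lambda>y. jump_op n ?f y (t - u)) ?s"
          unfolding jumps_def by (rule add_increasing) auto
        finally show "ennreal c * ennreal \<delta> \<le> jumps (\<lambda>y. jump_op n ?f y (t - u)) ?s" .
      qed auto
      then show "ennreal \<sigma> * (ennreal c * ennreal \<delta>) * indicator {0..t1/2} u
         \<le> ennreal (surv s u) * jumps (\<lambda>y. jump_op n ?f y (t - u)) (ES_flow (max 0 u) s) * indicator {0..t} u"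
        using t Suc.prems by (auto split: split_indicator simp: max_absorb2)
    qed
    also have "\<dots> = jump_op (Suc n) ?f s t" by (simp add: first_jump_def)
    finally show "ennreal (\<sigma> * c * \<delta> * (t1/2)) \<le> jump_op (Suc n) ?f s t" .
  qed
qed

lemma emeasure_ES_law_ge_jump_op:
  assumes "s \<in> ES_space" "0 \<le> t" "A \<in> sets ES_M"
  shows "jump_op k (indicator A) s t \<le> emeasure (ES_law lam h s t) A"
  unfolding emeasure_ES_law[OF assms] ES_trans_eq[OF assms(2)]
  using sum_le_suminf[of "\<lambda>k. jump_op k (indicator A) s t" "{k}"] by simp

lemma empty_sets: "{y \<in> ES_space. fst y = 0} \<in> sets ES_M"
proof -
  have "{y \<in> space ES_M. fst y = 0} \<in> sets ES_M" by measurable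
  then show ?thesis by simp
qed

text \<open>The constant from \<open>empties\<close> depends on the number of customers; at most K +
  1 numbers occur, so the minimum stays positive.\<close>

lemma empties_bounded:
  obtains \<delta> where "0 < \<delta>"
    "\<And>s. s \<in> ES_space \<Longrightarrow> fst s \<le> K \<Longrightarrow> (\<And>i. i \<in> {1..fst s} \<Longrightarrow> snd s i \<le> X) \<Longrightarrow>
      ennreal \<delta> \<le> emeasure (ES_law lam h s 1) {y \<in> ES_space. fst y = 0}"
proof -
  have "\<forall>n. \<exists>\<delta>>0. \<forall>s\<in>ES_space. fst s = n \<longrightarrow> (\<forall>i\<in>{1..n}. snd s i \<le> X) \<longrightarrow>
      ennreal \<delta> \<le> jump_op n (indicator {y \<in> ES_space. fst y = 0}) s 1"
    using empties[of 1 1 _ X] by auto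
  then have "\<exists>d. \<forall>n. 0 < d n \<and> (\<forall>s\<in>ES_space. fst s = n \<longrightarrow> (\<forall>i\<in>{1..n}. snd s i \<le> X) \<longrightarrow>
      ennreal (d n) \<le> jump_op n (indicator {y \<in> ES_space. fst y = 0}) s 1)"
    by (rule choice)
  then obtain d where dd: "\<forall>n. 0 < d n \<and> (\<forall>s\<in>ES_space. fst s = n \<longrightarrow> (\<forall>i\<in>{1..n}. snd s i \<le> X) \<longrightarrow>
      ennreal (d n) \<le> jump_op n (indicator {y \<in> ES_space. fst y = 0}) s 1)"
    by (rule exE)
  have d: "0 < d n" "s \<in> ES_space \<Longrightarrow> fst s = n \<Longrightarrow> (\<forall>i\<in>{1..n}. snd s i \<le> X) \<Longrightarrow>
      ennreal (d n) \<le> jump_op n (indicator {y \<in> ES_space. fst y = 0}) s 1" for n s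
    using dd[rule_format, of n] by blast+
  show thesis
  proof (rule that[of "Min (d ` {..K})"])
    show "0 < Min (d ` {..K})" using d(1) by (subst Min_gr_iff) auto
    fix s assume s: "s \<in> ES_space" "fst s \<le> K" and X: "\<And>i. i \<in> {1..fst s} \<Longrightarrow> snd s i \<le> X"
    have "ennreal (Min (d ` {..K})) \<le> ennreal (d (fst s))" using s by (intro ennreal_leI Min_le) auto
    also have "\<dots> \<le> jump_op (fst s) (indicator {y \<in> ES_space. fst y = 0}) s 1" using X by (intro d(2) s) auto
    also have "\<dots> \<le> emeasure (ES_law lam h s 1) {y \<in> ES_space. fst y = 0}"
      by (rule emeasure_ES_law_ge_jump_op[OF s(1) _ empty_sets]) simp
    finally show "ennreal (Min (d ` {..K})) \<le> emeasure (ES_law lam h s 1) {y \<in> ES_space. fst y = 0}" .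
  qed
qed

text \<open>From an empty state, whatever its \<open>x\<^sup>0\<close>, the next arrival leads to the same state \<open>(1, 0)\<close>, and it occurs
  with a density bounded below on \<open>[0, 1]\<close>.\<close>

lemma empty_minorization:
  obtains c N where "0 < c" "prob_space N" "sets N = sets ES_M"
    "\<And>y A. y \<in> ES_space \<Longrightarrow> fst y = 0 \<Longrightarrow> A \<in> sets ES_M \<Longrightarrow> ennreal c * emeasure N A \<le> emeasure (ES_law lam h y 1) A"
proof -
  define \<alpha> :: es_state where "\<alpha> = (1, \<lambda>_. 0)"
  have \<alpha>: "\<alpha> \<in> ES_space" by (auto simp: \<alpha>_def ES_space_def)
  \<comment> \<open>N describes an arrival at a uniform time u in [0, 1], followed by the flow from
    (1, 0) without jumps for the time 1 - u. A multiple of it lies below the one-jump part of the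
    law at time 1.\<close>
  define U where "U = uniform_measure lborel {0..1::real}"
  define F where "F = (\<lambda>u::real. ES_flow (max 0 (1 - u)) \<alpha>)"
  define N where "N = distr U ES_M F"
  have U: "prob_space U" unfolding U_def by (rule prob_space_uniform_measure) auto
  have [measurable]: "(\<lambda>_::real. \<alpha>) \<in> measurable borel ES_M" using \<alpha> by simp
  have Fb: "F \<in> measurable borel ES_M" unfolding F_def by measurable
  have FU: "F \<in> measurable U ES_M" using Fb by (simp add: U_def measurable_def)
  have N: "prob_space N" unfolding N_def by (rule prob_space.prob_space_distr[OF U FU])
  obtain \<sigma>0 where \<sigma>0: "0 < \<sigma>0" "\<And>s u. s \<in> ES_space \<Longrightarrow> fst s = 0 \<Longrightarrow> 0 \<le> u \<Longrightarrow> u \<le> 1 \<Longrightarrow> \<sigma>0 \<le> surv s u"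
    using surv_lower[of 0 0 1] by auto
  obtain \<sigma>1 where \<sigma>1: "0 < \<sigma>1" "\<And>s u. s \<in> ES_space \<Longrightarrow> fst s = 1 \<Longrightarrow> (\<And>i. i \<in> {1..1} \<Longrightarrow> snd s i \<le> 0) \<Longrightarrow> 0 \<le> u \<Longrightarrow> u \<le> 1 \<Longrightarrow> \<sigma>1 \<le> surv s u"
    using surv_lower[of 1 0 1] by blast
  have \<sigma>1': "\<sigma>1 \<le> surv \<alpha> u" if "0 \<le> u" "u \<le> 1" for u using that by (intro \<sigma>1(2) \<alpha>) (auto simp: \<alpha>_def)
  show thesis
  proof (rule that[of "\<sigma>0 * (lmin * \<sigma>1)" N])
    show "0 < \<sigma>0 * (lmin * \<sigma>1)" using \<sigma>0(1) \<sigma>1(1) lmin_pos by simp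
    show "prob_space N" by fact
    show "sets N = sets ES_M" by (simp add: N_def)
    fix y A assume y: "y \<in> ES_space" "fst y = 0" and A: "A \<in> sets ES_M"
    have vA: "F -` A \<inter> space borel \<in> sets borel" using Fb A by (rule measurable_sets)
    have "emeasure N A = emeasure U (F -` A \<inter> space U)" unfolding N_def by (rule emeasure_distr[OF FU A])
    also have "\<dots> = emeasure lborel ({0..1} \<inter> (F -` A))" using vA by (simp add: U_def emeasure_uniform_measure divide_ennreal_def)
    also have "\<dots> = (\<integral>\<^sup>+u. indicator ({0..1} \<inter> F -` A) u \<partial>lborel)"
      using vA by (intro nn_integral_indicator[symmetric]) auto
    also have "\<dots> = (\<integral>\<^sup>+u. indicator A (F u) * indicator {0..1} u \<partial>lborel)"
      by (intro nn_integral_cong) (auto split: split_indicator)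
    finally have "ennreal (\<sigma>0 * (lmin * \<sigma>1)) * emeasure N A = ennreal (\<sigma>0 * (lmin * \<sigma>1)) * (\<integral>\<^sup>+u. indicator A (F u) * indicator {0..1} u \<partial>lborel)"
      by simp
    also have "\<dots> = (\<integral>\<^sup>+u. ennreal (\<sigma>0 * (lmin * \<sigma>1)) * (indicator A (F u) * indicator {0..1} u) \<partial>lborel)"
    proof (rule nn_integral_cmult[symmetric])
      have "(\<lambda>u. indicator A (F u) :: ennreal) \<in> borel_measurable borel"
        by (rule measurable_compose[OF Fb]) (use A in auto)
      then show "(\<lambda>u. indicator A (F u) * indicator {0..1} u :: ennreal) \<in> borel_measurable lborel" by simp
    qed
    also have "\<dots> \<le> jump_op 1 (indicator A) y 1"
      unfolding One_nat_def jump_op.simps first_jump_def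
    proof (intro nn_integral_mono)
      fix u :: real
      let ?\<Phi> = "\<lambda>z. ennreal (surv z (1 - u)) * indicator A (ES_flow (max 0 (1 - u)) z)"
      have "ennreal (\<sigma>0 * (lmin * \<sigma>1)) * indicator A (F u) \<le> ennreal (surv y u) * jumps ?\<Phi> (ES_flow u y)" if u: "0 \<le> u" "u \<le> 1"
      proof -
        let ?y = "ES_flow u y"
        have fy: "?y \<in> ES_space" using y(1) u(1) by (rule ES_flow_space)
        have "?y = ES_empty (snd ?y 0)" using fy y by (intro ES_empty_cases) auto
        then have l: "lmin \<le> lam ?y" using lam_empty[OF ES_space_nonneg[OF fy, of 0]] by simp
        have ins: "ES_ins 1 ?y = \<alpha>" using y by (auto simp: ES_ins_def \<alpha>_def fun_eq_iff)
        have "ennreal (\<sigma>0 * (lmin * \<sigma>1)) * indicator A (F u) = ennreal \<sigma>0 * (ennreal lmin * (ennreal \<sigma>1 * indicator A (F u)))"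
          using \<sigma>0(1) \<sigma>1(1) lmin_pos by (simp add: ennreal_mult mult.assoc)
        also have "\<dots> \<le> ennreal (surv y u) * (ennreal (lam ?y) * (ennreal (surv \<alpha> (1 - u)) * indicator A (F u)))"
          using \<sigma>0(2)[OF y u] l \<sigma>1'[of "1 - u"] u by (intro mult_mono ennreal_leI) auto
        also have "ennreal (lam ?y) * (ennreal (surv \<alpha> (1 - u)) * indicator A (F u)) = jumps ?\<Phi> ?y"
          using y ins by (simp add: jumps_def F_def)
        finally show ?thesis .
      qed
      then show "ennreal (\<sigma>0 * (lmin * \<sigma>1)) * (indicator A (F u) * indicator {0..1} u)
        \<le> ennreal (surv y u) * jumps ?\<Phi> (ES_flow (max 0 u) y) * indicator {0..1} u"
        by (cases "u \<in> {0..1}") (auto simp: max_absorb2)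
    qed
    also have "\<dots> \<le> emeasure (ES_law lam h y 1) A" by (rule emeasure_ES_law_ge_jump_op[OF y(1) _ A]) simp
    finally show "ennreal (\<sigma>0 * (lmin * \<sigma>1)) * emeasure N A \<le> emeasure (ES_law lam h y 1) A" .
  qed
qed

text \<open>Time 2 is one unit for emptying and one for the arrival. Each summand of the age sum is
  at least 1 plus the age, so a sublevel set bounds the number of customers as well as their
  ages.\<close>

lemma ES_minorization:
  "\<exists>\<epsilon>>0. \<exists>N. prob_space N \<and> sets N = sets ES_M \<and>
    (\<forall>s\<in>ES_space. age_sum m 0 s \<le> R \<longrightarrow> (\<forall>A\<in>sets ES_M. ennreal \<epsilon> * emeasure N A \<le> emeasure (ES_law lam h s 2) A))"
proof -
  obtain c N where N: "0 < c" "prob_space N" "sets N = sets ES_M"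
    "\<And>y A. y \<in> ES_space \<Longrightarrow> fst y = 0 \<Longrightarrow> A \<in> sets ES_M \<Longrightarrow> ennreal c * emeasure N A \<le> emeasure (ES_law lam h y 1) A"
    using empty_minorization by blast
  obtain \<delta> where \<delta>: "0 < \<delta>" "\<And>s. s \<in> ES_space \<Longrightarrow> fst s \<le> nat \<lfloor>R\<rfloor> \<Longrightarrow> (\<And>i. i \<in> {1..fst s} \<Longrightarrow> snd s i \<le> R) \<Longrightarrow>
      ennreal \<delta> \<le> emeasure (ES_law lam h s 1) {y \<in> ES_space. fst y = 0}"
    using empties_bounded by blast
  have "ennreal (\<delta> * c) * emeasure N A \<le> emeasure (ES_law lam h s 2) A"
    if s: "s \<in> ES_space" and R: "age_sum m 0 s \<le> R" and A: "A \<in> sets ES_M" for s A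
  proof -
    let ?E = "{y \<in> ES_space. fst y = 0}"
    have m: "1 \<le> m" using m_gt_1 by simp
    have d: "ennreal \<delta> \<le> emeasure (ES_law lam h s 1) ?E"
    proof (rule \<delta>(2)[OF s])
      show "fst s \<le> nat \<lfloor>R\<rfloor>" using age_sum_ge(1)[OF s m] R by (simp add: le_nat_floor)
      show "snd s i \<le> R" if "i \<in> {1..fst s}" for i using age_sum_ge(2)[OF s m that] R by linarith
    qed
    have "ennreal (\<delta> * c) * emeasure N A = ennreal \<delta> * (ennreal c * emeasure N A)"
      using \<delta>(1) N(1) by (simp add: ennreal_mult mult.assoc)
    also have "\<dots> \<le> emeasure (ES_law lam h s 1) ?E * (ennreal c * emeasure N A)"
      by (intro mult_right_mono d) auto
    also have "\<dots> = (\<integral>\<^sup>+y. (ennreal c * emeasure N A) * indicator ?E y \<partial>ES_law lam h s 1)"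
      using empty_sets by (subst nn_integral_cmult_indicator) (auto simp: mult.commute)
    also have "\<dots> \<le> (\<integral>\<^sup>+y. emeasure (ES_law lam h y 1) A \<partial>ES_law lam h s 1)"
      using N(4) A by (intro nn_integral_mono) (auto split: split_indicator)
    also have "\<dots> = emeasure (ES_law lam h s (1 + 1)) A"
      using s A by (intro chapman_kolmogorov[symmetric]) auto
    finally show ?thesis by simp
  qed
  then show ?thesis using N \<delta>(1) by (intro exI[of _ "\<delta> * c"]) auto
qed

section \<open>Polynomial ergodicity of the service process\<close>

lemma nn_integral_ES_law_add_const:
  fixes f :: "es_state \<Rightarrow> real"
  assumes s: "s \<in> ES_space" and t: "0 \<le> t" and f: "f \<in> borel_measurable ES_M" "\<And>y. 0 \<le> f y"
    and a: "0 \<le> a" and B: "0 \<le> B" "(\<integral>\<^sup>+y. ennreal (f y) \<partial>ES_law lam h s t) \<le> ennreal B"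
  shows "(\<integral>\<^sup>+y. ennreal (a + f y) \<partial>ES_law lam h s t) \<le> ennreal (a + B)"
proof -
  interpret L: prob_space "ES_law lam h s t" using s t by (intro prob_P) auto
  have "(\<integral>\<^sup>+y. ennreal (a + f y) \<partial>ES_law lam h s t) = (\<integral>\<^sup>+y. ennreal a + ennreal (f y) \<partial>ES_law lam h s t)"
    using a f by simp
  also have "\<dots> = ennreal a + (\<integral>\<^sup>+y. ennreal (f y) \<partial>ES_law lam h s t)"
    using f(1) s t L.emeasure_space_1 by (subst nn_integral_add) (auto intro!: measurable_P)
  also have "\<dots> \<le> ennreal a + ennreal B" by (intro add_left_mono B(2))
  finally show ?thesis using a B by simp
qed

text \<open>The abstract conditions are verified with e = m p and time step 2. The assumption at p +
  1/m implies the corresponding one at p, so both Lyapunov functions share one margin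
  \<eta>.\<close>

lemma polynomial_ergodicity:
  assumes p: "1 < p" and big: "(p + 1/m) * (m + Lam * 2 powr (p + 1/m)) < C0"
  obtains \<mu> D where "sets \<mu> = sets ES_M" "prob_space \<mu>"
    "\<And>t A. 0 \<le> t \<Longrightarrow> A \<in> sets ES_M \<Longrightarrow> (\<integral>\<^sup>+s. emeasure (ES_law lam h s t) A \<partial>\<mu>) = emeasure \<mu> A"
    "0 < D"
    "\<And>s A t. s \<in> ES_space \<Longrightarrow> A \<in> sets ES_M \<Longrightarrow> 0 \<le> t \<Longrightarrow>
      \<bar>measure (ES_law lam h s t) A - measure \<mu> A\<bar> \<le> D * max 1 (ES_L m p s) * (1 + t) powr (- (m * p))"
    "\<And>\<nu>. sets \<nu> = sets ES_M \<Longrightarrow> prob_space \<nu> \<Longrightarrow>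
      (\<And>t A. 0 \<le> t \<Longrightarrow> A \<in> sets ES_M \<Longrightarrow> (\<integral>\<^sup>+s. emeasure (ES_law lam h s t) A \<partial>\<nu>) = emeasure \<nu> A) \<Longrightarrow> \<nu> = \<mu>"
proof -
  define p' where "p' = p + 1/m"
  define K where "K = p' * (m + Lam * 2 powr p')"
  have "0 < 1 / m" using m_gt_1 by simp
  then have p': "1 < p'" "p < p'" using p unfolding p'_def by linarith+
  have K0: "0 < K" using p' m_gt_1 Lam_nonneg by (auto simp: K_def intro!: mult_pos_pos add_pos_nonneg)
  have KC: "K < C0" using big by (simp add: K_def p'_def)
  have Kp: "p * (m + Lam * 2 powr p) \<le> K"
    unfolding K_def using p p' Lam_nonneg m_gt_1 by (intro mult_mono add_left_mono mult_left_mono) auto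
  \<comment> \<open>The whole gap between K and C0, turned into a relative margin.\<close>
  define \<eta> where "\<eta> = (C0 - K) / K"
  have \<eta>: "0 < \<eta>" "(1 + \<eta>) * K = C0" using K0 KC by (auto simp: \<eta>_def field_simps)
  have \<eta>p: "(1 + \<eta>) * (p * (m + Lam * 2 powr p)) \<le> C0"
    using \<eta> Kp mult_left_mono[OF Kp, of "1 + \<eta>"] by simp
  have \<eta>p': "(1 + \<eta>) * (p' * (m + Lam * 2 powr p')) \<le> C0" using \<eta> by (simp add: K_def)
  define e where "e = m * p"
  have e: "1 < e" using p m_gt_1 less_1_mult by (simp add: e_def)
  define \<alpha> where "\<alpha> = 1 - 1/e"
  have \<alpha>: "0 < \<alpha>" "\<alpha> < 1" using e by (auto simp: \<alpha>_def)
  define L where "L = (\<lambda>s. age_sum m 0 s powr p)"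
  define L' where "L' = (\<lambda>s. age_sum m 0 s powr p')"
  define k where "k = p * m * \<eta>"
  define k' where "k' = p' * m * \<eta>"
  define B where "B = Lam * (1 + \<eta>) powr (m * p) * 2"
  define B' where "B' = Lam * (1 + \<eta>) powr (m * p') * 2"
  have k: "0 < k" "0 < k'" using p p' m_gt_1 \<eta> by (auto simp: k_def k'_def)
  have B: "0 \<le> B" "0 \<le> B'" using Lam_nonneg by (auto simp: B_def B'_def)
  have L0: "0 \<le> L s" "0 \<le> L' s" for s by (auto simp: L_def L'_def)
  have Lm [measurable]: "L \<in> borel_measurable ES_M" "L' \<in> borel_measurable ES_M" by (simp_all add: L_def L'_def)
  \<comment> \<open>After time 2 the shifted power of the age sum, which dominates L + k L powr
    \<alpha>, has mean at most L + B. Making the larger expression part of V turns k L powr \<alpha>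
    into the loss, while V remains comparable with max 1 L.\<close>
  define V where "V = (\<lambda>s. 1 + L s + k * L s powr \<alpha>)"
  have Vm: "V \<in> borel_measurable ES_M" unfolding V_def by measurable
  have V1: "1 \<le> V s" "L s \<le> V s" for s using L0(1)[of s] k by (auto simp: V_def)
  have V0: "0 \<le> V s" for s using V1(1)[of s] by linarith
  have L\<alpha>: "L s powr \<alpha> \<le> 1 + L s" for s
  proof -
    have "L s powr \<alpha> \<le> \<alpha> * L s + (1 - \<alpha>)" using \<alpha> L0 by (intro powr_le_affine) auto
    also have "\<alpha> * L s \<le> 1 * L s" using \<alpha> L0(1)[of s] by (intro mult_right_mono) auto
    finally show ?thesis using \<alpha> by simp
  qed
  have VL: "V s \<le> (1 + k) * (1 + L s)" for s
    using mult_left_mono[OF L\<alpha>[of s], of k] k by (simp add: V_def distrib_right distrib_left)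
  have VM: "V s \<le> 2 * (1 + k) * max 1 (L s)" for s
  proof -
    have "(1 + k) * (1 + L s) \<le> (1 + k) * (2 * max 1 (L s))" using k by (intro mult_left_mono) auto
    also have "\<dots> = 2 * (1 + k) * max 1 (L s)" by (simp only: mult.assoc mult.commute mult.left_commute)
    finally show ?thesis using VL[of s] by (rule order_trans[rotated])
  qed
  have growth: "V s \<le> 1 + age_sum m \<eta> s powr p" if "s \<in> ES_space" for s
  proof -
    have "L s powr \<alpha> = age_sum m 0 s powr (p - 1/m)"
      using p m_gt_1 by (simp add: L_def powr_powr \<alpha>_def e_def right_diff_distrib)
    then show ?thesis using age_sum_growth[OF that, of m p \<eta>] m_gt_1 p \<eta> by (simp add: V_def k_def L_def)
  qed
  \<comment> \<open>Since p' - 1/m = p, the gain for L' is a multiple of L itself; the second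
    exponent is chosen for this.\<close>
  have growth': "L' s + k' * L s \<le> age_sum m \<eta> s powr p'" if "s \<in> ES_space" for s
    using age_sum_growth[OF that, of m p' \<eta>] m_gt_1 p' \<eta> by (simp add: L'_def k'_def L_def p'_def)
  \<comment> \<open>Speed \<eta>/2 during time 2 produces the shift \<eta>.\<close>
  have lyp: "(\<integral>\<^sup>+y. ennreal (age_sum m \<eta> y powr p) \<partial>ES_law lam h s 2) \<le> ennreal (L s + B)" if "s \<in> ES_space" for s
    using lyapunov[OF that, of p 2 "\<eta>/2" \<eta>] p \<eta>(1) \<eta>p by (simp add: L_def B_def)
  have lyp': "(\<integral>\<^sup>+y. ennreal (age_sum m \<eta> y powr p') \<partial>ES_law lam h s 2) \<le> ennreal (L' s + B')" if "s \<in> ES_space" for s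
    using lyapunov[OF that, of p' 2 "\<eta>/2" \<eta>] p' \<eta>(1) \<eta>p' by (simp add: L'_def B'_def)
  \<comment> \<open>Speed 0: no drift, but a finite moment at every time t.\<close>
  have lyp0: "(\<integral>\<^sup>+y. ennreal (L y) \<partial>ES_law lam h s t) < \<infinity>" if "s \<in> ES_space" "0 \<le> t" for s t
    using lyapunov[OF that(1), of p t 0 \<eta>] p \<eta>(1) \<eta>p that(2) 
    by (simp add: L_def order_le_less_trans[OF _ ennreal_less_top])
  have lyp0': "(\<integral>\<^sup>+y. ennreal (L' y) \<partial>ES_law lam h s 0) < \<infinity>" if "s \<in> ES_space" for s
    using lyapunov[OF that(1), of p' 0 0 \<eta>] p' \<eta>(1) \<eta>p'
    by (simp add: L'_def order_le_less_trans[OF _ ennreal_less_top])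
  \<comment> \<open>Expresses the loss through V instead of L by V <= 2 (1 + k) max 1 L; the price
    is an additive k.\<close>
  define c where "c = k / (2 * (1 + k)) powr \<alpha>"
  have c: "0 < c" using k by (simp add: c_def)
  have cV: "c * V s powr \<alpha> \<le> k * L s powr \<alpha> + k" for s
  proof -
    have "V s powr \<alpha> \<le> ((2 * (1 + k)) * max 1 (L s)) powr \<alpha>"
      using \<alpha> V0 VM by (intro powr_mono2) auto
    also have "\<dots> = (2 * (1 + k)) powr \<alpha> * max 1 (L s) powr \<alpha>" using k by (simp add: powr_mult)
    also have "\<dots> \<le> (2 * (1 + k)) powr \<alpha> * (1 + L s powr \<alpha>)"
      by (intro mult_left_mono) (auto simp: max_def)
    finally have "V s powr \<alpha> \<le> (2 * (1 + k)) powr \<alpha> * (1 + L s powr \<alpha>)" .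
    then have "c * V s powr \<alpha> \<le> c * ((2 * (1 + k)) powr \<alpha> * (1 + L s powr \<alpha>))" using c by (intro mult_left_mono) auto
    also have "\<dots> = k * (1 + L s powr \<alpha>)" using k by (simp add: c_def)
    finally show ?thesis by (simp add: distrib_left)
  qed
  define c' where "c' = k' / (1 + k)"
  have c': "0 < c'" using k by (simp add: c'_def)
  have c'V: "c' * V s \<le> k' + k' * L s" for s
  proof -
    have "c' * V s \<le> c' * ((1 + k) * (1 + L s))" using c' VL by (intro mult_left_mono) auto
    also have "\<dots> = k' * (1 + L s)" using k by (simp add: c'_def)
    finally show ?thesis by (simp add: distrib_left)
  qed
  define x0 :: es_state where "x0 = (0, \<lambda>_. 0)"
  have x0: "x0 \<in> ES_space" by (auto simp: x0_def ES_space_def)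
  interpret D: subgeometric_drift_moment ES_M "\<lambda>t s. ES_law lam h s t" V e c "B + k" 2 L' c' "k' + B'" x0
  proof (intro subgeometric_drift_moment.intro subgeometric_drift.intro markov_semigroup_axioms
      subgeometric_drift_axioms.intro subgeometric_drift_moment_axioms.intro)
    show "V \<in> borel_measurable ES_M" by (rule Vm)
    show "1 \<le> V s" for s by (rule V1)
    show "(0::real) < 2" "1 < e" "0 < c" "0 \<le> B + k" using e c B k by auto
    show "L' \<in> borel_measurable ES_M" "0 \<le> L' s" "0 < c'" "0 \<le> k' + B'" for s using c' k B L0 by auto
    show "x0 \<in> space ES_M" using x0 by simp
    show "(\<integral>\<^sup>+y. ennreal (L' y) \<partial>ES_law lam h x0 0) < \<infinity>" by (rule lyp0'[OF x0])
    show "(\<integral>\<^sup>+y. ennreal (V y) \<partial>ES_law lam h s t) < \<infinity>" if "s \<in> space ES_M" "0 \<le> t" for s t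
    proof -
      have s: "s \<in> ES_space" using that by simp
      define b where "b = enn2real (\<integral>\<^sup>+y. ennreal (L y) \<partial>ES_law lam h s t)"
      have b: "(\<integral>\<^sup>+y. ennreal (L y) \<partial>ES_law lam h s t) \<le> ennreal b" "0 \<le> b"
        using lyp0[OF s that(2)] by (auto simp: b_def)
      have "(\<integral>\<^sup>+y. ennreal (V y) \<partial>ES_law lam h s t) \<le> (\<integral>\<^sup>+y. ennreal (1 + k) * ennreal (1 + L y) \<partial>ES_law lam h s t)"
      proof (rule nn_integral_mono)
        fix y
        have "ennreal (V y) \<le> ennreal ((1 + k) * (1 + L y))" by (rule ennreal_leI[OF VL])
        also have "\<dots> = ennreal (1 + k) * ennreal (1 + L y)" using k L0(1)[of y] by (intro ennreal_mult) auto
        finally show "ennreal (V y) \<le> ennreal (1 + k) * ennreal (1 + L y)" .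
      qed
      also have "\<dots> = ennreal (1 + k) * (\<integral>\<^sup>+y. ennreal (1 + L y) \<partial>ES_law lam h s t)"
        using that by (intro nn_integral_cmult measurable_P) auto
      also have "\<dots> \<le> ennreal (1 + k) * ennreal (1 + b)"
        using b L0 by (intro mult_left_mono nn_integral_ES_law_add_const[OF s that(2) Lm(1)]) auto
      also have "\<dots> < \<infinity>" by (simp add: ennreal_mult_less_top)
      finally show ?thesis .
    qed
    show "(\<integral>\<^sup>+y. ennreal (V y) \<partial>ES_law lam h s 2) \<le> ennreal (V s - c * V s powr (1 - 1/e) + (B + k))" if "s \<in> space ES_M" for s
    proof -
      have s: "s \<in> ES_space" using that by simp
      have "(\<integral>\<^sup>+y. ennreal (V y) \<partial>ES_law lam h s 2) \<le> (\<integral>\<^sup>+y. ennreal (1 + age_sum m \<eta> y powr p) \<partial>ES_law lam h s 2)"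
        using growth by (intro nn_integral_mono ennreal_leI) auto
      also have "\<dots> \<le> ennreal (1 + (L s + B))"
        using lyp[OF s] L0 B by (intro nn_integral_ES_law_add_const s) auto
      also have "\<dots> \<le> ennreal (V s - c * V s powr (1 - 1/e) + (B + k))"
        using cV[of s] by (intro ennreal_leI) (simp add: V_def \<alpha>_def[symmetric])
      finally show ?thesis .
    qed
    show "(\<integral>\<^sup>+y. ennreal (L' y + c' * V y) \<partial>ES_law lam h s 2) \<le> ennreal (L' s + (k' + B'))" if "s \<in> space ES_M" for s
    proof -
      have s: "s \<in> ES_space" using that by simp
      have "L' y + c' * V y \<le> k' + age_sum m \<eta> y powr p'" if "y \<in> ES_space" for y
        using growth'[OF that] c'V[of y] by simp
      then have "(\<integral>\<^sup>+y. ennreal (L' y + c' * V y) \<partial>ES_law lam h s 2) \<le> (\<integral>\<^sup>+y. ennreal (k' + age_sum m \<eta> y powr p') \<partial>ES_law lam h s 2)"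
        by (intro nn_integral_mono ennreal_leI) auto
      also have "\<dots> \<le> ennreal (k' + (L' s + B'))"
        using lyp'[OF s] L0 B k by (intro nn_integral_ES_law_add_const s) auto
      finally show ?thesis by (simp add: ac_simps)
    qed
    show "\<exists>\<epsilon>>0. \<exists>N. prob_space N \<and> sets N = sets ES_M \<and>
      (\<forall>s\<in>space ES_M. V s \<le> R \<longrightarrow> (\<forall>A\<in>sets ES_M. ennreal \<epsilon> * emeasure N A \<le> emeasure (ES_law lam h s 2) A))" for R
    proof -
      \<comment> \<open>If S exceeds 1, then S <= S powr p <= V because p > 1; so sublevel sets of V
        lie in sublevel sets of the age sum.\<close>
      have "age_sum m 0 s \<le> max 1 R" if "V s \<le> R" for s
      proof (cases "age_sum m 0 s \<le> 1")
        case False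
        then have "age_sum m 0 s powr 1 \<le> L s" unfolding L_def using p by (intro powr_mono) auto
        then show ?thesis using False V1(2)[of s] that by simp
      qed simp
      then show ?thesis using ES_minorization[of "max 1 R"] by (simp only: space_ES_M) blast
    qed
  qed
  obtain \<mu> where \<mu>: "sets \<mu> = sets ES_M" "prob_space \<mu>"
    "\<And>t A. 0 \<le> t \<Longrightarrow> A \<in> sets ES_M \<Longrightarrow> (\<integral>\<^sup>+s. emeasure (ES_law lam h s t) A \<partial>\<mu>) = emeasure \<mu> A"
    "\<exists>C>0. \<forall>s\<in>space ES_M. \<forall>A\<in>sets ES_M. \<forall>t\<ge>0. \<bar>measure (ES_law lam h s t) A - measure \<mu> A\<bar> \<le> C * V s * (1 + t) powr (- e)"
    "\<And>\<nu>. sets \<nu> = sets ES_M \<Longrightarrow> prob_space \<nu> \<Longrightarrow>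
      (\<And>t A. 0 \<le> t \<Longrightarrow> A \<in> sets ES_M \<Longrightarrow> (\<integral>\<^sup>+s. emeasure (ES_law lam h s t) A \<partial>\<nu>) = emeasure \<nu> A) \<Longrightarrow> \<nu> = \<mu>"
    using D.invariant_law by blast
  obtain C where C: "0 < C" "\<And>s A t. s \<in> ES_space \<Longrightarrow> A \<in> sets ES_M \<Longrightarrow> 0 \<le> t \<Longrightarrow>
      \<bar>measure (ES_law lam h s t) A - measure \<mu> A\<bar> \<le> C * V s * (1 + t) powr (- e)"
    using \<mu>(4) by auto
  show thesis
  proof (rule that[OF \<mu>(1-3), of "C * (2 * (1 + k))"])
    show "0 < C * (2 * (1 + k))" using C k by simp
    fix s A and t :: real assume h: "s \<in> ES_space" "A \<in> sets ES_M" "0 \<le> t"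
    have "C * V s * (1 + t) powr (- e) \<le> C * (2 * (1 + k) * max 1 (L s)) * (1 + t) powr (- e)"
      using C(1) VM by (intro mult_right_mono mult_left_mono) auto
    then show "\<bar>measure (ES_law lam h s t) A - measure \<mu> A\<bar> \<le> C * (2 * (1 + k)) * max 1 (ES_L m p s) * (1 + t) powr (- (m * p))"
      using C(2)[OF h] by (simp add: ES_L_eq L_def e_def mult.assoc)
  qed (assumption | rule \<mu>(5))+
qed

end

section \<open>Regularity of the hazard rate of the service distribution\<close>

context
  fixes G g :: "real \<Rightarrow> real" and C0 :: real
  assumes g_nonneg: "\<forall>t\<ge>0. 0 \<le> g t"
    and G_deriv: "\<forall>t\<ge>0. (G has_real_derivative g t) (at t within {0..})"
    and G_lim: "(G \<longlongrightarrow> 1) at_top"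
    and C0_pos: "C0 > 0" and h_lower: "\<forall>t\<ge>0. hazard G g t \<ge> C0 / (1 + t)"
begin

text \<open>G increases to its limit 1. If it attained 1 at t, division by zero would make
  \<open>hazard\<close> equal to 0 there, against the positive lower bound.\<close>

lemma G_less_1:
  assumes "0 \<le> t"
  shows "G t < 1"
proof -
  have mono: "G x \<le> G y" if "0 \<le> x" "x \<le> y" for x y
  proof -
    have "(g has_integral (G y - G x)) {x..y}"
    proof (rule fundamental_theorem_of_calculus[OF that(2)])
      fix z assume z: "z \<in> {x..y}"
      have "(G has_real_derivative g z) (at z within {x..y})"
        by (rule DERIV_subset[of _ _ _ "{0..}"]) (use G_deriv z that in auto)
      then show "(G has_vector_derivative g z) (at z within {x..y})"
        by (rule has_real_derivative_iff_has_vector_derivative[THEN iffD1])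
    qed
    then have "0 \<le> G y - G x" by (rule has_integral_nonneg) (use g_nonneg that in auto)
    then show ?thesis by simp
  qed
  have "eventually (\<lambda>y. G t \<le> G y) at_top"
    using eventually_ge_at_top[of t] by eventually_elim (use mono assms in auto)
  then have "G t \<le> 1" by (intro tendsto_lowerbound[OF G_lim]) auto
  moreover have "G t \<noteq> 1"
  proof
    assume "G t = 1"
    then have "hazard G g t = 0" by (simp add: hazard_def)
    moreover have "0 < C0 / (1 + t)" using C0_pos assms by simp
    ultimately show False using h_lower assms by fastforce
  qed
  ultimately show ?thesis by simp
qed

lemma hazard_nonneg: "0 \<le> t \<Longrightarrow> 0 \<le> hazard G g t"
  using g_nonneg G_less_1[of t] by (simp add: hazard_def)

text \<open>Measurability of g comes from its being a derivative: it is the pointwise limit of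
  difference quotients of the continuous G. They are taken to the right, which also works at the
  endpoint 0.\<close>

lemma hazard_measurable: "(\<lambda>t. hazard G g (max 0 t)) \<in> borel_measurable borel"
proof -
  have Gc: "continuous_on {0..} G" using G_deriv by (intro DERIV_continuous_on) auto
  have Gm: "(\<lambda>t. G (max 0 t + c)) \<in> borel_measurable borel" if "0 \<le> c" for c
    by (intro borel_measurable_continuous_onI continuous_on_compose2[OF Gc] continuous_intros) (use that in auto)
  have "(\<lambda>t. g (max 0 t)) \<in> borel_measurable borel"
  proof (rule borel_measurable_LIMSEQ_real)
    show "(\<lambda>t. (G (max 0 t + 1 / real (Suc n)) - G (max 0 t + 0)) / (1 / real (Suc n))) \<in> borel_measurable borel" for n
      by (intro borel_measurable_divide borel_measurable_diff Gm) auto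
    fix t :: real
    let ?t = "max 0 t"
    have "((\<lambda>y. (G y - G ?t) / (y - ?t)) \<longlongrightarrow> g ?t) (at ?t within {0..})"
      using G_deriv by (simp add: has_field_derivative_iff)
    moreover have "filterlim (\<lambda>n. ?t + 1 / real (Suc n)) (at ?t within {0..}) sequentially"
      unfolding filterlim_at
    proof
      show "eventually (\<lambda>n. ?t + 1 / real (Suc n) \<in> {0..} \<and> ?t + 1 / real (Suc n) \<noteq> ?t) sequentially"
        by (intro always_eventually) auto
      show "(\<lambda>n. ?t + 1 / real (Suc n)) \<longlonglongrightarrow> ?t"
        using tendsto_add[OF tendsto_const[of ?t] LIMSEQ_inverse_real_of_nat] by (simp add: inverse_eq_divide)
    qed
    ultimately have "(\<lambda>n. (G (?t + 1 / real (Suc n)) - G ?t) / (?t + 1 / real (Suc n) - ?t)) \<longlonglongrightarrow> g ?t"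
      by (rule filterlim_compose)
    then show "(\<lambda>n. (G (?t + 1 / real (Suc n)) - G (?t + 0)) / (1 / real (Suc n))) \<longlonglongrightarrow> g ?t" by simp
  qed
  moreover have "(\<lambda>t. G (max 0 t)) \<in> borel_measurable borel" using Gm[of 0] by simp
  ultimately show ?thesis unfolding hazard_def by measurable
qed

text \<open>- ln (1 - G) is an antiderivative, finite because G < 1. The fundamental theorem holds
  for the gauge integral without continuity of g, and nonnegativity makes the integral a Lebesgue
  integral.\<close>

lemma hazard_integrable:
  assumes x: "0 \<le> x" and t: "0 \<le> t"
  shows "(\<integral>\<^sup>+r\<in>{0..t}. ennreal (hazard G g (x + r)) \<partial>lborel) < \<infinity>"
proof -
  have "((\<lambda>r. hazard G g (x + r)) has_integral - ln (1 - G (x + t)) - (- ln (1 - G (x + 0)))) {0..t}"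
  proof (rule fundamental_theorem_of_calculus[OF t])
    fix r assume r: "r \<in> {0..t}"
    have "(G has_real_derivative g (x + r)) (at (x + r) within (\<lambda>r. x + r) ` {0..t})"
      by (rule DERIV_subset[of _ _ _ "{0..}"]) (use G_deriv x r in auto)
    then have "((\<lambda>r. G (x + r)) has_real_derivative g (x + r) * 1) (at r within {0..t})"
      by (rule DERIV_image_chain[where g="\<lambda>r. x + r", unfolded o_def]) (auto intro!: derivative_eq_intros)
    then have "((\<lambda>r. - ln (1 - G (x + r))) has_real_derivative hazard G g (x + r)) (at r within {0..t})"
      using G_less_1[of "x + r"] x r by (auto intro!: derivative_eq_intros simp: hazard_def)
    then show "((\<lambda>r. - ln (1 - G (x + r))) has_vector_derivative hazard G g (x + r)) (at r within {0..t})"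
      by (rule has_real_derivative_iff_has_vector_derivative[THEN iffD1])
  qed
  then have "integral\<^sup>N lborel (\<lambda>r. ennreal (indicator {0..t} r * hazard G g (x + r))) < \<infinity>"
    by (subst nn_integral_has_integral_lebesgue) (use hazard_nonneg x in auto)
  also have "integral\<^sup>N lborel (\<lambda>r. ennreal (indicator {0..t} r * hazard G g (x + r))) = (\<integral>\<^sup>+r\<in>{0..t}. ennreal (hazard G g (x + r)) \<partial>lborel)"
    by (intro nn_integral_cong) (auto split: split_indicator)
  finally show ?thesis .
qed

end

text \<open>\<open>ES_L\<close> vanishes on empty states. A bound by it alone would force the laws
  started there to equal \<mu> at all times; the factor \<open>max 1\<close> avoids this.\<close>

theorem theorem1:
  fixes lam :: "es_state \<Rightarrow> real"
    and G g :: "real \<Rightarrow> real"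
    and C0 m a l :: real
  assumes G_zero: "G 0 = 0"
    and g_nonneg: "\<forall>t\<ge>0. 0 \<le> g t"
    and G_deriv: "\<forall>t\<ge>0. (G has_real_derivative g t) (at t within {0..})"
    and G_lim: "(G \<longlongrightarrow> 1) at_top"
    and lam_meas: "lam \<in> borel_measurable ES_M"
    and lam_nonneg: "\<forall>s\<in>ES_space. 0 \<le> lam s"
    and C0_pos: "C0 > 0" and m_gt: "m > 1" and a_gt: "a > 1" and l_pos: "l > 0"
    and h_lower: "\<forall>t\<ge>0. hazard G g t \<ge> C0 / (1 + t)"
    and lam0_pos: "(INF y\<in>{0..}. lam (ES_empty y)) > 0"
    and Lambda_fin: "bdd_above ((\<lambda>s. lam s / real (max 1 (fst s))) ` ES_space)"
    and C0_big: "C0 > (a + (l + 1) / m) * (m + ES_Lambda lam * 2 powr (a + (l + 1) / m))"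
  shows "\<exists>\<mu>. ES_stationary lam (hazard G g) \<mu> \<and>
            (\<forall>\<nu>. ES_stationary lam (hazard G g) \<nu> \<longrightarrow> \<nu> = \<mu>) \<and>
            (\<forall>k::real. 0 < k \<and> k < l \<longrightarrow>
               (\<exists>C>0. \<forall>s\<in>ES_space. \<forall>t\<ge>0.
                  tv_dist (ES_law lam (hazard G g) s t) \<mu>
                    \<le> C * max 1 (ES_L m (a + l / m) s) / (1 + t) powr (k + 1)))"
proof -
  define h where "h = hazard G g"
  define lmin where "lmin = (INF y\<in>{0..}. lam (ES_empty y))"
  have emp: "ES_empty y \<in> ES_space" if "0 \<le> y" for y using that by (auto simp: ES_empty_def ES_space_def)
  \<comment> \<open>A real infimum is a lower bound only for sets that are bounded below.\<close>
  have bdd: "bdd_below ((\<lambda>y. lam (ES_empty y)) ` {0..})"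
    using lam_nonneg emp by (intro bdd_belowI2[of _ 0]) auto
  interpret ES_heavy_service lam h "ES_Lambda lam" C0 m lmin
  proof
    show "lam \<in> borel_measurable ES_M" "0 < C0" "1 < m" by fact+
    show "0 \<le> lam s" if "s \<in> ES_space" for s using lam_nonneg that by auto
    show "lam s \<le> ES_Lambda lam * real (max 1 (fst s))" if "s \<in> ES_space" for s
    proof -
      have "lam s / real (max 1 (fst s)) \<le> ES_Lambda lam"
        unfolding ES_Lambda_def using Lambda_fin that by (intro cSUP_upper)
      then show ?thesis by (simp add: divide_le_eq split: if_splits)
    qed
    show "(\<lambda>t. h (max 0 t)) \<in> borel_measurable borel"
      unfolding h_def by (rule hazard_measurable[OF g_nonneg G_deriv G_lim C0_pos h_lower])
    show "0 \<le> h x" if "0 \<le> x" for x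
      unfolding h_def by (rule hazard_nonneg[OF g_nonneg G_deriv G_lim C0_pos h_lower that])
    show "(\<integral>\<^sup>+r\<in>{0..t}. ennreal (h (x + r)) \<partial>lborel) < \<infinity>" if "0 \<le> x" "0 \<le> t" for x t
      unfolding h_def by (rule hazard_integrable[OF g_nonneg G_deriv G_lim C0_pos h_lower that])
    show "C0 / (1 + x) \<le> h x" if "0 \<le> x" for x using h_lower that by (simp add: h_def)
    show "0 < lmin" using lam0_pos by (simp add: lmin_def)
    show "lmin \<le> lam (ES_empty y)" if "0 \<le> y" for y
      unfolding lmin_def using bdd that by (intro cINF_lower) auto
  qed
  define p where "p = a + l / m"
  have "0 < l / m" using l_pos m_gt by simp
  then have p: "1 < p" using a_gt unfolding p_def by linarith
  have p': "p + 1/m = a + (l + 1) / m" by (simp add: p_def add_divide_distrib)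
  \<comment> \<open>The exponent m p = m a + l is at least l + 1 since m a > 1, hence above k + 1
    for every k < l.\<close>
  have rate_exp: "l + 1 \<le> m * p"
  proof -
    have "m * p = m * a + l" using m_gt by (simp add: p_def distrib_left)
    moreover have "1 \<le> m * a" using less_1_mult[OF m_gt a_gt] by simp
    ultimately show ?thesis by simp
  qed
  obtain \<mu> D where \<mu>: "sets \<mu> = sets ES_M" "prob_space \<mu>"
    "\<And>t A. 0 \<le> t \<Longrightarrow> A \<in> sets ES_M \<Longrightarrow> (\<integral>\<^sup>+s. emeasure (ES_law lam h s t) A \<partial>\<mu>) = emeasure \<mu> A"
    and D: "0 < D" "\<And>s A t. s \<in> ES_space \<Longrightarrow> A \<in> sets ES_M \<Longrightarrow> 0 \<le> t \<Longrightarrow>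
      \<bar>measure (ES_law lam h s t) A - measure \<mu> A\<bar> \<le> D * max 1 (ES_L m p s) * (1 + t) powr (- (m * p))"
    and unique: "\<And>\<nu>. sets \<nu> = sets ES_M \<Longrightarrow> prob_space \<nu> \<Longrightarrow>
      (\<And>t A. 0 \<le> t \<Longrightarrow> A \<in> sets ES_M \<Longrightarrow> (\<integral>\<^sup>+s. emeasure (ES_law lam h s t) A \<partial>\<nu>) = emeasure \<nu> A) \<Longrightarrow> \<nu> = \<mu>"
    using polynomial_ergodicity[OF p] C0_big unfolding p' by blast
  have stat_iff: "(\<integral>\<^sup>+s. ES_trans lam h s t A \<partial>\<nu>) = (\<integral>\<^sup>+s. emeasure (ES_law lam h s t) A \<partial>\<nu>)"
    if "sets \<nu> = sets ES_M" "0 \<le> t" "A \<in> sets ES_M" for \<nu> t A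
    using sets_eq_imp_space_eq[OF that(1)] that(2,3) by (intro nn_integral_cong) (simp add: emeasure_ES_law)
  have "ES_stationary lam h \<mu>"
    unfolding ES_stationary_def using \<mu> by (simp add: stat_iff)
  moreover have "\<nu> = \<mu>" if "ES_stationary lam h \<nu>" for \<nu>
    using that unfolding ES_stationary_def by (intro unique) (auto simp: stat_iff[symmetric])
  moreover have "tv_dist (ES_law lam h s t) \<mu> \<le> D * max 1 (ES_L m p s) / (1 + t) powr (k + 1)"
    if k: "0 < k" "k < l" and s: "s \<in> ES_space" and t: "0 \<le> t" for k s t
    unfolding tv_dist_def
  proof (rule cSUP_least)
    show "sets (ES_law lam h s t) \<noteq> {}" by (simp add: sets.top[of ES_M, THEN ex_in_conv[THEN iffD1, OF exI]])
    fix A assume "A \<in> sets (ES_law lam h s t)"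
    then have "\<bar>measure (ES_law lam h s t) A - measure \<mu> A\<bar> \<le> D * max 1 (ES_L m p s) * (1 + t) powr (- (m * p))"
      using D(2) s t by simp
    also have "\<dots> \<le> D * max 1 (ES_L m p s) * (1 + t) powr (- (k + 1))"
      using D(1) t k rate_exp by (intro mult_left_mono powr_mono) auto
    finally show "\<bar>measure (ES_law lam h s t) A - measure \<mu> A\<bar> \<le> D * max 1 (ES_L m p s) / (1 + t) powr (k + 1)"
      by (simp only: powr_minus_divide times_divide_eq_right mult_1_right)
  qed
  ultimately show ?thesis using D(1) unfolding h_def[symmetric] p_def[symmetric] by blast
qed

end
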